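(* Let $j_1=j_2=j_3=\tfrac12$. Then the map $\overline{\phi}:\overline{AW}(\tfrac12,\tfrac12,\tfrac12)\to\mathcal{C}_{\frac12,\frac12,\frac12}$ given by $\overline{\phi}(A)=C_{12}$, $\overline{\phi}(B)=C_{23}$, $\overline{\phi}(K)=C_{123}$ is an algebra isomorphism.
   Context: Throughout, $q\in\mathbb{C}$ is nonzero and not a root of unity, a square root $q^{1/2}$ is fixed so that $q^m$ makes sense for half-integers $m$, and all algebras are unital associative algebras over $\mathbb{C}$. The quantum algebra $U_q(\mathfrak{sl}_2)$ is generated by $E$, $F$ and the invertible element $q^H$ with relations $q^HE=qEq^H$, $q^HF=q^{-1}Fq^H$, $[E,F]=\frac{q^{2H}-q^{-2H}}{q-q^{-1}}$. Its central Casimir element is $\Gamma=(q-q^{-1})^2FE+q\,q^{2H}+q^{-1}q^{-2H}$. The comultiplication $\Delta$ is the algebra homomorphism with $\Delta(E)=E\otimes q^{-H}+q^H\otimes E$, $\Delta(F)=F\otimes q^{-H}+q^H\otimes F$, $\Delta(q^H)=q^H\otimes q^H$; it is coassociative, and $\Delta^{(2)}=(\Delta\otimes\mathrm{id})\Delta=(\mathrm{id}\otimes\Delta)\Delta$. For $j\in\{0,\tfrac12,1,\dots\}$, $M_j$ denotes the spin-$j$ representation, i.e. the irreducible representation of dimension $2j+1$ generated by a vector $v$ with $Ev=0$, $q^Hv=q^jv$, and $\pi_j$ is the representation map. One has $\pi_j(\Gamma)=\chi_j\,\mathrm{Id}$ with $\chi_j=q^{2j+1}+q^{-2j-1}$.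 Write $\pi_{j_1,j_2,j_3}=\pi_{j_1}\otimes\pi_{j_2}\otimes\pi_{j_3}$. The centralizer is $$\mathcal{C}_{j_1,j_2,j_3}=\{m\in\mathrm{End}(M_{j_1}\otimes M_{j_2}\otimes M_{j_3}) : [\pi_{j_1,j_2,j_3}(\Delta^{(2)}(x)),m]=0\ \ \forall x\in U_q(\mathfrak{sl}_2)\}.$$ It contains the images under $\pi_{j_1,j_2,j_3}$: $C_{12}$ of $\Delta(\Gamma)\otimes1$, $C_{23}$ of $1\otimes\Delta(\Gamma)$, and $C_{123}$ of $\Delta^{(2)}(\Gamma)$. Sets: $\mathcal{J}(j_1,j_2)=\{|j_1-j_2|,|j_1-j_2|+1,\dots,j_1+j_2\}$, $\mathcal{J}(j_1,j_2,j_3)=\bigcup_{j\in\mathcal{J}(j_1,j_2)}\mathcal{J}(j,j_3)$, $\mathcal{M}(j_a,j_b,j_c)=\bigcup_{j\in\mathcal{J}(j_a,j_b)}\{\chi_\ell-\chi_j : \ell\in\mathcal{J}(j,j_c)\}$ (all sets without repetition). With $[X,Y]_q=qXY-q^{-1}YX$, the centrally extended Askey--Wilson algebra $AW(3)$ is the algebra generated by $A,B,D$ and central elements $\alpha_1,\alpha_2,\alpha_3,K$ with defining relations $$A+\frac{[B,D]_q}{q^2-q^{-2}}=\frac{\alpha_1\alpha_2+\alpha_3K}{q+q^{-1}},\quad B+\frac{[D,A]_q}{q^2-q^{-2}}=\frac{\alpha_2\alpha_3+\alpha_1K}{q+q^{-1}},\quad D+\frac{[A,B]_q}{q^2-q^{-2}}=\frac{\alpha_1\alpha_3+\alpha_2K}{q+q^{-1}}.$$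 The element $D'\in AW(3)$ is defined by $D'+\frac{[B,A]_q}{q^2-q^{-2}}=\frac{\alpha_1\alpha_3+\alpha_2K}{q+q^{-1}}$, and $$\Omega=qA(\alpha_1\alpha_2+\alpha_3K)+q^{-1}B(\alpha_2\alpha_3+\alpha_1K)+qD(\alpha_1\alpha_3+\alpha_2K)-q^2A^2-q^{-2}B^2-q^2D^2-qABD.$$ The algebra $\overline{AW}(j_1,j_2,j_3)$ is the quotient of $AW(3)$ by the relations: $\alpha_i=\chi_{j_i}$ ($i=1,2,3$); $\prod_{j\in\mathcal{J}(j_1,j_2)}(A-\chi_j)=0$; $\prod_{j\in\mathcal{J}(j_2,j_3)}(B-\chi_j)=0$; $\prod_{j\in\mathcal{J}(j_1,j_2,j_3)}(K-\chi_j)=0$; $\prod_{j\in\mathcal{J}(j_1,j_3)}(D-\chi_j)=0$; $\prod_{j\in\mathcal{J}(j_1,j_3)}(D'-\chi_j)=0$; $\prod_{m\in\mathcal{M}(j_1,j_2,j_3)}(K-A-m)=0$; $\prod_{m\in\mathcal{M}(j_2,j_3,j_1)}(K-B-m)=0$; $\prod_{m\in\mathcal{M}(j_1,j_3,j_2)}(K-D-m)=0$; $\prod_{m\in\mathcal{M}(j_1,j_3,j_2)}(K-D'-m)=0$; and $\Omega=\chi_{j_1}^2+\chi_{j_2}^2+\chi_{j_3}^2+K^2+\chi_{j_1}\chi_{j_2}\chi_{j_3}K-(q+q^{-1})^2$. *)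

theory Defs
  imports
    "HOL-Analysis.Analysis"
    "HOL-Algebra.QuotRing"
    "HOL-Algebra.Module"
    "HOL-Library.Poly_Mapping"
    "HOL-Computational_Algebra.Polynomial"
begin

section \<open>Complex algebras and their quotients\<close>

text \<open>
  An algebra over the complex numbers is carried by the record type \<^typ>\<open>(complex, 'a) module\<close>,
  which contains the ring operations and the scalar multiplication. The library's locale
  algebra is restricted to commutative rings, hence the following notions of morphism.
\<close>

type_synonym 'a calgebra = "(complex, 'a) module"

definition alg_hom :: "'a calgebra \<Rightarrow> 'b calgebra \<Rightarrow> ('a \<Rightarrow> 'b) set" where
  "alg_hom A B = {h \<in> ring_hom A B. \<forall>c. \<forall>x\<in>carrier A. h (c \<odot>\<^bsub>A\<^esub> x) = c \<odot>\<^bsub>B\<^esub> h x}"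

definition alg_iso :: "'a calgebra \<Rightarrow> 'b calgebra \<Rightarrow> ('a \<Rightarrow> 'b) set" where
  "alg_iso A B = {h \<in> alg_hom A B. bij_betw h (carrier A) (carrier B)}"

definition quot_alg :: "'a calgebra \<Rightarrow> 'a set \<Rightarrow> 'a set calgebra" where
  "quot_alg A I = ring.extend (A Quot I)
     (module.fields (\<lambda>c X. \<Union>x\<in>X. I +>\<^bsub>A\<^esub> (c \<odot>\<^bsub>A\<^esub> x)))"

text \<open>
  \<^term>\<open>mon_alg\<close> is the algebra of a monoid, written additively because the product of
  \<^typ>\<open>'m \<Rightarrow>\<^sub>0 complex\<close> is the convolution along addition of exponents. For lists under
  concatenation it is the free algebra, and for pairs it is the tensor product of the two
  monoid algebras.
\<close>

definition cst :: "complex \<Rightarrow> ('m::monoid_add \<Rightarrow>\<^sub>0 complex)" where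
  "cst c = Poly_Mapping.single 0 c"

definition mon_alg :: "('m::monoid_add \<Rightarrow>\<^sub>0 complex) calgebra" where
  "mon_alg = \<lparr>carrier = UNIV, mult = (*), one = 1, zero = 0, add = (+),
     smult = (\<lambda>c x. cst c * x)\<rparr>"

instantiation list :: (type) monoid_add
begin

definition zero_list :: "'a list" where "zero_list = []"

definition plus_list :: "'a list \<Rightarrow> 'a list \<Rightarrow> 'a list" where "plus_list xs ys = xs @ ys"

instance by standard (simp_all add: zero_list_def plus_list_def)

end

type_synonym 'g free_alg = "'g list \<Rightarrow>\<^sub>0 complex"

abbreviation mon :: "'m \<Rightarrow> ('m \<Rightarrow>\<^sub>0 complex)" where
  "mon m \<equiv> Poly_Mapping.single m 1"

abbreviation gen :: "'g \<Rightarrow> 'g free_alg" where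
  "gen g \<equiv> mon [g]"

definition lin_ext :: "('m \<Rightarrow> ('n::monoid_add \<Rightarrow>\<^sub>0 complex)) \<Rightarrow> ('m \<Rightarrow>\<^sub>0 complex) \<Rightarrow> ('n \<Rightarrow>\<^sub>0 complex)" where
  "lin_ext f x = (\<Sum>m\<in>Poly_Mapping.keys x. cst (Poly_Mapping.lookup x m) * f m)"

abbreviation mon_quot :: "('m::monoid_add \<Rightarrow>\<^sub>0 complex) set \<Rightarrow> ('m \<Rightarrow>\<^sub>0 complex) set calgebra" where
  "mon_quot I \<equiv> quot_alg mon_alg I"

abbreviation cls :: "('m::monoid_add \<Rightarrow>\<^sub>0 complex) set \<Rightarrow> ('m \<Rightarrow>\<^sub>0 complex) \<Rightarrow> ('m \<Rightarrow>\<^sub>0 complex) set" where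
  "cls I x \<equiv> I +>\<^bsub>mon_alg\<^esub> x"

abbreviation two_sided_ideal :: "('m::monoid_add \<Rightarrow>\<^sub>0 complex) set \<Rightarrow> ('m \<Rightarrow>\<^sub>0 complex) set" where
  "two_sided_ideal R \<equiv> Idl\<^bsub>mon_alg\<^esub> R"

text \<open>
  The map into the quotient by \<^term>\<open>J\<close> induced by \<^term>\<open>f\<close>. The union is a single coset when
  \<^term>\<open>f\<close> maps the ideal of the source into \<^term>\<open>J\<close>.
\<close>

definition quot_map :: "('n::monoid_add \<Rightarrow>\<^sub>0 complex) set \<Rightarrow> ('a \<Rightarrow> ('n \<Rightarrow>\<^sub>0 complex))
    \<Rightarrow> 'a set \<Rightarrow> ('n \<Rightarrow>\<^sub>0 complex) set" where
  "quot_map J f X = (\<Union>x\<in>X. cls J (f x))"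

definition tens :: "('m \<Rightarrow>\<^sub>0 complex) \<Rightarrow> ('n \<Rightarrow>\<^sub>0 complex) \<Rightarrow> ('m \<times> 'n \<Rightarrow>\<^sub>0 complex)" where
  "tens x y = (\<Sum>a\<in>Poly_Mapping.keys x. \<Sum>b\<in>Poly_Mapping.keys y.
     Poly_Mapping.single (a, b) (Poly_Mapping.lookup x a * Poly_Mapping.lookup y b))"

text \<open>
  The kernel of the projection of a tensor product of two monoid algebras onto the tensor
  product of their quotients by \<^term>\<open>I\<close> and \<^term>\<open>J\<close>; the latter tensor product is
  therefore \<^term>\<open>mon_quot (tens_ideal I J)\<close>.
\<close>

definition tens_ideal :: "('m::monoid_add \<Rightarrow>\<^sub>0 complex) set \<Rightarrow> ('n::monoid_add \<Rightarrow>\<^sub>0 complex) set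
    \<Rightarrow> ('m \<times> 'n \<Rightarrow>\<^sub>0 complex) set" where
  "tens_ideal I J = two_sided_ideal ({tens x 1 |x. x \<in> I} \<union> {tens 1 y |y. y \<in> J})"


section \<open>Matrix algebras and tensor products of representations\<close>

definition mat_scale :: "complex \<Rightarrow> complex^'n^'n \<Rightarrow> complex^'n^'n" where
  "mat_scale c M = (\<chi> i j. c * M $ i $ j)"

definition mat_alg :: "(complex^'n^'n) calgebra" where
  "mat_alg = \<lparr>carrier = UNIV, mult = (**), one = mat 1, zero = 0, add = (+), smult = mat_scale\<rparr>"

definition kron :: "complex^'a^'a \<Rightarrow> complex^'b^'b \<Rightarrow> complex^('a \<times> 'b)^('a \<times> 'b)" where
  "kron M N = (\<chi> i j. M $ fst i $ fst j * N $ snd i $ snd j)"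

text \<open>
  The representation \<open>\<rho> \<otimes> \<sigma>\<close> of the tensor product \<^term>\<open>mon_quot (tens_ideal I J)\<close>, where
  \<open>\<rho>\<close> and \<open>\<sigma>\<close> are representations of \<^term>\<open>mon_quot I\<close> and \<^term>\<open>mon_quot J\<close>.
\<close>

definition rep_tens :: "('m::monoid_add \<Rightarrow>\<^sub>0 complex) set \<Rightarrow> ('n::monoid_add \<Rightarrow>\<^sub>0 complex) set
    \<Rightarrow> (('m \<Rightarrow>\<^sub>0 complex) set \<Rightarrow> complex^'a^'a) \<Rightarrow> (('n \<Rightarrow>\<^sub>0 complex) set \<Rightarrow> complex^'b^'b)
    \<Rightarrow> ('m \<times> 'n \<Rightarrow>\<^sub>0 complex) set \<Rightarrow> complex^('a \<times> 'b)^('a \<times> 'b)" where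
  "rep_tens I J \<rho> \<sigma> X = the_elem
     ((\<lambda>x. \<Sum>m\<in>Poly_Mapping.keys x. mat_scale (Poly_Mapping.lookup x m)
         (kron (\<rho> (cls I (mon (fst m)))) (\<sigma> (cls J (mon (snd m)))))) ` X)"


section \<open>The quantum algebra\<close>

text \<open>The generators are $E$, $F$, $q^H$ and $q^{-H}$.\<close>

datatype uq_gen = gE | gF | gK | gKinv

type_synonym uq_word = "uq_gen list"

definition uq_rels :: "complex \<Rightarrow> uq_gen free_alg set" where
  "uq_rels q =
    {gen gK * gen gKinv - 1,
     gen gKinv * gen gK - 1,
     gen gK * gen gE - cst q * gen gE * gen gK,
     gen gK * gen gF - cst (inverse q) * gen gF * gen gK,
     gen gE * gen gF - gen gF * gen gE
       - cst (1 / (q - inverse q)) * (gen gK ^ 2 - gen gKinv ^ 2)}"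

definition uq_ideal :: "complex \<Rightarrow> (uq_word \<Rightarrow>\<^sub>0 complex) set" where
  "uq_ideal q = two_sided_ideal (uq_rels q)"

definition uq_ideal2 :: "complex \<Rightarrow> (uq_word \<times> uq_word \<Rightarrow>\<^sub>0 complex) set" where
  "uq_ideal2 q = tens_ideal (uq_ideal q) (uq_ideal q)"

definition uq_ideal3 :: "complex \<Rightarrow> (uq_word \<times> uq_word \<times> uq_word \<Rightarrow>\<^sub>0 complex) set" where
  "uq_ideal3 q = tens_ideal (uq_ideal q) (uq_ideal2 q)"

definition Uq :: "complex \<Rightarrow> (uq_word \<Rightarrow>\<^sub>0 complex) set calgebra" where
  "Uq q = mon_quot (uq_ideal q)"

definition casimir :: "complex \<Rightarrow> (uq_word \<Rightarrow>\<^sub>0 complex) set" where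
  "casimir q = cls (uq_ideal q)
     (cst ((q - inverse q)^2) * gen gF * gen gE + cst q * gen gK ^ 2 + cst (inverse q) * gen gKinv ^ 2)"

fun coprod_gen :: "uq_gen \<Rightarrow> (uq_word \<times> uq_word \<Rightarrow>\<^sub>0 complex)" where
  "coprod_gen gE = tens (gen gE) (gen gKinv) + tens (gen gK) (gen gE)"
| "coprod_gen gF = tens (gen gF) (gen gKinv) + tens (gen gK) (gen gF)"
| "coprod_gen gK = tens (gen gK) (gen gK)"
| "coprod_gen gKinv = tens (gen gKinv) (gen gKinv)"

definition coprod_free :: "uq_gen free_alg \<Rightarrow> (uq_word \<times> uq_word \<Rightarrow>\<^sub>0 complex)" where
  "coprod_free = lin_ext (\<lambda>w. prod_list (map coprod_gen w))"

text \<open>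
  \<^term>\<open>coprod_free\<close> is the lift of the comultiplication to free algebras. The iterated
  comultiplication is taken in the form \<open>(id \<otimes> \<Delta>) \<Delta>\<close>; triple tensor products are nested to the right.
\<close>

definition coprod :: "complex \<Rightarrow> (uq_word \<Rightarrow>\<^sub>0 complex) set \<Rightarrow> (uq_word \<times> uq_word \<Rightarrow>\<^sub>0 complex) set" where
  "coprod q = quot_map (uq_ideal2 q) coprod_free"

definition id_tens_coprod :: "complex \<Rightarrow> (uq_word \<times> uq_word \<Rightarrow>\<^sub>0 complex) set
    \<Rightarrow> (uq_word \<times> uq_word \<times> uq_word \<Rightarrow>\<^sub>0 complex) set" where
  "id_tens_coprod q = quot_map (uq_ideal3 q)
     (lin_ext (\<lambda>(u, v). tens (mon u) (coprod_free (mon v))))"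

definition coprod2 :: "complex \<Rightarrow> (uq_word \<Rightarrow>\<^sub>0 complex) set
    \<Rightarrow> (uq_word \<times> uq_word \<times> uq_word \<Rightarrow>\<^sub>0 complex) set" where
  "coprod2 q X = id_tens_coprod q (coprod q X)"

text \<open>The embeddings \<open>Z \<mapsto> Z \<otimes> 1\<close> and \<open>Z \<mapsto> 1 \<otimes> Z\<close> of the second into the third tensor power.\<close>

definition tens_one_right :: "complex \<Rightarrow> (uq_word \<times> uq_word \<Rightarrow>\<^sub>0 complex) set
    \<Rightarrow> (uq_word \<times> uq_word \<times> uq_word \<Rightarrow>\<^sub>0 complex) set" where
  "tens_one_right q = quot_map (uq_ideal3 q) (lin_ext (\<lambda>(u, v). mon (u, v, 0)))"

definition tens_one_left :: "complex \<Rightarrow> (uq_word \<times> uq_word \<Rightarrow>\<^sub>0 complex) set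
    \<Rightarrow> (uq_word \<times> uq_word \<times> uq_word \<Rightarrow>\<^sub>0 complex) set" where
  "tens_one_left q = quot_map (uq_ideal3 q) (lin_ext (\<lambda>(u, v). mon (0, u, v)))"


section \<open>Spin representations and the centralizer\<close>

type_synonym 'n uq_rep = "(uq_word \<Rightarrow>\<^sub>0 complex) set \<Rightarrow> complex^'n^'n"

text \<open>
  For a half-integer \<^term>\<open>j\<close>, the power $q^j$ with respect to a chosen square root
  \<^term>\<open>s\<close> of $q$ is the integer power $s^{2j}$.
\<close>

definition half_power :: "complex \<Rightarrow> rat \<Rightarrow> complex" where
  "half_power s j = s powi \<lfloor>2 * j\<rfloor>"

definition irreducible_rep :: "complex \<Rightarrow> ('n::finite) uq_rep \<Rightarrow> bool" where
  "irreducible_rep q \<pi> \<longleftrightarrow>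
     (\<forall>W. vec.subspace W \<and> (\<forall>x\<in>carrier (Uq q). \<forall>w\<in>W. \<pi> x *v w \<in> W) \<longrightarrow> W = {0} \<or> W = UNIV)"

definition spin_rep :: "complex \<Rightarrow> complex \<Rightarrow> rat \<Rightarrow> ('n::finite) uq_rep \<Rightarrow> bool" where
  "spin_rep q s j \<pi> \<longleftrightarrow>
     \<pi> \<in> alg_hom (Uq q) mat_alg \<and> of_nat CARD('n) = 2 * j + 1 \<and> irreducible_rep q \<pi> \<and>
     (\<exists>v. \<pi> (cls (uq_ideal q) (gen gE)) *v v = 0 \<and>
          \<pi> (cls (uq_ideal q) (gen gK)) *v v = half_power s j *s v \<and>
          (\<lambda>x. \<pi> x *v v) ` carrier (Uq q) = UNIV)"

definition rep3 :: "complex \<Rightarrow> ('a::finite) uq_rep \<Rightarrow> ('b::finite) uq_rep \<Rightarrow> ('c::finite) uq_rep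
    \<Rightarrow> (uq_word \<times> uq_word \<times> uq_word \<Rightarrow>\<^sub>0 complex) set
    \<Rightarrow> complex^('a \<times> 'b \<times> 'c)^('a \<times> 'b \<times> 'c)" where
  "rep3 q \<pi>1 \<pi>2 \<pi>3 =
     rep_tens (uq_ideal q) (uq_ideal2 q) \<pi>1 (rep_tens (uq_ideal q) (uq_ideal q) \<pi>2 \<pi>3)"

definition centralizer :: "complex \<Rightarrow> ('a::finite) uq_rep \<Rightarrow> ('b::finite) uq_rep \<Rightarrow> ('c::finite) uq_rep
    \<Rightarrow> (complex^('a \<times> 'b \<times> 'c)^('a \<times> 'b \<times> 'c)) calgebra" where
  "centralizer q \<pi>1 \<pi>2 \<pi>3 = mat_alg\<lparr>carrier :=
     {m. \<forall>x\<in>carrier (Uq q). rep3 q \<pi>1 \<pi>2 \<pi>3 (coprod2 q x) ** m - m ** rep3 q \<pi>1 \<pi>2 \<pi>3 (coprod2 q x) = 0}\<rparr>"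

definition C12 :: "complex \<Rightarrow> ('a::finite) uq_rep \<Rightarrow> ('b::finite) uq_rep \<Rightarrow> ('c::finite) uq_rep
    \<Rightarrow> complex^('a \<times> 'b \<times> 'c)^('a \<times> 'b \<times> 'c)" where
  "C12 q \<pi>1 \<pi>2 \<pi>3 = rep3 q \<pi>1 \<pi>2 \<pi>3 (tens_one_right q (coprod q (casimir q)))"

definition C23 :: "complex \<Rightarrow> ('a::finite) uq_rep \<Rightarrow> ('b::finite) uq_rep \<Rightarrow> ('c::finite) uq_rep
    \<Rightarrow> complex^('a \<times> 'b \<times> 'c)^('a \<times> 'b \<times> 'c)" where
  "C23 q \<pi>1 \<pi>2 \<pi>3 = rep3 q \<pi>1 \<pi>2 \<pi>3 (tens_one_left q (coprod q (casimir q)))"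

definition C123 :: "complex \<Rightarrow> ('a::finite) uq_rep \<Rightarrow> ('b::finite) uq_rep \<Rightarrow> ('c::finite) uq_rep
    \<Rightarrow> complex^('a \<times> 'b \<times> 'c)^('a \<times> 'b \<times> 'c)" where
  "C123 q \<pi>1 \<pi>2 \<pi>3 = rep3 q \<pi>1 \<pi>2 \<pi>3 (coprod2 q (casimir q))"


section \<open>The quotient of the Askey--Wilson algebra\<close>

text \<open>For a half-integer \<^term>\<open>j\<close> the exponent $2j+1$ is an integer.\<close>

definition chi :: "complex \<Rightarrow> rat \<Rightarrow> complex" where
  "chi q j = q powi \<lfloor>2 * j + 1\<rfloor> + q powi (- \<lfloor>2 * j + 1\<rfloor>)"

definition J2 :: "rat \<Rightarrow> rat \<Rightarrow> rat set" where
  "J2 j1 j2 = {\<bar>j1 - j2\<bar> + of_nat k |k. \<bar>j1 - j2\<bar> + of_nat k \<le> j1 + j2}"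

definition J3 :: "rat \<Rightarrow> rat \<Rightarrow> rat \<Rightarrow> rat set" where
  "J3 j1 j2 j3 = (\<Union>j\<in>J2 j1 j2. J2 j j3)"

definition Mset :: "complex \<Rightarrow> rat \<Rightarrow> rat \<Rightarrow> rat \<Rightarrow> complex set" where
  "Mset q ja jb jc = (\<Union>j\<in>J2 ja jb. {chi q l - chi q j |l. l \<in> J2 j jc})"

text \<open>
  The product of the factors \<open>x - c i\<close> over \<open>i\<close> in \<open>S\<close>. These factors commute with each other, but the
  algebra is not commutative, so the product is formed in the polynomial ring and then
  evaluated at \<open>x\<close>.
\<close>

definition root_prod :: "('i \<Rightarrow> complex) \<Rightarrow> 'i set \<Rightarrow> ('m::monoid_add \<Rightarrow>\<^sub>0 complex) \<Rightarrow> ('m \<Rightarrow>\<^sub>0 complex)" where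
  "root_prod c S x = (let p = (\<Prod>i\<in>S. [:- c i, 1:]) in \<Sum>n\<le>degree p. cst (coeff p n) * x ^ n)"

datatype aw_gen = gA | gB | gD | ga1 | ga2 | ga3 | gk

abbreviation "awA \<equiv> gen gA"
abbreviation "awB \<equiv> gen gB"
abbreviation "awD \<equiv> gen gD"
abbreviation "al1 \<equiv> gen ga1"
abbreviation "al2 \<equiv> gen ga2"
abbreviation "al3 \<equiv> gen ga3"
abbreviation "awK \<equiv> gen gk"

definition qcomm :: "complex \<Rightarrow> aw_gen free_alg \<Rightarrow> aw_gen free_alg \<Rightarrow> aw_gen free_alg" where
  "qcomm q x y = cst q * x * y - cst (inverse q) * y * x"

definition aw3_rels :: "complex \<Rightarrow> aw_gen free_alg set" where
  "aw3_rels q =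
    {gen z * gen g - gen g * gen z |z g. z \<in> {ga1, ga2, ga3, gk}} \<union>
    {awA + cst (1 / (q^2 - inverse q ^ 2)) * qcomm q awB awD
       - cst (1 / (q + inverse q)) * (al1 * al2 + al3 * awK),
     awB + cst (1 / (q^2 - inverse q ^ 2)) * qcomm q awD awA
       - cst (1 / (q + inverse q)) * (al2 * al3 + al1 * awK),
     awD + cst (1 / (q^2 - inverse q ^ 2)) * qcomm q awA awB
       - cst (1 / (q + inverse q)) * (al1 * al3 + al2 * awK)}"

definition awD' :: "complex \<Rightarrow> aw_gen free_alg" where
  "awD' q = cst (1 / (q + inverse q)) * (al1 * al3 + al2 * awK)
     - cst (1 / (q^2 - inverse q ^ 2)) * qcomm q awB awA"

definition aw_Omega :: "complex \<Rightarrow> aw_gen free_alg" where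
  "aw_Omega q =
     cst q * awA * (al1 * al2 + al3 * awK)
     + cst (inverse q) * awB * (al2 * al3 + al1 * awK)
     + cst q * awD * (al1 * al3 + al2 * awK)
     - cst (q^2) * awA^2 - cst (inverse q ^ 2) * awB^2 - cst (q^2) * awD^2
     - cst q * awA * awB * awD"

definition awbar_rels :: "complex \<Rightarrow> rat \<Rightarrow> rat \<Rightarrow> rat \<Rightarrow> aw_gen free_alg set" where
  "awbar_rels q j1 j2 j3 =
    {al1 - cst (chi q j1), al2 - cst (chi q j2), al3 - cst (chi q j3),
     root_prod (chi q) (J2 j1 j2) awA,
     root_prod (chi q) (J2 j2 j3) awB,
     root_prod (chi q) (J3 j1 j2 j3) awK,
     root_prod (chi q) (J2 j1 j3) awD,
     root_prod (chi q) (J2 j1 j3) (awD' q),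
     root_prod (\<lambda>m. m) (Mset q j1 j2 j3) (awK - awA),
     root_prod (\<lambda>m. m) (Mset q j2 j3 j1) (awK - awB),
     root_prod (\<lambda>m. m) (Mset q j1 j3 j2) (awK - awD),
     root_prod (\<lambda>m. m) (Mset q j1 j3 j2) (awK - awD' q),
     aw_Omega q - (cst (chi q j1 ^ 2 + chi q j2 ^ 2 + chi q j3 ^ 2) + awK^2
       + cst (chi q j1 * chi q j2 * chi q j3) * awK - cst ((q + inverse q)^2))}"

definition awbar_ideal :: "complex \<Rightarrow> rat \<Rightarrow> rat \<Rightarrow> rat \<Rightarrow> aw_gen free_alg set" where
  "awbar_ideal q j1 j2 j3 = two_sided_ideal (aw3_rels q \<union> awbar_rels q j1 j2 j3)"

definition AWbar :: "complex \<Rightarrow> rat \<Rightarrow> rat \<Rightarrow> rat \<Rightarrow> aw_gen free_alg set calgebra" where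
  "AWbar q j1 j2 j3 = mon_quot (awbar_ideal q j1 j2 j3)"

text \<open>
  A morphism with prescribed values on the classes of $A$, $B$ and $K$. It is determined by them,
  since the remaining generators are expressed through these three.
\<close>

definition sends_generators :: "complex \<Rightarrow> rat \<Rightarrow> rat \<Rightarrow> rat
    \<Rightarrow> (aw_gen free_alg set \<Rightarrow> 'b) \<Rightarrow> 'b \<Rightarrow> 'b \<Rightarrow> 'b \<Rightarrow> bool" where
  "sends_generators q j1 j2 j3 f a b k \<longleftrightarrow>
     f (cls (awbar_ideal q j1 j2 j3) awA) = a \<and>
     f (cls (awbar_ideal q j1 j2 j3) awB) = b \<and>
     f (cls (awbar_ideal q j1 j2 j3) awK) = k"

end

theory Submission
  imports Defs
begin

text \<open>
  Put $x = q + q^{-1} = \chi_0$, so that $\chi_1 - \chi_0 = x(x^2-4)$. Both algebras are the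
  Temperley--Lieb algebra with loop parameter $x$: it has generators $e_1, e_2$ with
  $e_i^2 = x e_i$, $e_1e_2e_1 = e_1$, $e_2e_1e_2 = e_2$ and basis $1, e_1, e_2, e_1e_2, e_2e_1$.

  In the centralizer, $C_{12} = \chi_1 - (x^2-4)e_1$ and $C_{23} = \chi_1 - (x^2-4)e_2$ for explicit
  matrices $e_1, e_2$. An element of the centralizer is determined by its restriction to the
  weight spaces of $q^H$ for the weights $q^{3/2}$ and $q^{1/2}$; there the commutation relations
  leave five free parameters.

  In the quotient of $AW(3)$, define $e_1, e_2$ by the same formulas. The relation on $K - A$ gives
  $K e_1 = \chi_{1/2} e_1$, and compressing the Askey--Wilson relations with $x - e_2$, on which
  $B = \chi_1$, expresses $(x-e_2)e_1(x-e_2)$ through $K$. These relations leave only one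
  one-dimensional representation besides those of the Temperley--Lieb algebra, with
  $A = B = \chi_0$ and $K = \chi_{1/2}$, and the quadratic relation for $D$ excludes it.
  Conversely, in the Temperley--Lieb algebra the relations of the quotient hold with
  $D = \chi_1 - (x^2-4)(e_1 + e_2 - q^{-1}e_1e_2 - q e_2e_1)$.
\<close>

section \<open>Monoid algebras and linear extension\<close>

text \<open>On the centralizer side the obstacle is the encoding: comultiplication and
  representations act on cosets through unions and \<open>the_elem\<close>. They are not shown to be
  well defined one by one. Instead they are evaluated on free-algebra representatives by matrix
  homomorphisms that kill the relations. The representation is given only abstractly, so a basis has
  to be produced before explicit matrices can be used.

  No basis theorem for the Temperley--Lieb algebra enters: five words span the quotient of AW(3),
  and their images are linearly independent matrices, which gives injectivity at once.

  On the AW(3) side a single element \<open>T\<close> measures two defects, the failure of e_1 e_2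
  e_1 = e_1 (and of its mirror image) and the failure of the Temperley--Lieb formula for K. That is
  why excluding one one-dimensional representation is enough.\<close>

lemma cst_simps:
  "cst 0 = (0 :: 'm::monoid_add \<Rightarrow>\<^sub>0 complex)" "cst 1 = (1 :: 'm \<Rightarrow>\<^sub>0 complex)"
  "cst (a + b) = (cst a + cst b :: 'm \<Rightarrow>\<^sub>0 complex)"
  "cst (a - b) = (cst a - cst b :: 'm \<Rightarrow>\<^sub>0 complex)"
  "cst (- a) = (- cst a :: 'm \<Rightarrow>\<^sub>0 complex)"
  "cst (a * b) = (cst a * cst b :: 'm \<Rightarrow>\<^sub>0 complex)"
  by (simp_all add: cst_def single_add single_diff single_uminus mult_single)

lemma cst_mult_single: "cst c * Poly_Mapping.single m d = Poly_Mapping.single m (c * d)"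
  by (simp add: cst_def mult_single)

lemma poly_mapping_sum_single:
  "x = (\<Sum>m\<in>Poly_Mapping.keys x. Poly_Mapping.single m (Poly_Mapping.lookup x m))"
  by (rule poly_mapping_eqI)
    (simp add: lookup_sum lookup_single when_def in_keys_iff)

lemma poly_mapping_single_induct [case_names single add]:
  fixes x :: "'m \<Rightarrow>\<^sub>0 'c::comm_monoid_add"
  assumes single: "\<And>m c. P (Poly_Mapping.single m c)"
    and add: "\<And>x y. P x \<Longrightarrow> P y \<Longrightarrow> P (x + y)"
  shows "P x"
proof -
  have "P (\<Sum>m\<in>M. Poly_Mapping.single m (Poly_Mapping.lookup x m))" if "finite M" for M
    using that by induction (use assms single[of _ 0] in simp_all)
  then show ?thesis
    using poly_mapping_sum_single[of x] finite_keys by metis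
qed

lemma cst_commute: "x * cst c = cst c * x"
  by (induction x rule: poly_mapping_single_induct)
    (simp_all add: cst_def mult_single mult.commute distrib_left distrib_right)

lemma lin_ext_add: "lin_ext f (x + y) = lin_ext f x + lin_ext f y"
  unfolding lin_ext_def
  by (rule setsum_keys_plus_distrib) (simp_all add: cst_simps distrib_right)

lemma lin_ext_single: "lin_ext f (Poly_Mapping.single m c) = cst c * f m"
  by (simp add: lin_ext_def cst_simps)

lemma lin_ext_cst_mult: "lin_ext f (cst c * x) = cst c * lin_ext f x"
  by (induction x rule: poly_mapping_single_induct)
    (simp_all add: cst_mult_single lin_ext_add lin_ext_single cst_simps distrib_left mult.assoc)

lemma lin_ext_mult:
  fixes f :: "'m::monoid_add \<Rightarrow> ('n::monoid_add \<Rightarrow>\<^sub>0 complex)"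
  assumes "\<And>m n. f (m + n) = f m * f n"
  shows "lin_ext f (x * y) = lin_ext f x * lin_ext f y"
proof (induction x rule: poly_mapping_single_induct)
  case (single m c)
  show ?case
  proof (induction y rule: poly_mapping_single_induct)
    case (single n d)
    have "cst (c * d) * (f m * f n) = cst c * (cst d * f m) * f n"
      by (simp add: cst_simps mult.assoc)
    also have "\<dots> = cst c * f m * (cst d * f n)"
      by (metis cst_commute mult.assoc)
    finally show ?case
      by (simp add: mult_single lin_ext_single assms)
  qed (simp add: distrib_left lin_ext_add)
qed (simp add: distrib_right lin_ext_add)

lemma coprod_free_simps:
  "coprod_free (x + y) = coprod_free x + coprod_free y"
  "coprod_free (x * y) = coprod_free x * coprod_free y"
  "coprod_free (cst c * x) = cst c * coprod_free x"
  "coprod_free 1 = 1"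
  "coprod_free (gen g) = coprod_gen g"
proof -
  have "coprod_free (mon 0) = (1 :: uq_word \<times> uq_word \<Rightarrow>\<^sub>0 complex)"
    by (simp add: coprod_free_def lin_ext_single cst_simps zero_list_def)
  then show "coprod_free 1 = 1"
    by simp
qed (simp_all add: coprod_free_def lin_ext_add lin_ext_cst_mult lin_ext_single lin_ext_mult
    plus_list_def cst_simps)

lemma tens_add: "tens (x + y) z = tens x z + tens y z" "tens z (x + y) = tens z x + tens z y"
  unfolding tens_def
   apply (rule setsum_keys_plus_distrib)
    apply (simp_all add: single_add distrib_right sum.distrib)
  apply (subst sum.distrib [symmetric])
  apply (rule sum.cong[OF refl])
  apply (rule setsum_keys_plus_distrib)
   apply (simp_all add: single_add distrib_left)
  done

lemma tens_single:
  "tens (Poly_Mapping.single a c) (Poly_Mapping.single b d) = Poly_Mapping.single (a, b) (c * d)"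
  by (simp add: tens_def)

subsection \<open>Representations by matrices\<close>

lemma mat_scale_simps:
  fixes M N :: "complex^'n^'n"
  shows "mat_scale c (M + N) = mat_scale c M + mat_scale c N"
    "mat_scale (c + d) M = mat_scale c M + mat_scale d M"
    "mat_scale c (mat_scale d M) = mat_scale (c * d) M"
    "mat_scale 0 M = 0" "mat_scale c 0 = 0" "mat_scale 1 M = M"
    "mat_scale c M ** N = mat_scale c (M ** N)"
    "M ** mat_scale c N = mat_scale c (M ** N)"
  by (simp_all add: mat_scale_def vec_eq_iff matrix_matrix_mult_def algebra_simps sum_distrib_left)

lemma matrix_add_rdistrib: "(A + B) ** C = A ** C + B ** C"
  by (simp add: vec_eq_iff matrix_matrix_mult_def distrib_right sum.distrib)

text \<open>The sum inside \<open>rep_tens\<close> has this shape, so a tensor product of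
  representations can be handled as a linear extension from monomials.\<close>

definition mat_lin :: "('m \<Rightarrow> complex^'n^'n) \<Rightarrow> ('m \<Rightarrow>\<^sub>0 complex) \<Rightarrow> complex^'n^'n" where
  "mat_lin f x = (\<Sum>m\<in>Poly_Mapping.keys x. mat_scale (Poly_Mapping.lookup x m) (f m))"

lemma mat_lin_add: "mat_lin f (x + y) = mat_lin f x + mat_lin f y"
  unfolding mat_lin_def
  by (rule setsum_keys_plus_distrib) (simp_all add: mat_scale_simps)

lemma mat_lin_single: "mat_lin f (Poly_Mapping.single m c) = mat_scale c (f m)"
  by (simp add: mat_lin_def mat_scale_simps)

lemma mat_lin_cst_mult: "mat_lin f (cst c * x) = mat_scale c (mat_lin f x)"
  by (induction x rule: poly_mapping_single_induct)
    (simp_all add: cst_mult_single mat_lin_add mat_lin_single mat_scale_simps distrib_left)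

abbreviation mat_hom :: "(('m::monoid_add \<Rightarrow>\<^sub>0 complex) \<Rightarrow> complex^'n^'n) set" where
  "mat_hom \<equiv> alg_hom mon_alg mat_alg"

lemma mat_hom_iff:
  "h \<in> mat_hom \<longleftrightarrow> (\<forall>x y. h (x + y) = h x + h y) \<and> (\<forall>x y. h (x * y) = h x ** h y) \<and>
     h 1 = mat 1 \<and> (\<forall>c x. h (cst c * x) = mat_scale c (h x))"
  by (auto simp: alg_hom_def ring_hom_def mon_alg_def mat_alg_def)

lemma mat_lin_hom:
  assumes "f 0 = mat 1" "\<And>m n. f (m + n) = f m ** f n"
  shows "mat_lin f \<in> mat_hom"
proof -
  have "mat_lin f (x * y) = mat_lin f x ** mat_lin f y" for x y
  proof (induction x rule: poly_mapping_single_induct)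
    case (single m c)
    show ?case
      by (induction y rule: poly_mapping_single_induct)
        (simp_all add: mult_single mat_lin_single assms mat_scale_simps mat_lin_add distrib_left
          matrix_add_ldistrib mult.commute)
  qed (simp add: distrib_right mat_lin_add matrix_add_rdistrib)
  then show ?thesis
    by (simp add: mat_hom_iff mat_lin_add mat_lin_cst_mult assms mat_lin_single mat_scale_simps
        flip: single_one)
qed

lemma mat_hom_simps:
  assumes "h \<in> mat_hom"
  shows "h (x + y) = h x + h y" "h (x * y) = h x ** h y" "h 1 = mat 1"
    "h (cst c * x) = mat_scale c (h x)" "h 0 = 0" "h (- x) = - h x" "h (x - y) = h x - h y"
    "h (cst c) = mat_scale c (mat 1)"
proof -
  show add: "h (x + y) = h x + h y" "h (x * y) = h x ** h y" "h 1 = mat 1"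
    and sc: "h (cst c * x) = mat_scale c (h x)" for x y c
    using assms by (auto simp: mat_hom_iff)
  show "h (cst c) = mat_scale c (mat 1)"
    using sc[of c 1] add(3) by simp
  show z: "h 0 = 0"
    using add(1)[of 0 0] by simp
  show m: "h (- x) = - h x" for x
    using add(1)[of x "- x"] z by (simp add: eq_neg_iff_add_eq_0 add.commute)
  show "h (x - y) = h x - h y"
    using add(1)[of x "- y"] by (simp add: m)
qed

lemma mat_hom_eq_mat_lin:
  assumes "h \<in> mat_hom"
  shows "h x = mat_lin (\<lambda>m. h (mon m)) x"
proof (induction x rule: poly_mapping_single_induct)
  case (single m c)
  show ?case
    using mat_hom_simps(4)[OF assms, of c "mon m"] by (simp add: cst_mult_single mat_lin_single)
qed (simp add: mat_hom_simps(1)[OF assms] mat_lin_add)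

definition free_hom :: "('g \<Rightarrow> complex^'n^'n) \<Rightarrow> 'g free_alg \<Rightarrow> complex^'n^'n" where
  "free_hom f = mat_lin (\<lambda>w. foldr (\<lambda>g M. f g ** M) w (mat 1))"

lemma free_hom_hom: "free_hom f \<in> mat_hom"
  unfolding free_hom_def
proof (rule mat_lin_hom)
  show "foldr (\<lambda>g. (**) (f g)) (m + n) (mat 1) =
      foldr (\<lambda>g. (**) (f g)) m (mat 1) ** foldr (\<lambda>g. (**) (f g)) n (mat 1)" for m n
    by (induction m) (simp_all add: plus_list_def matrix_mul_assoc)
qed (simp add: zero_list_def)

lemma free_hom_gen: "free_hom f (gen g) = f g"
  by (simp add: free_hom_def mat_lin_single mat_scale_simps)

subsection \<open>Ideals and quotients\<close>

lemma ring_mon_alg: "ring (mon_alg :: ('m::monoid_add \<Rightarrow>\<^sub>0 complex) calgebra)"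
proof (rule ringI)
  show "abelian_group (mon_alg :: ('m \<Rightarrow>\<^sub>0 complex) calgebra)"
  proof (rule abelian_groupI)
    fix x :: "'m \<Rightarrow>\<^sub>0 complex"
    show "\<exists>y\<in>carrier mon_alg. y \<oplus>\<^bsub>mon_alg\<^esub> x = \<zero>\<^bsub>mon_alg\<^esub>"
      by (rule bexI[of _ "- x"]) (simp_all add: mon_alg_def)
  qed (simp_all add: mon_alg_def ac_simps)
  show "Group.monoid (mon_alg :: ('m \<Rightarrow>\<^sub>0 complex) calgebra)"
    by (rule Group.monoidI) (simp_all add: mon_alg_def ac_simps)
qed (simp_all add: mon_alg_def distrib_left distrib_right)

lemma uminus_mon_alg:
  fixes x :: "'m::monoid_add \<Rightarrow>\<^sub>0 complex"
  shows "\<ominus>\<^bsub>mon_alg\<^esub> x = - x"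
proof -
  interpret ring "mon_alg :: ('m \<Rightarrow>\<^sub>0 complex) calgebra" by (rule ring_mon_alg)
  show ?thesis
    by (rule minus_equality) (simp_all add: mon_alg_def)
qed

text \<open>Ideals are described elementwise so that the same lemmas serve two kinds of ideal: those
  generated by relations and the kernels of matrix homomorphisms.\<close>

locale mon_ideal =
  fixes I :: "('m::monoid_add \<Rightarrow>\<^sub>0 complex) set"
  assumes zero: "0 \<in> I" and add: "x \<in> I \<Longrightarrow> y \<in> I \<Longrightarrow> x + y \<in> I"
    and left: "y \<in> I \<Longrightarrow> x * y \<in> I" and right: "x \<in> I \<Longrightarrow> x * y \<in> I"
begin

lemma uminus: "x \<in> I \<Longrightarrow> - x \<in> I"
  using left[of x "- 1"] by simp

lemma diff: "x \<in> I \<Longrightarrow> y \<in> I \<Longrightarrow> x - y \<in> I"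
  using add[of x "- y"] uminus[of y] by simp

lemma ideal: "ideal I mon_alg"
proof (rule idealI[OF ring_mon_alg])
  interpret ring "mon_alg :: ('m \<Rightarrow>\<^sub>0 complex) calgebra" by (rule ring_mon_alg)
  have inv: "inv\<^bsub>add_monoid mon_alg\<^esub> x = - x" for x :: "'m \<Rightarrow>\<^sub>0 complex"
    using uminus_mon_alg[of x] by (simp add: a_inv_def)
  show "subgroup I (add_monoid mon_alg)"
    by (rule subgroup.intro) (use inv uminus zero add in \<open>simp_all add: mon_alg_def\<close>)
qed (use left right in \<open>simp_all add: mon_alg_def\<close>)

lemma mem_cls: "y \<in> cls I x \<longleftrightarrow> y - x \<in> I"
  by (force simp: a_r_coset_def r_coset_def mon_alg_def intro: bexI[of _ "y - x"])

lemma cls_eq_iff: "cls I x = cls I y \<longleftrightarrow> x - y \<in> I"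
proof
  assume "cls I x = cls I y"
  then show "x - y \<in> I"
    using mem_cls[of x x] mem_cls[of x y] zero by simp
next
  assume *: "x - y \<in> I"
  show "cls I x = cls I y"
  proof (rule Set.set_eqI)
    fix z
    show "z \<in> cls I x \<longleftrightarrow> z \<in> cls I y"
      using add[OF _ *, of "z - x"] diff[OF _ *, of "z - y"] by (auto simp: mem_cls)
  qed
qed

lemma carrier_quot: "carrier (mon_quot I) = range (cls I)"
  by (auto simp: quot_alg_def ring.defs FactRing_def A_RCOSETS_def RCOSETS_def a_r_coset_def mon_alg_def)

lemma quot_ops:
  "cls I x \<otimes>\<^bsub>mon_quot I\<^esub> cls I y = cls I (x * y)"
  "cls I x \<oplus>\<^bsub>mon_quot I\<^esub> cls I y = cls I (x + y)"
  "\<one>\<^bsub>mon_quot I\<^esub> = cls I 1"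
  "c \<odot>\<^bsub>mon_quot I\<^esub> cls I x = cls I (cst c * x)"
proof -
  interpret ideal I mon_alg by (rule ideal)
  show "cls I x \<otimes>\<^bsub>mon_quot I\<^esub> cls I y = cls I (x * y)"
    using rcoset_mult_add[of x y] by (simp add: quot_alg_def ring.defs FactRing_def mon_alg_def)
  show "cls I x \<oplus>\<^bsub>mon_quot I\<^esub> cls I y = cls I (x + y)"
    using a_rcos_sum[of x y] by (simp add: quot_alg_def ring.defs FactRing_def mon_alg_def)
  show "\<one>\<^bsub>mon_quot I\<^esub> = cls I 1"
    by (simp add: quot_alg_def ring.defs FactRing_def mon_alg_def)
  have "cls I (cst c * y) = cls I (cst c * x)" if "y \<in> cls I x" for y
    using that left[of "y - x" "cst c"] by (simp add: mem_cls cls_eq_iff right_diff_distrib)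
  moreover have "x \<in> cls I x"
    by (simp add: mem_cls zero)
  ultimately have "(\<Union>y\<in>cls I x. cls I (cst c * y)) = cls I (cst c * x)"
    by blast
  then show "c \<odot>\<^bsub>mon_quot I\<^esub> cls I x = cls I (cst c * x)"
    by (simp add: quot_alg_def ring.defs module.defs mon_alg_def)
qed

end

lemma mon_ideal_genideal: "mon_ideal (two_sided_ideal R)"
proof -
  interpret ring "mon_alg :: ('a \<Rightarrow>\<^sub>0 complex) calgebra" by (rule ring_mon_alg)
  interpret ideal "two_sided_ideal R" mon_alg
    by (rule genideal_ideal) (simp add: mon_alg_def)
  show ?thesis
  proof
    show "0 \<in> two_sided_ideal R"
      using zero_closed by (simp add: mon_alg_def)
    show "x + y \<in> two_sided_ideal R" if "x \<in> two_sided_ideal R" "y \<in> two_sided_ideal R" for x y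
      using a_closed[OF that] by (simp add: mon_alg_def)
    show "x * y \<in> two_sided_ideal R" if "y \<in> two_sided_ideal R" for x y
      using I_l_closed[OF that, of x] by (simp add: mon_alg_def)
    show "x * y \<in> two_sided_ideal R" if "x \<in> two_sided_ideal R" for x y
      using I_r_closed[OF that, of y] by (simp add: mon_alg_def)
  qed
qed

lemma genideal_superset: "R \<subseteq> two_sided_ideal R"
  using ring.genideal_self[OF ring_mon_alg, of R] by (simp add: mon_alg_def)

lemma (in mon_ideal) genideal_subset: "R \<subseteq> I \<Longrightarrow> two_sided_ideal R \<subseteq> I"
  by (rule ring.genideal_minimal[OF ring_mon_alg ideal])

lemma mon_ideal_kernel:
  assumes "h \<in> mat_hom"
  shows "mon_ideal {x. h x = 0}"
  by unfold_locales (simp_all add: mat_hom_simps[OF assms])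

lemma mat_hom_genideal:
  assumes "h \<in> mat_hom" "\<And>x. x \<in> R \<Longrightarrow> h x = 0" "x \<in> two_sided_ideal R"
  shows "h x = 0"
  using mon_ideal.genideal_subset[OF mon_ideal_kernel[OF assms(1)], of R] assms by auto

subsection \<open>Tensor products of representations\<close>

lemma kron_mult: "kron A B ** kron C D = kron (A ** C) (B ** D)"
  by (simp add: kron_def vec_eq_iff matrix_matrix_mult_def sum_product sum.cartesian_product
      case_prod_unfold ac_simps flip: UNIV_Times_UNIV)

lemma kron_bilinear:
  "kron (A + B) C = kron A C + kron B C" "kron C' (A' + B') = kron C' A' + kron C' B'"
  "kron (A - B) C = kron A C - kron B C" "kron C' (A' - B') = kron C' A' - kron C' B'"
  "kron (mat_scale c A) D = mat_scale c (kron A D)" "kron D' (mat_scale c A') = mat_scale c (kron D' A')"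
  "kron 0 D = 0" "kron D' 0 = 0"
  by (auto simp: kron_def vec_eq_iff mat_scale_def algebra_simps)

lemma kron_one: "kron (mat 1) (mat 1) = mat 1"
  by (auto simp: kron_def vec_eq_iff mat_def prod_eq_iff)

lemmas kron_simps = kron_bilinear kron_one

definition kron_hom :: "(('m::monoid_add \<Rightarrow>\<^sub>0 complex) \<Rightarrow> complex^'a^'a)
    \<Rightarrow> (('n::monoid_add \<Rightarrow>\<^sub>0 complex) \<Rightarrow> complex^'b^'b)
    \<Rightarrow> ('m \<times> 'n \<Rightarrow>\<^sub>0 complex) \<Rightarrow> complex^('a \<times> 'b)^('a \<times> 'b)" where
  "kron_hom r t = mat_lin (\<lambda>m. kron (r (mon (fst m))) (t (mon (snd m))))"

lemma kron_hom_hom: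
  assumes "r \<in> mat_hom" "t \<in> mat_hom"
  shows "kron_hom r t \<in> mat_hom"
  unfolding kron_hom_def
proof (rule mat_lin_hom)
  show "kron (r (mon (fst (m + n)))) (t (mon (snd (m + n)))) =
      kron (r (mon (fst m))) (t (mon (snd m))) ** kron (r (mon (fst n))) (t (mon (snd n)))" for m n
    using mat_hom_simps(2)[OF assms(1), of "mon (fst m)" "mon (fst n)"]
      mat_hom_simps(2)[OF assms(2), of "mon (snd m)" "mon (snd n)"]
    by (simp add: mult_single kron_mult)
qed (use mat_hom_simps(3)[OF assms(1)] mat_hom_simps(3)[OF assms(2)] in \<open>simp add: kron_simps\<close>)

lemma kron_hom_tens:
  fixes r :: "('m::monoid_add \<Rightarrow>\<^sub>0 complex) \<Rightarrow> complex^'a^'a"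
    and t :: "('n::monoid_add \<Rightarrow>\<^sub>0 complex) \<Rightarrow> complex^'b^'b"
  assumes r: "r \<in> mat_hom" and t: "t \<in> mat_hom"
  shows "kron_hom r t (tens x y) = kron (r x) (t y)"
proof (induction x rule: poly_mapping_single_induct)
  case (single a c)
  show ?case
  proof (induction y rule: poly_mapping_single_induct)
    case (single b d)
    show ?case
      using mat_hom_simps(4)[OF r, of c "mon a"] mat_hom_simps(4)[OF t, of d "mon b"]
      by (simp add: tens_single kron_hom_def mat_lin_single cst_mult_single kron_simps
          mat_scale_simps mult.commute)
  qed (simp add: tens_add mat_hom_simps[OF kron_hom_hom[OF r t]] mat_hom_simps[OF t] kron_simps)
qed (simp add: tens_add mat_hom_simps[OF kron_hom_hom[OF r t]] mat_hom_simps[OF r] kron_simps)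

lemma kron_hom_tens_ideal:
  assumes "r \<in> mat_hom" "t \<in> mat_hom" "\<And>x. x \<in> I \<Longrightarrow> r x = 0" "\<And>x. x \<in> J \<Longrightarrow> t x = 0"
    and "x \<in> tens_ideal I J"
  shows "kron_hom r t x = 0"
  using kron_hom_hom[OF assms(1,2)] _ assms(5)[unfolded tens_ideal_def]
proof (rule mat_hom_genideal)
  show "kron_hom r t y = 0" if "y \<in> {tens x 1 |x. x \<in> I} \<union> {tens 1 y |y. y \<in> J}" for y
    using that assms(3,4) by (auto simp: kron_hom_tens assms(1,2) kron_simps)
qed

lemma mon_ideal_tens_ideal: "mon_ideal (tens_ideal I J)"
  unfolding tens_ideal_def by (rule mon_ideal_genideal)

lemma (in mon_ideal) quot_hom:
  assumes "\<rho> \<in> alg_hom (mon_quot I) mat_alg"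
  shows "(\<lambda>x. \<rho> (cls I x)) \<in> mat_hom" and "x \<in> I \<Longrightarrow> \<rho> (cls I x) = 0"
proof -
  show h: "(\<lambda>x. \<rho> (cls I x)) \<in> mat_hom"
  proof -
    have r: "\<rho> \<in> ring_hom (mon_quot I) mat_alg" and sc: "\<rho> (c \<odot>\<^bsub>mon_quot I\<^esub> cls I x) = mat_scale c (\<rho> (cls I x))" for c x
      using assms by (auto simp: alg_hom_def carrier_quot mat_alg_def)
    have "\<rho> (cls I (x * y)) = \<rho> (cls I x) ** \<rho> (cls I y)" "\<rho> (cls I (x + y)) = \<rho> (cls I x) + \<rho> (cls I y)" for x y
      using ring_hom_mult[OF r, of "cls I x" "cls I y"] ring_hom_add[OF r, of "cls I x" "cls I y"]
      by (simp_all add: quot_ops carrier_quot) (simp_all add: mat_alg_def)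
    moreover have "\<rho> (cls I 1) = mat 1"
      using ring_hom_one[OF r] by (simp add: quot_ops) (simp add: mat_alg_def)
    ultimately show ?thesis
      using sc by (simp add: mat_hom_iff quot_ops)
  qed
  show "\<rho> (cls I x) = 0" if "x \<in> I"
    using mat_hom_simps(5)[OF h] cls_eq_iff[of x 0] that by simp
qed

lemma the_elem_image_const: "X \<noteq> {} \<Longrightarrow> (\<And>x. x \<in> X \<Longrightarrow> f x = a) \<Longrightarrow> the_elem (f ` X) = a"
  by (metis image_constant_conv image_cong the_elem_eq)

lemma rep_tens_eq:
  "rep_tens I J \<rho> \<sigma> X = the_elem (kron_hom (\<lambda>x. \<rho> (cls I x)) (\<lambda>x. \<sigma> (cls J x)) ` X)"
  by (simp add: rep_tens_def kron_hom_def mat_lin_def)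

text \<open>A homomorphism that kills \<open>I\<close> has one value on each coset, so
  \<open>the_elem\<close> returns it and representatives can be chosen freely.\<close>

lemma (in mon_ideal) the_elem_hom_cls:
  assumes "h \<in> mat_hom" "\<And>x. x \<in> I \<Longrightarrow> h x = 0"
  shows "the_elem (h ` cls I x) = h x"
proof (rule the_elem_image_const)
  show "h y = h x" if "y \<in> cls I x" for y
    using that assms(2)[of "y - x"] by (simp add: mem_cls mat_hom_simps[OF assms(1)])
qed (use mem_cls[of x x] zero in auto)

subsection \<open>The comultiplication on matrix representations\<close>

text \<open>This is the action on a tensor product of two modules; iterating it in the second
  argument gives the action through \<open>coprod2\<close>.\<close>

definition coprod_hom :: "(uq_gen free_alg \<Rightarrow> complex^'a^'a) \<Rightarrow> (uq_gen free_alg \<Rightarrow> complex^'b^'b)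
    \<Rightarrow> uq_gen free_alg \<Rightarrow> complex^('a \<times> 'b)^('a \<times> 'b)" where
  "coprod_hom r t x = kron_hom r t (coprod_free x)"

lemma coprod_hom_hom:
  assumes "r \<in> mat_hom" "t \<in> mat_hom"
  shows "coprod_hom r t \<in> mat_hom"
proof -
  note h = mat_hom_simps[OF kron_hom_hom[OF assms]]
  have "coprod_hom r t (cst c * x) = mat_scale c (coprod_hom r t x)" for c x
    by (simp only: coprod_hom_def coprod_free_simps(3) h(4))
  moreover have "coprod_hom r t (x * y) = coprod_hom r t x ** coprod_hom r t y" for x y
    by (simp only: coprod_hom_def coprod_free_simps h(2))
  ultimately show ?thesis
    by (simp add: mat_hom_iff) (simp add: coprod_hom_def coprod_free_simps h)
qed

lemma coprod_hom_gens:
  assumes "r \<in> mat_hom" "t \<in> mat_hom"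
  shows
    "coprod_hom r t (gen gE) = kron (r (gen gE)) (t (gen gKinv)) + kron (r (gen gK)) (t (gen gE))"
    "coprod_hom r t (gen gF) = kron (r (gen gF)) (t (gen gKinv)) + kron (r (gen gK)) (t (gen gF))"
    "coprod_hom r t (gen gK) = kron (r (gen gK)) (t (gen gK))"
    "coprod_hom r t (gen gKinv) = kron (r (gen gKinv)) (t (gen gKinv))"
  by (simp_all add: coprod_hom_def coprod_free_simps mat_hom_simps[OF kron_hom_hom[OF assms]]
      kron_hom_tens[OF assms])

definition uq_relations :: "complex \<Rightarrow> complex^'n^'n \<Rightarrow> complex^'n^'n \<Rightarrow> complex^'n^'n \<Rightarrow> complex^'n^'n \<Rightarrow> bool"
  where "uq_relations q E F K L \<longleftrightarrow> K ** L = mat 1 \<and> L ** K = mat 1 \<and>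
     K ** E = mat_scale q (E ** K) \<and> K ** F = mat_scale (inverse q) (F ** K) \<and>
     E ** F - F ** E = mat_scale (1 / (q - inverse q)) (K ** K - L ** L)"

lemma matrix_diff_distrib:
  fixes A B C :: "complex^'n^'n"
  shows "A ** (B - C) = A ** B - A ** C" "(B - C) ** A = B ** A - C ** A"
  by (simp_all add: vec_eq_iff matrix_matrix_mult_def algebra_simps sum_subtractf)

lemma matrix_commute_mult:
  fixes X :: "complex^'n^'n"
  assumes "X ** S = S ** X" "X ** T = T ** X"
  shows "X ** (S ** T) = S ** T ** X"
proof -
  have "X ** (S ** T) = S ** X ** T"
    by (simp only: matrix_mul_assoc assms(1))
  also have "\<dots> = S ** (X ** T)"
    by (rule matrix_mul_assoc[symmetric])
  also have "\<dots> = S ** T ** X"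
    unfolding assms(2) by (rule matrix_mul_assoc)
  finally show ?thesis .
qed

lemma mat_scale_diff: "mat_scale c (M - N) = mat_scale c M - mat_scale c N"
  by (simp add: mat_scale_def vec_eq_iff algebra_simps)

text \<open>In the commutator of the images of E and F the mixed terms cancel: moving q^H past E in
  the first factor and q^{-H} past F in the second gives the same power of q. The rest telescopes,
  (K^2 - L^2) x L'^2 + K^2 x (K'^2 - L'^2) = K^2 x K'^2 - L^2 x L'^2, where x stands for the tensor
  sign.\<close>

lemma uq_relations_kron:
  assumes q: "q \<noteq> 0" and 1: "uq_relations q E F K L" and 2: "uq_relations q E' F' K' L'"
  shows "uq_relations q (kron E L' + kron K E') (kron F L' + kron K F') (kron K K') (kron L L')"
proof -
  have LE: "L' ** E' = mat_scale (inverse q) (E' ** L')" and LF: "L' ** F' = mat_scale q (F' ** L')"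
  proof -
    have KE: "K' ** E' = mat_scale q (E' ** K')" and KF: "K' ** F' = mat_scale (inverse q) (F' ** K')"
      and inv: "K' ** L' = mat 1" "L' ** K' = mat 1"
      using 2 by (simp_all add: uq_relations_def)
    have "E' ** L' = L' ** (K' ** E') ** L'"
      by (simp add: matrix_mul_assoc inv)
    also have "\<dots> = mat_scale q (L' ** E' ** (K' ** L'))"
      by (simp add: KE mat_scale_simps matrix_mul_assoc)
    finally show "L' ** E' = mat_scale (inverse q) (E' ** L')"
      using q by (simp add: inv mat_scale_simps)
    have "F' ** L' = L' ** (K' ** F') ** L'"
      by (simp add: matrix_mul_assoc inv)
    also have "\<dots> = mat_scale (inverse q) (L' ** F' ** (K' ** L'))"
      by (simp add: KF mat_scale_simps matrix_mul_assoc)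
    finally show "L' ** F' = mat_scale q (F' ** L')"
      using q by (simp add: inv mat_scale_simps)
  qed
  have KL: "K' ** L' = L' ** K'"
    using 2 by (simp add: uq_relations_def)
  have EF: "E ** F = F ** E + mat_scale (1 / (q - inverse q)) (K ** K - L ** L)"
    "E' ** F' = F' ** E' + mat_scale (1 / (q - inverse q)) (K' ** K' - L' ** L')"
    using 1 2 by (simp_all add: uq_relations_def diff_eq_eq add.commute)
  show ?thesis
    using 1 2 q
    by (simp add: uq_relations_def kron_mult kron_simps matrix_add_ldistrib matrix_add_rdistrib
        mat_scale_simps KL)
      (simp add: EF kron_simps mat_scale_simps mat_scale_diff LE LF)
qed

lemma mat_hom_uq_rels:
  assumes "r \<in> mat_hom"
  shows "(\<forall>x\<in>uq_rels q. r x = 0) \<longleftrightarrow> uq_relations q (r (gen gE)) (r (gen gF)) (r (gen gK)) (r (gen gKinv))"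
  by (simp add: uq_rels_def uq_relations_def mat_hom_simps[OF assms] power2_eq_square mat_scale_simps)

lemma mat_hom_uq_ideal:
  assumes "r \<in> mat_hom" "uq_relations q (r (gen gE)) (r (gen gF)) (r (gen gK)) (r (gen gKinv))"
    and "x \<in> uq_ideal q"
  shows "r x = 0"
  using mat_hom_genideal[OF assms(1) _ assms(3)[unfolded uq_ideal_def]] mat_hom_uq_rels[OF assms(1)] assms(2)
  by blast

lemma uq_relations_coprod_hom:
  assumes "q \<noteq> 0" "r \<in> mat_hom" "t \<in> mat_hom"
    and "uq_relations q (r (gen gE)) (r (gen gF)) (r (gen gK)) (r (gen gKinv))"
    and "uq_relations q (t (gen gE)) (t (gen gF)) (t (gen gK)) (t (gen gKinv))"
  shows "uq_relations q (coprod_hom r t (gen gE)) (coprod_hom r t (gen gF))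
     (coprod_hom r t (gen gK)) (coprod_hom r t (gen gKinv))"
  using uq_relations_kron[OF assms(1,4,5)] by (simp add: coprod_hom_gens assms(2,3))

definition casimir_mat :: "complex \<Rightarrow> complex^'n^'n \<Rightarrow> complex^'n^'n \<Rightarrow> complex^'n^'n \<Rightarrow> complex^'n^'n \<Rightarrow> complex^'n^'n" where
  "casimir_mat q E F K L = mat_scale ((q - inverse q)^2) (F ** E) + mat_scale q (K ** K)
     + mat_scale (inverse q) (L ** L)"

section \<open>Evaluating the coset-level maps in one matrix representation\<close>

locale uq_matrix_rep =
  fixes q :: complex and \<pi> :: "('n::finite) uq_rep"
  assumes q_nonzero: "q \<noteq> 0" and hom: "\<pi> \<in> alg_hom (Uq q) mat_alg"
begin

sublocale uq: mon_ideal "uq_ideal q"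
  unfolding uq_ideal_def by (rule mon_ideal_genideal)

sublocale uq2: mon_ideal "uq_ideal2 q"
  unfolding uq_ideal2_def by (rule mon_ideal_tens_ideal)

sublocale uq3: mon_ideal "uq_ideal3 q"
  unfolding uq_ideal3_def by (rule mon_ideal_tens_ideal)

definition rep :: "uq_gen free_alg \<Rightarrow> complex^'n^'n" where
  "rep x = \<pi> (cls (uq_ideal q) x)"

lemma rep_hom: "rep \<in> mat_hom" and rep_uq_ideal: "x \<in> uq_ideal q \<Longrightarrow> rep x = 0"
  using uq.quot_hom[of \<pi>] hom by (simp_all add: rep_def[abs_def] Uq_def)

lemma rep_relations: "uq_relations q (rep (gen gE)) (rep (gen gF)) (rep (gen gK)) (rep (gen gKinv))"
  using mat_hom_uq_rels[OF rep_hom] rep_uq_ideal genideal_superset unfolding uq_ideal_def by blast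

definition rep2 :: "uq_gen free_alg \<Rightarrow> complex^('n \<times> 'n)^('n \<times> 'n)" where
  "rep2 = coprod_hom rep rep"

lemma rep2_hom: "rep2 \<in> mat_hom"
  unfolding rep2_def by (intro coprod_hom_hom rep_hom)

lemma rep2_uq_ideal: "x \<in> uq_ideal q \<Longrightarrow> rep2 x = 0"
  and rep2_relations: "uq_relations q (rep2 (gen gE)) (rep2 (gen gF)) (rep2 (gen gK)) (rep2 (gen gKinv))"
proof -
  show *: "uq_relations q (rep2 (gen gE)) (rep2 (gen gF)) (rep2 (gen gK)) (rep2 (gen gKinv))"
    unfolding rep2_def by (intro uq_relations_coprod_hom rep_hom rep_relations q_nonzero)
  show "rep2 x = 0" if "x \<in> uq_ideal q"
    by (rule mat_hom_uq_ideal[OF rep2_hom * that])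
qed

definition repc :: "uq_gen free_alg \<Rightarrow> complex^('n \<times> 'n \<times> 'n)^('n \<times> 'n \<times> 'n)" where
  "repc = coprod_hom rep rep2"

lemma repc_hom: "repc \<in> mat_hom"
  unfolding repc_def by (intro coprod_hom_hom rep_hom rep2_hom)

lemma repc_uq_ideal: "x \<in> uq_ideal q \<Longrightarrow> repc x = 0"
  unfolding repc_def
  by (rule mat_hom_uq_ideal[OF coprod_hom_hom uq_relations_coprod_hom])
    (simp_all add: rep_hom rep2_hom rep_relations rep2_relations q_nonzero)

lemma rep_tens_cls: "rep_tens (uq_ideal q) (uq_ideal q) \<pi> \<pi> (cls (uq_ideal2 q) y) = kron_hom rep rep y"
  unfolding rep_tens_eq
  using uq2.the_elem_hom_cls[OF kron_hom_hom[OF rep_hom rep_hom], of y]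
    kron_hom_tens_ideal[OF rep_hom rep_hom rep_uq_ideal rep_uq_ideal]
  by (simp add: uq_ideal2_def rep_def[abs_def])

definition tensor3 :: "(uq_word \<times> uq_word \<times> uq_word \<Rightarrow>\<^sub>0 complex) \<Rightarrow> complex^('n \<times> 'n \<times> 'n)^('n \<times> 'n \<times> 'n)" where
  "tensor3 = kron_hom rep (kron_hom rep rep)"

lemma tensor3_hom: "tensor3 \<in> mat_hom"
  unfolding tensor3_def by (intro kron_hom_hom rep_hom)

lemma tensor3_ideal: "x \<in> uq_ideal3 q \<Longrightarrow> tensor3 x = 0"
  unfolding tensor3_def uq_ideal3_def
  by (rule kron_hom_tens_ideal)
    (auto intro!: rep_hom kron_hom_hom rep_uq_ideal
      intro: kron_hom_tens_ideal[OF rep_hom rep_hom rep_uq_ideal rep_uq_ideal]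
      simp: uq_ideal2_def)

lemma rep3_eq: "rep3 q \<pi> \<pi> \<pi> X = the_elem (tensor3 ` X)"
  unfolding rep3_def rep_tens_eq[of "uq_ideal q" "uq_ideal2 q"] rep_tens_cls tensor3_def
  by (simp add: rep_def[abs_def])

text \<open>The value of the representation on a coset can be read off from any representative, so the
  compatibility of \<open>g\<close> with the ideals is needed only after composition with the representation.\<close>

lemma rep3_quot_map:
  assumes l: "l \<in> mat_hom" "\<And>x. x \<in> uq_ideal2 q \<Longrightarrow> l x = 0"
    and g: "\<And>x. tensor3 (g x) = l x"
    and ideal: "\<And>x. x \<in> uq_ideal q \<Longrightarrow> l (coprod_free x) = 0"
  shows "rep3 q \<pi> \<pi> \<pi> (quot_map (uq_ideal3 q) g (coprod q (cls (uq_ideal q) x))) = l (coprod_free x)"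
proof -
  let ?Z = "quot_map (uq_ideal3 q) g (coprod q (cls (uq_ideal q) x))"
  have "tensor3 z = l (coprod_free x)" if "z \<in> ?Z" for z
  proof -
    \<comment> \<open>One change of representative in each of the three quotients: the algebra, its
      tensor square and its tensor cube.\<close>
    from that obtain x' y where x': "x' - x \<in> uq_ideal q" and y: "y - coprod_free x' \<in> uq_ideal2 q"
      and z: "z - g y \<in> uq_ideal3 q"
      by (auto simp: quot_map_def coprod_def uq.mem_cls uq2.mem_cls uq3.mem_cls)
    have "tensor3 z = tensor3 (g y)"
      using tensor3_ideal[OF z] by (simp add: mat_hom_simps[OF tensor3_hom])
    also have "\<dots> = l (coprod_free x')"
      using l(2)[OF y] by (simp add: g mat_hom_simps[OF l(1)])
    also have "\<dots> = l (coprod_free (x' - x) + coprod_free x)"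
      by (metis coprod_free_simps(1) diff_add_cancel)
    also have "\<dots> = l (coprod_free x)"
      using ideal[OF x'] by (simp add: mat_hom_simps[OF l(1)])
    finally show ?thesis .
  qed
  moreover have "?Z \<noteq> {}"
  proof -
    have "x \<in> cls (uq_ideal q) x" "coprod_free x \<in> cls (uq_ideal2 q) (coprod_free x)"
      "g (coprod_free x) \<in> cls (uq_ideal3 q) (g (coprod_free x))"
      by (simp_all add: uq.mem_cls uq2.mem_cls uq3.mem_cls uq.zero uq2.zero uq3.zero)
    then show ?thesis
      by (auto simp: quot_map_def coprod_def)
  qed
  ultimately show ?thesis
    by (simp add: rep3_eq the_elem_image_const)
qed

lemma tensor3_lin_ext:
  "tensor3 (lin_ext f x) = mat_lin (\<lambda>m. tensor3 (f m)) x"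
  by (induction x rule: poly_mapping_single_induct)
    (simp_all add: lin_ext_add mat_lin_add lin_ext_single mat_lin_single mat_hom_simps[OF tensor3_hom]
      mat_scale_simps)

lemma kron_hom_uq_ideal2:
  assumes "r \<in> mat_hom" "t \<in> mat_hom" "\<And>x. x \<in> uq_ideal q \<Longrightarrow> r x = 0"
    "\<And>x. x \<in> uq_ideal q \<Longrightarrow> t x = 0" "x \<in> uq_ideal2 q"
  shows "kron_hom r t x = 0"
  using assms unfolding uq_ideal2_def by (rule kron_hom_tens_ideal)

lemma rep3_coprod2: "rep3 q \<pi> \<pi> \<pi> (coprod2 q (cls (uq_ideal q) x)) = repc x"
  unfolding coprod2_def id_tens_coprod_def repc_def coprod_hom_def
proof (rule rep3_quot_map[where l = "kron_hom rep rep2"])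
  show "tensor3 (lin_ext (\<lambda>(u, v). tens (mon u) (coprod_free (mon v))) x) = kron_hom rep rep2 x" for x
    unfolding tensor3_lin_ext kron_hom_def[of rep rep2]
    by (simp add: case_prod_unfold tensor3_def kron_hom_tens rep_hom kron_hom_hom rep2_def
        coprod_hom_def)
qed (use repc_uq_ideal in \<open>auto intro: kron_hom_hom kron_hom_uq_ideal2 rep_hom rep_uq_ideal rep2_hom
    rep2_uq_ideal simp: repc_def coprod_hom_def\<close>)

text \<open>Triple products nest to the right, so the trailing identity of Z x 1 sits inside the
  second factor. Absorbing it into the second representation makes C_12 the Casimir of a two-fold
  coproduct representation.\<close>

abbreviation (input) "kron_one \<equiv> \<lambda>x. kron (rep x) (mat 1 :: complex^'n^'n)"

lemma kron_one_hom: "kron_one \<in> mat_hom"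
  by (simp add: mat_hom_iff mat_hom_simps[OF rep_hom] kron_simps kron_mult mat_scale_simps)

lemma kron_one_relations: "uq_relations q (kron_one (gen gE)) (kron_one (gen gF)) (kron_one (gen gK)) (kron_one (gen gKinv))"
  using mat_hom_uq_rels[OF kron_one_hom] mat_hom_uq_rels[OF rep_hom] rep_relations
  by (metis kron_simps(7))

lemma rep3_tens_one_right:
  "rep3 q \<pi> \<pi> \<pi> (tens_one_right q (coprod q (cls (uq_ideal q) x))) = coprod_hom rep kron_one x"
  unfolding tens_one_right_def coprod_hom_def
proof (rule rep3_quot_map[where l = "kron_hom rep kron_one"])
  show "tensor3 (lin_ext (\<lambda>(u, v). mon (u, v, 0)) x) = kron_hom rep kron_one x" for x
    unfolding tensor3_lin_ext
    by (simp add: case_prod_unfold tensor3_def kron_hom_def mat_lin_single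
        mat_scale_simps mat_hom_simps[OF rep_hom])
  show "kron_hom rep kron_one (coprod_free x) = 0" if "x \<in> uq_ideal q" for x
    unfolding coprod_hom_def[symmetric]
    by (rule mat_hom_uq_ideal[OF coprod_hom_hom uq_relations_coprod_hom[where q = q]])
      (simp_all add: rep_hom rep_relations kron_one_hom kron_one_relations q_nonzero that)
  show "kron_hom rep kron_one x = 0" if "x \<in> uq_ideal2 q" for x
    by (rule kron_hom_uq_ideal2[OF rep_hom kron_one_hom _ _ that])
      (simp_all add: rep_uq_ideal kron_simps)
qed (intro kron_hom_hom rep_hom kron_one_hom)

lemma rep3_tens_one_left:
  "rep3 q \<pi> \<pi> \<pi> (tens_one_left q (coprod q (cls (uq_ideal q) x))) = kron (mat 1) (rep2 x)"
  unfolding tens_one_left_def rep2_def coprod_hom_def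
proof (rule rep3_quot_map[where l = "\<lambda>x. kron (mat 1) (kron_hom rep rep x)"])
  have lin: "kron (mat 1) (mat_lin f x) = mat_lin (\<lambda>m. kron (mat 1) (f m)) x"
    for f :: "uq_word \<times> uq_word \<Rightarrow> complex^('n \<times> 'n)^('n \<times> 'n)" and x
    by (induction x rule: poly_mapping_single_induct)
      (simp_all add: mat_lin_single mat_lin_add kron_simps)
  show "tensor3 (lin_ext (\<lambda>(u, v). mon (0, u, v)) x) = kron (mat 1) (kron_hom rep rep x)" for x
    unfolding tensor3_lin_ext
    by (simp add: case_prod_unfold tensor3_def kron_hom_def mat_lin_single
        mat_scale_simps mat_hom_simps[OF rep_hom] lin)
  show "(\<lambda>x. kron (mat 1) (kron_hom rep rep x)) \<in> mat_hom"
    by (simp add: mat_hom_iff mat_hom_simps[OF kron_hom_hom[OF rep_hom rep_hom]] kron_simps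
        kron_mult mat_scale_simps)
  show "kron (mat 1) (kron_hom rep rep (coprod_free x)) = 0" if "x \<in> uq_ideal q" for x
    using rep2_uq_ideal[OF that] by (simp add: rep2_def coprod_hom_def kron_simps)
  show "kron (mat 1) (kron_hom rep rep x) = 0" if "x \<in> uq_ideal2 q" for x
    by (simp add: kron_hom_uq_ideal2 rep_hom rep_uq_ideal that kron_simps)
qed

definition casimir_of :: "(uq_gen free_alg \<Rightarrow> complex^'m^'m) \<Rightarrow> complex^'m^'m" where
  "casimir_of r = casimir_mat q (r (gen gE)) (r (gen gF)) (r (gen gK)) (r (gen gKinv))"

lemma casimir_of:
  assumes "r \<in> mat_hom"
  shows "r (cst ((q - inverse q)^2) * gen gF * gen gE + cst q * gen gK ^ 2 + cst (inverse q) * gen gKinv ^ 2)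
    = casimir_of r"
  by (simp add: casimir_of_def casimir_mat_def mat_hom_simps[OF assms] mat_scale_simps power2_eq_square
      mult.assoc)

lemma casimir_images:
  "C12 q \<pi> \<pi> \<pi> = casimir_of (coprod_hom rep kron_one)"
  "C23 q \<pi> \<pi> \<pi> = kron (mat 1) (casimir_of rep2)"
  "C123 q \<pi> \<pi> \<pi> = casimir_of repc"
  unfolding C12_def C23_def C123_def casimir_def rep3_tens_one_right rep3_tens_one_left rep3_coprod2
  by (simp_all add: casimir_of coprod_hom_hom rep_hom kron_one_hom rep2_hom repc_hom)

lemma carrier_centralizer:
  "m \<in> carrier (centralizer q \<pi> \<pi> \<pi>) \<longleftrightarrow> (\<forall>g. repc (gen g) ** m = m ** repc (gen g))"
proof -
  have "m \<in> carrier (centralizer q \<pi> \<pi> \<pi>) \<longleftrightarrow> (\<forall>x. repc x ** m = m ** repc x)"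
    by (auto simp: centralizer_def Uq_def uq.carrier_quot rep3_coprod2)
  moreover have "repc x ** m = m ** repc x" if *: "\<forall>g. repc (gen g) ** m = m ** repc (gen g)" for x
  proof -
    have words: "repc (mon w) ** m = m ** repc (mon w)" for w
    proof (induction w)
      case Nil
      have "(mon [] :: uq_gen free_alg) = 1"
        by (simp flip: single_one add: zero_list_def)
      then show ?case
        by (simp add: mat_hom_simps(3)[OF repc_hom])
    next
      case (Cons g w)
      have "(mon (g # w) :: uq_gen free_alg) = gen g * mon w"
        by (simp add: mult_single plus_list_def)
      then show ?case
        using matrix_commute_mult[OF *[rule_format, of g, symmetric] Cons[symmetric]]
        by (simp add: mat_hom_simps(2)[OF repc_hom])
    qed
    have lin: "mat_lin f x ** m = m ** mat_lin f x" if "\<And>w. f w ** m = m ** f w" for f :: "uq_word \<Rightarrow> _"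
      by (induction x rule: poly_mapping_single_induct)
        (simp_all add: mat_lin_single mat_lin_add mat_scale_simps matrix_add_ldistrib
          matrix_add_rdistrib that)
    show ?thesis
      unfolding mat_hom_eq_mat_lin[OF repc_hom, of x] by (rule lin) (rule words)
  qed
  ultimately show ?thesis
    by blast
qed

end

section \<open>The threefold tensor power of the spin one half representation\<close>

definition mat2 :: "complex \<Rightarrow> complex \<Rightarrow> complex \<Rightarrow> complex \<Rightarrow> complex^2^2" where
  "mat2 a b c d = (\<chi> i j. if i = 1 then if j = 1 then a else b else if j = 1 then c else d)"

lemma mat2_nth: "mat2 a b c d $ 1 $ 1 = a" "mat2 a b c d $ 1 $ 2 = b"
  "mat2 a b c d $ 2 $ 1 = c" "mat2 a b c d $ 2 $ 2 = d"
  by (simp_all add: mat2_def)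

lemma mat_one_nth: "(mat 1 :: complex^2^2) $ 1 $ 1 = 1" "(mat 1 :: complex^2^2) $ 1 $ 2 = 0"
  "(mat 1 :: complex^2^2) $ 2 $ 1 = 0" "(mat 1 :: complex^2^2) $ 2 $ 2 = 1"
  by (simp_all add: mat_def)

text \<open>The matrices of \<open>E\<close>, \<open>F\<close> and \<open>q\<^sup>H\<close> with respect to the basis \<open>v\<close>, \<open>F v\<close>, where \<open>v\<close> is the highest
  weight vector; \<open>K0 (inverse s)\<close> is the matrix of \<open>q\<^sup>-\<^sup>H\<close>.\<close>

definition E0 :: "complex^2^2" where "E0 = mat2 0 1 0 0"
definition F0 :: "complex^2^2" where "F0 = mat2 0 0 1 0"
definition K0 :: "complex \<Rightarrow> complex^2^2" where "K0 s = mat2 s 0 0 (inverse s)"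

text \<open>With v = s^{-1} v_1 x v_2 - s v_2 x v_1 and s^2 = q, this is v v^T on the first two
  factors. The vector v spans the spin 0 summand and v^T v = q + q^{-1}, so the matrix is q + q^{-1}
  times the projection onto that summand.\<close>

definition tl1 :: "complex \<Rightarrow> complex^(2\<times>2\<times>2)^(2\<times>2\<times>2)" where
  "tl1 q = mat_scale (inverse q) (kron (mat2 1 0 0 0) (kron (mat2 0 0 0 1) (mat 1)))
     + mat_scale q (kron (mat2 0 0 0 1) (kron (mat2 1 0 0 0) (mat 1)))
     - kron E0 (kron F0 (mat 1)) - kron F0 (kron E0 (mat 1))"

definition tl2 :: "complex \<Rightarrow> complex^(2\<times>2\<times>2)^(2\<times>2\<times>2)" where
  "tl2 q = mat_scale (inverse q) (kron (mat 1) (kron (mat2 1 0 0 0) (mat2 0 0 0 1)))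
     + mat_scale q (kron (mat 1) (kron (mat2 0 0 0 1) (mat2 1 0 0 0)))
     - kron (mat 1) (kron E0 F0) - kron (mat 1) (kron F0 E0)"

lemma sum_222: "(\<Sum>i\<in>UNIV. f i) = f (1,1,1) + f (1,1,2) + f (1,2,1) + f (1,2,2)
    + f (2,1,1) + f (2,1,2) + f (2,2,1) + f (2,2,2)" for f :: "2\<times>2\<times>2 \<Rightarrow> complex"
  by (simp add: sum_2 add.assoc sum.cartesian_product' flip: UNIV_Times_UNIV)

lemma mat222_eq_iff: "M = N \<longleftrightarrow> (\<forall>i1 i2 i3 j1 j2 j3. M $ (i1,i2,i3) $ (j1,j2,j3) = N $ (i1,i2,i3) $ (j1,j2,j3))"
  for M N :: "complex^(2\<times>2\<times>2)^(2\<times>2\<times>2)"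
  by (simp add: vec_eq_iff split_paired_All)

lemma kron3_nth: "kron A (kron B C) $ (i1,i2,i3) $ (j1,j2,j3) = A $ i1 $ j1 * (B $ i2 $ j2 * C $ i3 $ j3)"
  by (simp add: kron_def)

lemma mat_mult_nth: "(M ** N) $ i $ j = (\<Sum>k\<in>UNIV. M $ i $ k * N $ k $ j)"
  by (simp add: matrix_matrix_mult_def)

lemma mat_scale_nth: "mat_scale c M $ i $ j = c * M $ i $ j"
  by (simp add: mat_scale_def)

lemmas mat222_simps = mat222_eq_iff forall_2 kron3_nth mat_mult_nth mat_scale_nth sum_222 mat2_nth mat_one_nth

lemma tl_squares:
  assumes "q \<noteq> 0"
  shows "tl1 q ** tl1 q = mat_scale (q + inverse q) (tl1 q)" "tl2 q ** tl2 q = mat_scale (q + inverse q) (tl2 q)"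
  using assms
  by (simp_all add: mat222_simps tl1_def tl2_def E0_def F0_def) (simp_all add: field_simps)

lemma tl_products:
  assumes "q \<noteq> 0"
  shows "tl1 q ** tl2 q ** tl1 q = tl1 q" "tl2 q ** tl1 q ** tl2 q = tl2 q"
  using assms by (simp_all add: mat222_simps tl1_def tl2_def E0_def F0_def)

definition triple_E :: "complex \<Rightarrow> complex^(2\<times>2\<times>2)^(2\<times>2\<times>2)" where
  "triple_E s = kron E0 (kron (K0 (inverse s)) (K0 (inverse s))) + kron (K0 s) (kron E0 (K0 (inverse s)))
     + kron (K0 s) (kron (K0 s) E0)"

definition triple_F :: "complex \<Rightarrow> complex^(2\<times>2\<times>2)^(2\<times>2\<times>2)" where
  "triple_F s = kron F0 (kron (K0 (inverse s)) (K0 (inverse s))) + kron (K0 s) (kron F0 (K0 (inverse s)))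
     + kron (K0 s) (kron (K0 s) F0)"

definition triple_K :: "complex \<Rightarrow> complex^(2\<times>2\<times>2)^(2\<times>2\<times>2)" where
  "triple_K s = kron (K0 s) (kron (K0 s) (K0 s))"

lemma tl_commute:
  assumes "s \<noteq> 0" "q = s^2"
  shows "triple_E s ** tl1 q = tl1 q ** triple_E s" "triple_E s ** tl2 q = tl2 q ** triple_E s"
    "triple_F s ** tl1 q = tl1 q ** triple_F s" "triple_F s ** tl2 q = tl2 q ** triple_F s"
    "triple_K s ** tl1 q = tl1 q ** triple_K s" "triple_K s ** tl2 q = tl2 q ** triple_K s"
  using assms
  by (simp_all add: mat222_simps tl1_def tl2_def E0_def F0_def K0_def triple_E_def triple_F_def triple_K_def)
    (simp_all add: field_simps power2_eq_square)

text \<open>The Casimir is \<chi>_1 on spin 1 and \<chi>_0 on spin 0, and \<chi>_1 - \<chi>_0 = (q -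
  q^{-1})^2 (q + q^{-1}); the last factor is absorbed by the normalisation of
  \<open>tl1\<close>.\<close>

lemma casimir_12:
  assumes "s \<noteq> 0" "q = s^2"
  shows "casimir_mat q (kron E0 (kron (K0 (inverse s)) (mat 1)) + kron (K0 s) (kron E0 (mat 1)))
     (kron F0 (kron (K0 (inverse s)) (mat 1)) + kron (K0 s) (kron F0 (mat 1)))
     (kron (K0 s) (kron (K0 s) (mat 1))) (kron (K0 (inverse s)) (kron (K0 (inverse s)) (mat 1)))
    = mat_scale (q^3 + inverse q ^ 3) (mat 1) - mat_scale ((q - inverse q)^2) (tl1 q)"
  using assms by (simp add: casimir_mat_def mat222_simps mat_def[of 1] tl1_def E0_def F0_def K0_def)
   (simp add: field_simps eval_nat_numeral)

lemma casimir_23: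
  assumes "s \<noteq> 0" "q = s^2"
  shows "casimir_mat q (kron (mat 1) (kron E0 (K0 (inverse s))) + kron (mat 1) (kron (K0 s) E0))
     (kron (mat 1) (kron F0 (K0 (inverse s))) + kron (mat 1) (kron (K0 s) F0))
     (kron (mat 1) (kron (K0 s) (K0 s))) (kron (mat 1) (kron (K0 (inverse s)) (K0 (inverse s))))
    = mat_scale (q^3 + inverse q ^ 3) (mat 1) - mat_scale ((q - inverse q)^2) (tl2 q)"
  using assms by (simp add: casimir_mat_def mat222_simps mat_def[of 1] tl2_def E0_def F0_def K0_def)
   (simp add: field_simps eval_nat_numeral)

text \<open>The bracket is q^2 + 1 + q^{-2} times the projection onto the spin 1/2 isotypic part,
  the complement of the Jones--Wenzl projector, and \<chi>_{3/2} - \<chi>_{1/2} = (q - q^{-1})^2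
  (q^2 + 1 + q^{-2}).\<close>

lemma casimir_123:
  assumes "s \<noteq> 0" "q = s^2"
  shows "casimir_mat q (triple_E s) (triple_F s) (triple_K s) (triple_K (inverse s))
    = mat_scale (q^4 + inverse q ^ 4) (mat 1) - mat_scale ((q - inverse q)^2)
       (mat_scale (q + inverse q) (tl1 q + tl2 q) - tl1 q ** tl2 q - tl2 q ** tl1 q)"
  using assms by (simp add: casimir_mat_def mat222_simps mat_def[of 1] tl1_def tl2_def E0_def F0_def K0_def triple_E_def triple_F_def
    triple_K_def)
   (simp add: field_simps eval_nat_numeral)

section \<open>The commutant of the triple tensor product\<close>

definition ups :: "2 \<Rightarrow> nat" where "ups i = (if i = 1 then 1 else 0)"

text \<open>A basis vector with u indices equal to 1 has eigenvalue s^u s^{-(3-u)} = s^{-3} (s^2)^u.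
  In this form distinct weights differ by natural powers of q.\<close>

lemma triple_K_nth:
  "s \<noteq> 0 \<Longrightarrow> triple_K s $ (i1,i2,i3) $ (j1,j2,j3) =
     (if (i1,i2,i3) = (j1,j2,j3) then inverse s ^ 3 * (s^2) ^ (ups i1 + ups i2 + ups i3) else 0)"
  using exhaust_2[of i1] exhaust_2[of i2] exhaust_2[of i3] exhaust_2[of j1] exhaust_2[of j2] exhaust_2[of j3]
  by (auto simp: triple_K_def kron3_nth K0_def mat2_nth ups_def eval_nat_numeral field_simps)

text \<open>Different weights give different eigenvalues of q^H because q is not a root of unity, so
  a commuting matrix is block diagonal.\<close>

lemma commutant_weight:
  assumes s: "s \<noteq> 0" and gen: "\<And>n::nat. n > 0 \<Longrightarrow> (s^2)^n \<noteq> 1"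
    and K: "triple_K s ** n = n ** triple_K s" and ne: "ups i1 + ups i2 + ups i3 \<noteq> ups j1 + ups j2 + ups j3"
  shows "n $ (i1,i2,i3) $ (j1,j2,j3) = 0"
proof -
  have less: False if "(s^2)^a = (s^2)^b" "a < b" for a b :: nat
  proof -
    obtain c where c: "0 < c" "a + c = b"
      using less_imp_add_positive \<open>a < b\<close> by blast
    then have "(s^2)^a = (s^2)^a * (s^2)^c"
      using that(1) power_add[of "s^2" a c] by simp
    then show False
      using gen[OF c(1)] s by simp
  qed
  have inj: "a = b" if "(s^2)^a = (s^2)^b" for a b :: nat
    using less[OF that] less[OF that[symmetric]] by (cases a b rule: linorder_cases) auto
  have "(triple_K s ** n) $ (i1,i2,i3) $ (j1,j2,j3) = (n ** triple_K s) $ (i1,i2,i3) $ (j1,j2,j3)"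
    using K by simp
  moreover have "(triple_K s ** n) $ (i1,i2,i3) $ (j1,j2,j3) =
      inverse s ^ 3 * (s^2) ^ (ups i1 + ups i2 + ups i3) * n $ (i1,i2,i3) $ (j1,j2,j3)"
    using exhaust_2[of i1] exhaust_2[of i2] exhaust_2[of i3]
    by (auto simp: mat_mult_nth sum_222 triple_K_nth s)
  moreover have "(n ** triple_K s) $ (i1,i2,i3) $ (j1,j2,j3) =
      inverse s ^ 3 * (s^2) ^ (ups j1 + ups j2 + ups j3) * n $ (i1,i2,i3) $ (j1,j2,j3)"
    using exhaust_2[of j1] exhaust_2[of j2] exhaust_2[of j3]
    by (auto simp: mat_mult_nth sum_222 triple_K_nth s)
  ultimately show ?thesis
    using inj[of "ups i1 + ups i2 + ups i3" "ups j1 + ups j2 + ups j3"] ne s by auto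
qed

text \<open>The first entry tested is the block of weight q^{3/2}; the other four are the entries of
  the 3 by 3 block of weight q^{1/2} that avoid the middle index (1,2,1). E and F force everything
  else.\<close>

lemma commutant_zero:
  assumes s: "s \<noteq> 0" and gen: "\<And>n::nat. n > 0 \<Longrightarrow> (s^2)^n \<noteq> 1"
    and E: "triple_E s ** n = n ** triple_E s" and F: "triple_F s ** n = n ** triple_F s"
    and K: "triple_K s ** n = n ** triple_K s"
    and zero: "n $ (1,1,1) $ (1,1,1) = 0" "n $ (1,1,2) $ (1,1,2) = 0" "n $ (1,1,2) $ (2,1,1) = 0"
      "n $ (2,1,1) $ (1,1,2) = 0" "n $ (2,1,1) $ (2,1,1) = 0"
  shows "n = 0"
proof -
  have "\<forall>i1 i2 i3 j1 j2 j3. ups i1 + ups i2 + ups i3 \<noteq> ups j1 + ups j2 + ups j3 \<longrightarrow> n $ (i1,i2,i3) $ (j1,j2,j3) = 0"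
    using commutant_weight[OF s gen K] by blast
  then have W: "\<forall>i1 i2 i3. \<forall>j1 j2 j3. ups i1 + ups i2 + ups i3 \<noteq> ups j1 + ups j2 + ups j3 \<longrightarrow> n $ (i1,i2,i3) $ (j1,j2,j3) = 0"
     by blast
  note W = W[unfolded forall_2 ups_def, simplified]
  have Fn: "(triple_F s ** n) $ i $ j = (n ** triple_F s) $ i $ j"
    and En: "(triple_E s ** n) $ i $ j = (n ** triple_E s) $ i $ j" for i j
    using E F by simp_all
  note ent = mat_mult_nth sum_222 triple_E_def triple_F_def E0_def F0_def K0_def kron3_nth mat2_nth W zero s
  \<comment> \<open>The column (1,1,1) of F n = n F: in each row the left side vanishes and two of
    the three terms on the right are zero by assumption. The next step is the same argument for E
    and the row (1,1,1).\<close>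
  have z1: "n $ (1,1,2) $ (1,2,1) = 0" "n $ (2,1,1) $ (1,2,1) = 0"
    using Fn[of "(1,1,2)" "(1,1,1)"] Fn[of "(2,1,1)" "(1,1,1)"] by (simp_all add: ent)
  have z2: "n $ (1,2,1) $ (1,1,2) = 0" "n $ (1,2,1) $ (2,1,1) = 0"
    using En[of "(1,1,1)" "(1,1,2)"] En[of "(1,1,1)" "(2,1,1)"] by (simp_all add: ent)
  have z3: "n $ (1,2,1) $ (1,2,1) = 0"
    using Fn[of "(1,2,1)" "(1,1,1)"] by (simp add: ent z2)
  note z = z1 z2 z3
  \<comment> \<open>The equations say that a row of \<open>n\<close> annihilates the image under F
    of the weight space for q^{1/2}. Up to a power of s, the determinant of F from there to the
    weight space for q^{-1/2} is s^4 + 1; its vanishing would give q^4 = 1.\<close>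
  have solve: "a = 0 \<and> b = 0 \<and> c = 0"
    if "a * (s * s) + b = 0" "a + c = 0" "b + c * (inverse s * inverse s) = 0" for a b c
  proof -
    from that have c: "c = - a" and b: "b = - (a * (s * s))"
      by (auto simp: add_eq_0_iff)
    have "a * (s^4 + 1) = - (s * s) * (b + c * (inverse s * inverse s))"
      using s unfolding b c by (simp add: field_simps eval_nat_numeral)
    then have "a * (s^4 + 1) = 0"
      using that(3) by simp
    moreover have "s^4 + 1 \<noteq> 0"
    proof
      assume "s^4 + 1 = 0"
      then have "s^4 = - 1"
        by (metis add_eq_0_iff minus_equation_iff)
      moreover have "(s^2)^4 = s^4 * s^4"
        by (simp flip: power_mult power_add)
      ultimately show False
        using gen[of 4] by simp
    qed
    ultimately show ?thesis
      using b c by simp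
  qed
  have r': "n $ i $ (1,2,2) = 0 \<and> n $ i $ (2,1,2) = 0 \<and> n $ i $ (2,2,1) = 0"
    if i: "(triple_F s ** n) $ i $ (1,1,2) = 0" "(triple_F s ** n) $ i $ (1,2,1) = 0"
      "(triple_F s ** n) $ i $ (2,1,1) = 0" for i
    using i unfolding Fn by (intro solve) (simp_all add: ent)
  have "n $ (1,2,2) $ (1,2,2) = 0 \<and> n $ (1,2,2) $ (2,1,2) = 0 \<and> n $ (1,2,2) $ (2,2,1) = 0"
    "n $ (2,1,2) $ (1,2,2) = 0 \<and> n $ (2,1,2) $ (2,1,2) = 0 \<and> n $ (2,1,2) $ (2,2,1) = 0"
    "n $ (2,2,1) $ (1,2,2) = 0 \<and> n $ (2,2,1) $ (2,1,2) = 0 \<and> n $ (2,2,1) $ (2,2,1) = 0"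
    by (rule r'; simp add: ent z)+
  note r = this
  have z4: "n $ (2,2,2) $ (2,2,2) = 0"
    using Fn[of "(2,2,2)" "(1,2,2)"] by (simp add: ent z r)
  show ?thesis
    by (simp add: mat222_eq_iff forall_2 W zero z r z4)
qed


definition tl_comb :: "complex^'n^'n \<Rightarrow> complex^'n^'n \<Rightarrow> complex \<Rightarrow> complex \<Rightarrow> complex \<Rightarrow> complex \<Rightarrow> complex \<Rightarrow> complex^'n^'n"
  where "tl_comb S T a b c d e = mat_scale a (mat 1) + mat_scale b S + mat_scale c T
     + mat_scale d (S ** T) + mat_scale e (T ** S)"

text \<open>These are exactly the five entries tested by \<open>commutant_zero\<close>. They
  determine the coefficients triangularly, starting from \<open>a\<close>, which gives both the
  existence and the uniqueness of the expansion.\<close>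

lemma tl_comb_entries:
  assumes "q \<noteq> 0"
  shows "tl_comb (tl1 q) (tl2 q) a b c d e $ (1,1,1) $ (1,1,1) = a"
    "tl_comb (tl1 q) (tl2 q) a b c d e $ (1,1,2) $ (1,1,2) = a + c * inverse q"
    "tl_comb (tl1 q) (tl2 q) a b c d e $ (1,1,2) $ (2,1,1) = e"
    "tl_comb (tl1 q) (tl2 q) a b c d e $ (2,1,1) $ (1,1,2) = d"
    "tl_comb (tl1 q) (tl2 q) a b c d e $ (2,1,1) $ (2,1,1) = a + b * q"
  using assms
  by (simp_all add: tl_comb_def mat222_simps tl1_def tl2_def E0_def F0_def mat_def[of 1])

lemma tl_comb_commute:
  assumes "s \<noteq> 0" "q = s^2" "X \<in> {triple_E s, triple_F s, triple_K s}"
  shows "X ** tl_comb (tl1 q) (tl2 q) a b c d e = tl_comb (tl1 q) (tl2 q) a b c d e ** X"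
proof -
  have 1: "X ** tl1 q = tl1 q ** X" and 2: "X ** tl2 q = tl2 q ** X"
    using tl_commute[OF assms(1,2)] assms(3) by auto
  have "X ** (tl1 q ** tl2 q) = tl1 q ** tl2 q ** X" "X ** (tl2 q ** tl1 q) = tl2 q ** tl1 q ** X"
    by (rule matrix_commute_mult; fact)+
  then show ?thesis
    by (simp add: tl_comb_def matrix_add_ldistrib matrix_add_rdistrib mat_scale_simps 1 2)
qed

lemma commutant_eq_tl_comb:
  assumes s: "s \<noteq> 0" "q = s^2" and gen: "\<And>n::nat. n > 0 \<Longrightarrow> q^n \<noteq> 1"
    and m: "\<And>X. X \<in> {triple_E s, triple_F s, triple_K s} \<Longrightarrow> X ** m = m ** X"
  shows "\<exists>a b c d e. m = tl_comb (tl1 q) (tl2 q) a b c d e"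
proof -
  define a where "a = m $ (1,1,1) $ (1,1,1)"
  \<comment> \<open>The coefficients come from solving the equations in
    \<open>tl_comb_entries\<close> for the five entries of \<open>m\<close>.\<close>
  define t where "t = tl_comb (tl1 q) (tl2 q) a ((m $ (2,1,1) $ (2,1,1) - a) / q)
    ((m $ (1,1,2) $ (1,1,2) - a) * q) (m $ (2,1,1) $ (1,1,2)) (m $ (1,1,2) $ (2,1,1))"
  have q: "q \<noteq> 0"
    using s by simp
  have "X ** (m - t) = (m - t) ** X" if "X \<in> {triple_E s, triple_F s, triple_K s}" for X
    using m[OF that] tl_comb_commute[OF s that] by (simp add: matrix_diff_distrib t_def)
  moreover have "(m - t) $ (1,1,1) $ (1,1,1) = 0" "(m - t) $ (1,1,2) $ (1,1,2) = 0"
    "(m - t) $ (1,1,2) $ (2,1,1) = 0" "(m - t) $ (2,1,1) $ (1,1,2) = 0" "(m - t) $ (2,1,1) $ (2,1,1) = 0"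
    using q by (simp_all add: t_def tl_comb_entries a_def mult.assoc)
  ultimately have "m - t = 0"
    using gen unfolding s(2) by (intro commutant_zero[OF s(1)]) auto
  then have "m = t"
    by simp
  then show ?thesis
    unfolding t_def by blast
qed

lemma tl_comb_eq_0:
  assumes "q \<noteq> 0" "tl_comb (tl1 q) (tl2 q) a b c d e = 0"
  shows "a = 0 \<and> b = 0 \<and> c = 0 \<and> d = 0 \<and> e = 0"
  using tl_comb_entries[OF assms(1), of a b c d e] assms by simp

subsection \<open>Diagonalisation\<close>

lemma matrix_mult_mat2:
  fixes M g :: "complex^2^2"
  assumes "M *v column 1 g = a *s column 1 g + c *s column 2 g"
    and "M *v column 2 g = b *s column 1 g + d *s column 2 g"
  shows "M ** g = g ** mat2 a b c d"
proof -
  have "(M ** g) $ i $ j = (g ** mat2 a b c d) $ i $ j" for i j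
    using exhaust_2[of j] arg_cong[OF assms(1), of "\<lambda>x. x $ i"] arg_cong[OF assms(2), of "\<lambda>x. x $ i"]
    by (auto simp: matrix_matrix_mult_def matrix_vector_mult_def column_def sum_2 mat2_nth)
  then show ?thesis
    by (simp add: vec_eq_iff)
qed

lemma matrix_vector_add_rdistrib: "(A + B) *v x = A *v x + B *v x" for A B :: "complex^'n^'n"
  by (simp add: vec_eq_iff matrix_vector_mult_def sum.distrib algebra_simps)

lemma mat_scale_vector: "mat_scale c A *v x = c *s (A *v x)" for A :: "complex^'n^'n"
  by (simp add: vec_eq_iff matrix_vector_mult_def mat_scale_def sum_distrib_left algebra_simps)

locale spin_half =
  fixes q s :: complex and \<pi> :: "2 uq_rep"
  assumes q0: "q \<noteq> 0" and generic: "\<forall>n::nat. n > 0 \<longrightarrow> q ^ n \<noteq> 1" and s2: "s ^ 2 = q"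
    and spin: "spin_rep q s (1/2) \<pi>"
begin

sublocale uq_matrix_rep q \<pi>
  by unfold_locales (use q0 spin in \<open>simp_all add: spin_rep_def\<close>)

lemma s0: "s \<noteq> 0"
  using q0 s2 by auto

lemma q_neq: "q \<noteq> inverse q"
  using generic[rule_format, of 2] q0 by (auto simp: power2_eq_square field_simps)

text \<open>The highest weight vector v and w = F v form a basis, and the relations of the quantum
  algebra fix all matrices with respect to it.\<close>

lemma diagonalisation:
  obtains g g' :: "complex^2^2" where "g ** g' = mat 1" "g' ** g = mat 1"
    "rep (gen gE) = g ** E0 ** g'" "rep (gen gF) = g ** F0 ** g'"
    "rep (gen gK) = g ** K0 s ** g'" "rep (gen gKinv) = g ** K0 (inverse s) ** g'"
proof -
  let ?E = "rep (gen gE)" and ?F = "rep (gen gF)" and ?K = "rep (gen gK)" and ?L = "rep (gen gKinv)"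
  from spin obtain v where Ev: "?E *v v = 0" and Kv: "?K *v v = s *s v"
    and gen: "(\<lambda>x. \<pi> x *v v) ` carrier (Uq q) = UNIV"
    by (auto simp: spin_rep_def rep_def half_power_def)
  have KL: "?L ** ?K = mat 1" and KF: "?K ** ?F = mat_scale (inverse q) (?F ** ?K)"
    and EF: "?E ** ?F = ?F ** ?E + mat_scale (1 / (q - inverse q)) (?K ** ?K - ?L ** ?L)"
    using rep_relations by (simp_all add: uq_relations_def diff_eq_eq add.commute)
  have v0: "v \<noteq> 0"
  proof
    assume "v = 0"
    then have "UNIV = {0 :: complex^2}"
      using gen by auto
    then have "(1 :: complex^2) = 0"
      by blast
    then show False
      by (simp add: vec_eq_iff)
  qed
  define w where "w = ?F *v v"
  have Lv: "?L *v v = inverse s *s v"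
  proof -
    have "v = ?L *v (?K *v v)"
      by (simp add: matrix_vector_mul_assoc KL)
    then have "v = s *s (?L *v v)"
      by (simp add: Kv vec.scale)
    then have "inverse s *s v = inverse s *s (s *s (?L *v v))"
      by simp
    then show ?thesis
      using s0 by (simp add: vector_smult_assoc)
  qed
  \<comment> \<open>On weight q^{1/2} the commutator [E,F] acts by (q - q^{-1}) / (q - q^{-1}) =
    1.\<close>
  have Ew: "?E *v w = v"
  proof -
    have "?E *v w = (?E ** ?F) *v v"
      by (simp add: w_def matrix_vector_mul_assoc)
    also have "\<dots> = ?F *v (?E *v v) + (1 / (q - inverse q)) *s (?K *v (?K *v v) - ?L *v (?L *v v))"
      unfolding EF matrix_vector_add_rdistrib mat_scale_vector matrix_vector_mult_diff_rdistrib
      by (simp add: matrix_vector_mul_assoc)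
    also have "\<dots> = (1 / (q - inverse q) * (s * s - inverse s * inverse s)) *s v"
      by (simp add: Ev Kv Lv vec.scale vec_eq_iff algebra_simps)
    also have "s * s - inverse s * inverse s = q - inverse q"
      using s2 by (simp add: power2_eq_square flip: inverse_mult_distrib)
    finally show ?thesis
      using q_neq by simp
  qed
  have KF': "?K *v (?F *v x) = inverse q *s (?F *v (?K *v x))" for x
    by (simp only: matrix_vector_mul_assoc KF mat_scale_vector)
  have Kw: "?K *v w = inverse s *s w"
  proof -
    have "?K *v w = (inverse q * s) *s w"
      unfolding w_def KF' by (simp add: Kv vec.scale vector_smult_assoc)
    also have "inverse q * s = inverse s"
      using s0 by (simp add: power2_eq_square flip: s2)
    finally show ?thesis .
  qed
  define g :: "complex^2^2" where "g = (\<chi> i j. if j = 1 then v $ i else w $ i)"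
  have col: "column 1 g = v" "column 2 g = w"
    by (simp_all add: g_def column_def vec_eq_iff)
  have g_mult: "g *v x = x $ 1 *s v + x $ 2 *s w" for x
    by (simp add: vec_eq_iff g_def matrix_vector_mult_def sum_2 mult.commute)
  \<comment> \<open>E maps v to 0 and w to v, so applying it isolates the coefficient of w.\<close>
  have "x = 0" if "g *v x = 0" for x
  proof -
    have "?E *v (g *v x) = x $ 2 *s v"
      by (simp add: g_mult vec.add vec.scale Ev Ew)
    then have x2: "x $ 2 = 0"
      using that v0 by simp
    moreover have "x $ 1 = 0"
      using that v0 g_mult[of x] x2 by simp
    ultimately show ?thesis
      by (simp add: vec_eq_iff forall_2)
  qed
  then obtain g' where g'g: "g' ** g = mat 1"
    using matrix_left_invertible_ker[of g] by blast
  then have gg': "g ** g' = mat 1"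
    using matrix_left_right_inverse by blast
  have conj: "M = g ** N ** g'" if "M ** g = g ** N" for M N
    unfolding that[symmetric] by (simp add: gg' flip: matrix_mul_assoc)
  \<comment> \<open>F w would have q^H-eigenvalue q^{-3/2}, which differs from the eigenvalues
    q^{1/2} of v and q^{-1/2} of w.\<close>
  have Fw: "?F *v w = 0"
  proof -
    define a b where "a = (g' *v (?F *v w)) $ 1" and "b = (g' *v (?F *v w)) $ 2"
    have "g *v (g' *v y) = y" for y
      by (simp add: matrix_vector_mul_assoc gg')
    then have Fw: "?F *v w = a *s v + b *s w"
      using g_mult[of "g' *v (?F *v w)"] by (simp add: a_def b_def)
    have "?K *v (?F *v w) = (inverse q * inverse s) *s (?F *v w)"
      unfolding KF' by (simp add: Kw vec.scale vector_smult_assoc)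
    then have "?K *v (a *s v + b *s w) = (inverse q * inverse s) *s (a *s v + b *s w)"
      by (simp add: Fw)
    then have *: "(a * (s - inverse q * inverse s)) *s v + (b * (inverse s - inverse q * inverse s)) *s w = 0"
      by (simp add: vec.add vec.scale Kv Kw vec_eq_iff algebra_simps)
    define x :: "complex^2" where
      "x = (\<chi> i. if i = 1 then a * (s - inverse q * inverse s) else b * (inverse s - inverse q * inverse s))"
    have "g *v x = 0"
      using * by (simp add: g_mult x_def)
    then have "g' *v (g *v x) = 0"
      by simp
    then have "x = 0"
      by (simp add: matrix_vector_mul_assoc g'g)
    then have "a * (s - inverse q * inverse s) = 0" "b * (inverse s - inverse q * inverse s) = 0"
      by (simp_all add: x_def vec_eq_iff forall_2)
    moreover have "s - inverse q * inverse s \<noteq> 0"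
    proof
      assume "s - inverse q * inverse s = 0"
      then have "q * s * (s - inverse q * inverse s) = 0"
        by simp
      then have "q ^ 2 = 1"
        using s0 q0 s2 by (simp add: algebra_simps power2_eq_square)
      then show False
        using generic[rule_format, of 2] by simp
    qed
    moreover have "inverse s - inverse q * inverse s \<noteq> 0"
    proof
      assume "inverse s - inverse q * inverse s = 0"
      then have "q * s * (inverse s - inverse q * inverse s) = 0"
        by simp
      then have "q = 1"
        using s0 q0 by (simp add: algebra_simps)
      then show False
        using generic[rule_format, of 1] by simp
    qed
    ultimately show ?thesis
      by (simp add: Fw)
  qed
  have 1: "?E ** g = g ** E0" and 2: "?F ** g = g ** F0" and 3: "?K ** g = g ** K0 s"
    unfolding E0_def F0_def K0_def
    by (rule matrix_mult_mat2; simp add: col Ev Ew Kv Kw Fw; simp add: w_def)+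
  have 4: "?L ** g = g ** K0 (inverse s)"
  proof -
    have KK: "K0 s ** K0 (inverse s) = mat 1"
      using s0 by (simp add: vec_eq_iff forall_2 K0_def matrix_matrix_mult_def sum_2 mat2_nth mat_one_nth)
    have "?L ** (g ** (K0 s ** K0 (inverse s))) = ?L ** (g ** K0 s) ** K0 (inverse s)"
      by (simp add: matrix_mul_assoc)
    also have "\<dots> = (?L ** ?K) ** g ** K0 (inverse s)"
      unfolding 3[symmetric] by (simp add: matrix_mul_assoc)
    finally show ?thesis
      by (simp add: KL KK)
  qed
  show thesis
    by (rule that[OF gg' g'g conj[OF 1] conj[OF 2] conj[OF 3] conj[OF 4]])
qed

lemma repc_relations: "uq_relations q (repc (gen gE)) (repc (gen gF)) (repc (gen gK)) (repc (gen gKinv))"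
  using mat_hom_uq_rels[OF repc_hom] repc_uq_ideal genideal_superset unfolding uq_ideal_def by blast

lemma carrier_centralizer_EFK:
  "m \<in> carrier (centralizer q \<pi> \<pi> \<pi>) \<longleftrightarrow> (\<forall>g\<in>{gE, gF, gK}. repc (gen g) ** m = m ** repc (gen g))"
proof -
  have "repc (gen gKinv) ** m = m ** repc (gen gKinv)" if "repc (gen gK) ** m = m ** repc (gen gK)"
  proof -
    have KL: "repc (gen gK) ** repc (gen gKinv) = mat 1" "repc (gen gKinv) ** repc (gen gK) = mat 1"
      using repc_relations by (simp_all add: uq_relations_def)
    have "repc (gen gKinv) ** m = repc (gen gKinv) ** (m ** repc (gen gK)) ** repc (gen gKinv)"
      by (simp add: KL flip: matrix_mul_assoc)
    also have "\<dots> = m ** repc (gen gKinv)"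
      unfolding that[symmetric] by (simp add: KL matrix_mul_assoc)
    finally show ?thesis .
  qed
  moreover have "(\<forall>g. P g) \<longleftrightarrow> P gE \<and> P gF \<and> P gK \<and> P gKinv" for P
    by (metis uq_gen.exhaust)
  ultimately show ?thesis
    by (auto simp: carrier_centralizer)
qed

text \<open>The explicit matrices are transported to the given representation by conjugation with
  the triple Kronecker power of the change of basis. Only relations, expansions and independence are
  exported, so nothing later refers to matrix entries.\<close>

theorem temperley_lieb:
  obtains S T where
    "S ** S = mat_scale (q + inverse q) S" "T ** T = mat_scale (q + inverse q) T"
    "S ** T ** S = S" "T ** S ** T = T"
    "C12 q \<pi> \<pi> \<pi> = mat_scale (q^3 + inverse q ^ 3) (mat 1) - mat_scale ((q - inverse q)^2) S"
    "C23 q \<pi> \<pi> \<pi> = mat_scale (q^3 + inverse q ^ 3) (mat 1) - mat_scale ((q - inverse q)^2) T"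
    "C123 q \<pi> \<pi> \<pi> = mat_scale (q^4 + inverse q ^ 4) (mat 1) - mat_scale ((q - inverse q)^2)
       (mat_scale (q + inverse q) (S + T) - S ** T - T ** S)"
    "\<forall>m. m \<in> carrier (centralizer q \<pi> \<pi> \<pi>) \<longleftrightarrow> (\<exists>a b c d e. m = tl_comb S T a b c d e)"
    "\<forall>a b c d e. tl_comb S T a b c d e = 0 \<longrightarrow> a = 0 \<and> b = 0 \<and> c = 0 \<and> d = 0 \<and> e = 0"
proof -
  obtain g g' :: "complex^2^2" where inv: "g ** g' = mat 1" "g' ** g = mat 1"
    and rep: "rep (gen gE) = g ** E0 ** g'" "rep (gen gF) = g ** F0 ** g'"
      "rep (gen gK) = g ** K0 s ** g'" "rep (gen gKinv) = g ** K0 (inverse s) ** g'"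
    by (rule diagonalisation)
  define G where "G = kron g (kron g g)"
  define G' where "G' = kron g' (kron g' g')"
  define cj where "cj M = G ** M ** G'" for M
  have GG: "G ** G' = mat 1" "G' ** G = mat 1"
    by (simp_all add: G_def G'_def kron_mult inv kron_one)
  have cj_kron: "kron (g ** A ** g') (kron (g ** B ** g') (g ** C ** g')) = cj (kron A (kron B C))" for A B C
    by (simp add: cj_def G_def G'_def kron_mult)
  have cj_kron1: "kron (mat 1) (kron (g ** B ** g') (g ** C ** g')) = cj (kron (mat 1) (kron B C))"
    "kron (g ** B ** g') (kron (g ** C ** g') (mat 1)) = cj (kron B (kron C (mat 1)))" for B C
    using cj_kron[of "mat 1" B C] cj_kron[of B C "mat 1"] by (simp_all add: inv)
  have cj_add: "cj (M + N) = cj M + cj N" and cj_diff: "cj (M - N) = cj M - cj N"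
    and cj_scale: "cj (mat_scale c M) = mat_scale c (cj M)" and cj_one: "cj (mat 1) = mat 1" for M N c
    by (simp_all add: cj_def matrix_add_ldistrib matrix_add_rdistrib matrix_diff_distrib mat_scale_simps GG)
  have cj_mult: "cj M ** cj N = cj (M ** N)" for M N
  proof -
    have "cj M ** cj N = G ** M ** (G' ** G) ** N ** G'"
      by (simp add: cj_def matrix_mul_assoc)
    then show ?thesis
      by (simp add: GG cj_def matrix_mul_assoc)
  qed
  have cj_surj: "cj (G' ** M ** G) = M" for M
  proof -
    have "cj (G' ** M ** G) = (G ** G') ** M ** (G ** G')"
      by (simp add: cj_def matrix_mul_assoc)
    then show ?thesis
      by (simp add: GG)
  qed
  have cj_inj: "cj M = cj N \<longleftrightarrow> M = N" for M N
  proof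
    have "G' ** cj M ** G = M" for M
    proof -
      have "G' ** cj M ** G = (G' ** G) ** M ** (G' ** G)"
        by (simp add: cj_def matrix_mul_assoc)
      then show ?thesis
        by (simp add: GG)
    qed
    then show "cj M = cj N \<Longrightarrow> M = N"
      by metis
  qed simp
  have cj_casimir: "casimir_mat q (cj A) (cj B) (cj C) (cj D) = cj (casimir_mat q A B C D)" for A B C D
    by (simp add: casimir_mat_def cj_add cj_scale cj_mult)
  note homs = rep_hom rep2_hom kron_one_hom
  have triple: "repc (gen gE) = cj (triple_E s)" "repc (gen gF) = cj (triple_F s)"
      "repc (gen gK) = cj (triple_K s)" "repc (gen gKinv) = cj (triple_K (inverse s))"
    by (simp_all add: repc_def rep2_def coprod_hom_gens coprod_hom_hom rep_hom rep kron_simps cj_kron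
        cj_add triple_E_def triple_F_def triple_K_def add.assoc)
  have tl_cj: "tl_comb (cj (tl1 q)) (cj (tl2 q)) a b c d e = cj (tl_comb (tl1 q) (tl2 q) a b c d e)"
    for a b c d e
    by (simp add: tl_comb_def cj_add cj_scale cj_mult cj_one)
  show thesis
  proof (rule that[of "cj (tl1 q)" "cj (tl2 q)"])
    show "cj (tl1 q) ** cj (tl1 q) = mat_scale (q + inverse q) (cj (tl1 q))"
      "cj (tl2 q) ** cj (tl2 q) = mat_scale (q + inverse q) (cj (tl2 q))"
      by (simp_all add: cj_mult cj_scale tl_squares[OF q0])
    show "cj (tl1 q) ** cj (tl2 q) ** cj (tl1 q) = cj (tl1 q)" "cj (tl2 q) ** cj (tl1 q) ** cj (tl2 q) = cj (tl2 q)"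
      by (simp_all add: cj_mult tl_products[OF q0])
    show "C12 q \<pi> \<pi> \<pi> = mat_scale (q^3 + inverse q ^ 3) (mat 1) - mat_scale ((q - inverse q)^2) (cj (tl1 q))"
      unfolding casimir_images casimir_of_def
      by (simp add: coprod_hom_gens homs rep cj_kron1 cj_casimir casimir_12[OF s0 s2[symmetric]]
          cj_diff cj_scale cj_one flip: cj_add)
    show "C23 q \<pi> \<pi> \<pi> = mat_scale (q^3 + inverse q ^ 3) (mat 1) - mat_scale ((q - inverse q)^2) (cj (tl2 q))"
    proof -
      have "kron (mat 1 :: complex^2^2) (casimir_mat q A B C D) =
          casimir_mat q (kron (mat 1) A) (kron (mat 1) B) (kron (mat 1) C) (kron (mat 1) D)"
        for A B C D :: "complex^(2\<times>2)^(2\<times>2)"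
        by (simp add: casimir_mat_def kron_simps kron_mult)
      then show ?thesis
        unfolding casimir_images casimir_of_def
        by (simp add: rep2_def coprod_hom_gens homs rep kron_simps cj_kron1 cj_casimir
            casimir_23[OF s0 s2[symmetric]] cj_diff cj_scale cj_one flip: cj_add)
    qed
    show "C123 q \<pi> \<pi> \<pi> = mat_scale (q^4 + inverse q ^ 4) (mat 1) - mat_scale ((q - inverse q)^2)
       (mat_scale (q + inverse q) (cj (tl1 q) + cj (tl2 q)) - cj (tl1 q) ** cj (tl2 q) - cj (tl2 q) ** cj (tl1 q))"
      unfolding casimir_images casimir_of_def triple
      by (simp add: cj_casimir casimir_123[OF s0 s2[symmetric]] cj_diff cj_scale cj_one cj_mult cj_add)
    show "\<forall>a b c d e. tl_comb (cj (tl1 q)) (cj (tl2 q)) a b c d e = 0 \<longrightarrow>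
        a = 0 \<and> b = 0 \<and> c = 0 \<and> d = 0 \<and> e = 0"
    proof (intro allI impI)
      fix a b c d e
      assume "tl_comb (cj (tl1 q)) (cj (tl2 q)) a b c d e = 0"
      then have "cj (tl_comb (tl1 q) (tl2 q) a b c d e) = cj 0"
        by (simp add: tl_cj) (simp add: cj_def)
      then show "a = 0 \<and> b = 0 \<and> c = 0 \<and> d = 0 \<and> e = 0"
        unfolding cj_inj by (rule tl_comb_eq_0[OF q0])
    qed
    show "\<forall>m. m \<in> carrier (centralizer q \<pi> \<pi> \<pi>) \<longleftrightarrow> (\<exists>a b c d e. m = tl_comb (cj (tl1 q)) (cj (tl2 q)) a b c d e)"
    proof
      fix m
      obtain n where m: "m = cj n"
        using cj_surj by metis
      have "m \<in> carrier (centralizer q \<pi> \<pi> \<pi>) \<longleftrightarrow> (\<forall>X\<in>{triple_E s, triple_F s, triple_K s}. X ** n = n ** X)"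
        by (simp add: carrier_centralizer_EFK triple m cj_mult cj_inj)
      also have "\<dots> \<longleftrightarrow> (\<exists>a b c d e. n = tl_comb (tl1 q) (tl2 q) a b c d e)"
      proof
        assume "\<forall>X\<in>{triple_E s, triple_F s, triple_K s}. X ** n = n ** X"
        then show "\<exists>a b c d e. n = tl_comb (tl1 q) (tl2 q) a b c d e"
          using generic by (intro commutant_eq_tl_comb[OF s0 s2[symmetric]]) blast+
      next
        assume "\<exists>a b c d e. n = tl_comb (tl1 q) (tl2 q) a b c d e"
        then show "\<forall>X\<in>{triple_E s, triple_F s, triple_K s}. X ** n = n ** X"
          using tl_comb_commute[OF s0 s2[symmetric]] by blast
      qed
      finally show "m \<in> carrier (centralizer q \<pi> \<pi> \<pi>) \<longleftrightarrow> (\<exists>a b c d e. m = tl_comb (cj (tl1 q)) (cj (tl2 q)) a b c d e)"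
        by (simp add: m tl_cj cj_inj)
    qed
  qed
qed

end

section \<open>The Askey--Wilson relations\<close>

locale generic_q =
  fixes q :: complex
  assumes q_nz: "q \<noteq> 0" and not_root: "\<forall>n::nat. n > 0 \<longrightarrow> q ^ n \<noteq> 1"
begin

definition x :: complex where "x = q + inverse q"

text \<open>Up to powers of q these are products of cyclotomic polynomials: q x = q^2 + 1 divides
  q^4 - 1, q^2 (x^2 - 4) = (q^2 - 1)^2, and for x^2 - 2, x^2 - 1, x^2 + x - 1 the corresponding
  multiples divide q^8 - 1, q^6 - 1, q^5 - 1. They occur as factors of differences of the values
  \<chi>_j.\<close>

lemma q_poly:
  "x \<noteq> 0" "x^2 - 4 \<noteq> 0" "x^2 - 2 \<noteq> 0" "x^2 - 1 \<noteq> 0" "x^2 + x - 1 \<noteq> 0" "q^2 - inverse q ^ 2 \<noteq> 0"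
proof -
  have ne: "q^2 - 1 \<noteq> 0" "q^4 - 1 \<noteq> 0" "q^5 - 1 \<noteq> 0" "q^6 - 1 \<noteq> 0" "q^8 - 1 \<noteq> 0"
    using not_root by simp_all
  have qx: "q * x = q^2 + 1"
    using q_nz by (simp add: x_def algebra_simps power2_eq_square)
  have "q * x * (q^2 - 1) = q^4 - 1"
    by (simp add: qx algebra_simps eval_nat_numeral)
  then show "x \<noteq> 0"
    using ne by auto
  have "(q * x)^2 - 4 * q^2 = (q^2 - 1)^2" "((q * x)^2 - 2 * q^2) * (q^4 - 1) = q^8 - 1"
    "((q * x)^2 - q^2) * (q^2 - 1) = q^6 - 1" "((q * x)^2 + q * (q * x) - q^2) * (q - 1) = q^5 - 1"
    by (simp_all add: qx algebra_simps eval_nat_numeral)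
  then have "q^2 * (x^2 - 4) = (q^2 - 1)^2" "q^2 * (x^2 - 2) * (q^4 - 1) = q^8 - 1"
    "q^2 * (x^2 - 1) * (q^2 - 1) = q^6 - 1" "q^2 * (x^2 + x - 1) * (q - 1) = q^5 - 1"
    by (simp_all add: algebra_simps power2_eq_square)
  then show "x^2 - 4 \<noteq> 0" "x^2 - 2 \<noteq> 0" "x^2 - 1 \<noteq> 0" "x^2 + x - 1 \<noteq> 0"
    using ne by auto
  have "q^2 * (q^2 - inverse q ^ 2) = q^4 - 1"
    using q_nz by (simp add: field_simps eval_nat_numeral)
  then show "q^2 - inverse q ^ 2 \<noteq> 0"
    using ne by auto
qed

text \<open>With n = 2j + 1 the value q^n + q^{-n} is the rescaled Chebyshev polynomial 2 T_n(x/2),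
  so identities between the \<chi>_j become polynomial identities in \<open>x\<close>.\<close>

lemma chi_values:
  "chi q 0 = x" "chi q (1/2) = x^2 - 2" "chi q 1 = x^3 - 3 * x" "chi q (3/2) = x^4 - 4 * x^2 + 2"
proof -
  have "\<lfloor>2 * (3/2) + 1 :: rat\<rfloor> = 4" "\<lfloor>2 * (1/2) + 1 :: rat\<rfloor> = 2" "\<lfloor>2 * 1 + 1 :: rat\<rfloor> = 3"
    by simp_all
  then show "chi q 0 = x" "chi q (1/2) = x^2 - 2" "chi q 1 = x^3 - 3 * x" "chi q (3/2) = x^4 - 4 * x^2 + 2"
    unfolding chi_def using q_nz
    by (simp_all add: x_def power_int_minus field_simps) (simp_all add: algebra_simps eval_nat_numeral)
qed

lemma x_powers:
  "q^3 + inverse q ^ 3 = x^3 - 3 * x" "q^4 + inverse q ^ 4 = x^4 - 4 * x^2 + 2" "(q - inverse q)^2 = x^2 - 4"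
  "q^2 + inverse q ^ 2 = x^2 - 2"
  using q_nz by (simp_all add: x_def field_simps eval_nat_numeral)

lemma J2_values:
  "J2 (1/2) (1/2) = {0, 1}" "J2 0 (1/2) = {1/2}" "J2 1 (1/2) = {1/2, 3/2}"
proof -
  have one: "{k. k \<le> Suc 0} = {0, 1}"
    by auto
  have le: "{a + of_nat k |k. a + of_nat k \<le> b} = (\<lambda>k. a + of_nat k) ` {k. of_nat k \<le> b - a}" for a b :: rat
    by (auto simp: le_diff_eq add.commute)
  show "J2 (1/2) (1/2) = {0, 1}" "J2 0 (1/2) = {1/2}" "J2 1 (1/2) = {1/2, 3/2}"
    unfolding J2_def le
    by (simp_all add: one)
qed

lemma J3_value: "J3 (1/2) (1/2) (1/2) = {1/2, 3/2}"
  by (auto simp: J3_def J2_values)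

lemma Mset_value:
  "Mset q (1/2) (1/2) (1/2) = {x^2 - 2 - x, x^2 - 2 - (x^3 - 3 * x), x^4 - 4 * x^2 + 2 - (x^3 - 3 * x)}"
  unfolding Mset_def J2_values
  by (simp add: Setcompr_eq_image J2_values chi_values insert_commute)

end

subsection \<open>Congruences and eigenvectors\<close>

context mon_ideal
begin

definition eqv :: "('m \<Rightarrow>\<^sub>0 complex) \<Rightarrow> ('m \<Rightarrow>\<^sub>0 complex) \<Rightarrow> bool" (infix \<open>\<doteq>\<close> 50)
  where "y \<doteq> z \<longleftrightarrow> y - z \<in> I"

lemma eqv_refl [simp, intro]: "y \<doteq> y"
  by (simp add: eqv_def zero)

lemma eqv_sym: "y \<doteq> z \<Longrightarrow> z \<doteq> y"
  using uminus[of "y - z"] by (simp add: eqv_def)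

lemma eqv_trans [trans]: "y \<doteq> z \<Longrightarrow> z \<doteq> w \<Longrightarrow> y \<doteq> w"
  using add[of "y - z" "z - w"] by (simp add: eqv_def)

lemma eqv_add: "y \<doteq> z \<Longrightarrow> y' \<doteq> z' \<Longrightarrow> y + y' \<doteq> z + z'"
  using add[of "y - z" "y' - z'"] by (simp add: eqv_def algebra_simps)

lemma eqv_diff: "y \<doteq> z \<Longrightarrow> y' \<doteq> z' \<Longrightarrow> y - y' \<doteq> z - z'"
  using diff[of "y - z" "y' - z'"] by (simp add: eqv_def algebra_simps)

lemma eqv_mult: "y \<doteq> z \<Longrightarrow> y' \<doteq> z' \<Longrightarrow> y * y' \<doteq> z * z'"
  using add[OF right[of "y - z" y'] left[of "y' - z'" z]] by (simp add: eqv_def algebra_simps)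

lemma eqv_left: "y \<doteq> z \<Longrightarrow> w * y \<doteq> w * z" and eqv_right: "y \<doteq> z \<Longrightarrow> y * w \<doteq> z * w"
  by (simp_all add: eqv_mult)

lemma eqv_cancel: "c \<noteq> 0 \<Longrightarrow> cst c * y \<doteq> cst c * z \<Longrightarrow> y \<doteq> z"
  using eqv_left[of "cst c * y" "cst c * z" "cst (inverse c)"]
  by (simp add: cst_simps flip: mult.assoc cst_simps(6))

lemma eqv_0_iff: "y \<doteq> 0 \<longleftrightarrow> y \<in> I"
  by (simp add: eqv_def)

lemma eqv_0_cancel: "c \<noteq> 0 \<Longrightarrow> cst c * y \<doteq> 0 \<Longrightarrow> y \<doteq> 0"
  using eqv_cancel[of c y 0] by simp

lemma eqv_sum: "(\<And>i. i \<in> S \<Longrightarrow> f i \<doteq> g i) \<Longrightarrow> sum f S \<doteq> sum g S"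
  by (induction S rule: infinite_finite_induct) (auto intro: eqv_add)

lemma cst_left_commute: "y * (cst c * z) = cst c * (y * z)"
  by (metis cst_commute mult.assoc)

text \<open>A polynomial in \<open>y\<close> acts on an eigenvector through its value at the
  eigenvalue. This spares expanding the products: relations of the quotient are exploited through
  \<open>no_eigenvector\<close> and verified through \<open>root_prod_eigenvector_0\<close>.\<close>

lemma root_prod_eigenvector:
  assumes "y * w \<doteq> cst c * w"
  shows "root_prod f S y * w \<doteq> cst (\<Prod>i\<in>S. c - f i) * w"
proof -
  define p where "p = (\<Prod>i\<in>S. [:- f i, 1:])"
  have pow: "y ^ n * w \<doteq> cst (c ^ n) * w" for n
  proof (induction n)
    case (Suc n)
    have "y ^ Suc n * w = y * (y ^ n * w)"
      by (simp add: mult.assoc)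
    also have "\<dots> \<doteq> y * (cst (c ^ n) * w)"
      by (rule eqv_left[OF Suc])
    also have "\<dots> = cst (c ^ n) * (y * w)"
      by (rule cst_left_commute)
    also have "\<dots> \<doteq> cst (c ^ n) * (cst c * w)"
      by (rule eqv_left[OF assms])
    also have "\<dots> = cst (c ^ Suc n) * w"
      by (simp add: mult.assoc[symmetric] mult.commute[of c] flip: cst_simps(6))
    finally show ?case .
  qed (simp add: cst_simps)
  have "root_prod f S y * w = (\<Sum>n\<le>degree p. cst (coeff p n) * (y ^ n * w))"
    by (simp add: root_prod_def p_def[symmetric] sum_distrib_right mult.assoc)
  also have "\<dots> \<doteq> (\<Sum>n\<le>degree p. cst (coeff p n) * (cst (c ^ n) * w))"
    by (intro eqv_sum eqv_left pow)
  also have "\<dots> = (\<Sum>n\<le>degree p. cst (coeff p n * c ^ n)) * w"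
    by (simp add: sum_distrib_right cst_simps mult.assoc)
  also have "(\<Sum>n\<le>degree p. cst (coeff p n * c ^ n)) = cst (poly p c)"
  proof -
    have "(\<Sum>n\<in>N. cst (g n)) = cst (\<Sum>n\<in>N. g n)" for g and N :: "nat set"
      by (induction N rule: infinite_finite_induct) (simp_all add: cst_simps)
    then show ?thesis
      by (simp add: poly_altdef)
  qed
  also have "poly p c = (\<Prod>i\<in>S. c - f i)"
    by (simp add: p_def poly_prod)
  finally show ?thesis .
qed

lemma root_prod_eigenvector_0:
  assumes "finite S" "c \<in> f ` S" "y * w \<doteq> cst c * w"
  shows "root_prod f S y * w \<doteq> 0"
proof -
  have "(\<Prod>i\<in>S. c - f i) = 0"
    using assms(1,2) by auto
  then show ?thesis
    using root_prod_eigenvector[OF assms(3), of f S] by (simp add: cst_simps)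
qed

lemma no_eigenvector:
  assumes "finite S" "c \<notin> f ` S" "root_prod f S y \<doteq> 0" "y * w \<doteq> cst c * w"
  shows "w \<doteq> 0"
proof (rule eqv_0_cancel)
  show "(\<Prod>i\<in>S. c - f i) \<noteq> 0"
    using assms(1,2) by auto
  have "root_prod f S y * w \<doteq> 0 * w"
    by (rule eqv_right) fact
  then show "cst (\<Prod>i\<in>S. c - f i) * w \<doteq> 0"
    using root_prod_eigenvector[OF assms(4), of f S] eqv_sym eqv_trans by (metis mult_zero_left)
qed

lemma root_prod_pair:
  assumes "i \<noteq> j"
  shows "root_prod f {i, j} y = (y - cst (f i)) * (y - cst (f j))"
proof -
  have p: "(\<Prod>k\<in>{i, j}. [:- f k, 1:]) = [:f i * f j, - f i - f j, 1:]"
    using assms by simp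
  show ?thesis
    unfolding root_prod_def p
    by (simp add: Let_def atMost_Suc cst_simps algebra_simps eval_nat_numeral cst_commute[of y "f j"])
qed

end

subsection \<open>The quotient satisfies the Temperley--Lieb relations\<close>

locale aw_quotient = generic_q q + mon_ideal I
  for q :: complex and I :: "aw_gen free_alg set" +
  assumes rels: "aw3_rels q \<union> awbar_rels q (1/2) (1/2) (1/2) \<subseteq> I"
begin

lemma alpha: "al1 \<doteq> cst (x^2 - 2)" "al2 \<doteq> cst (x^2 - 2)" "al3 \<doteq> cst (x^2 - 2)"
  using rels by (auto simp: awbar_rels_def eqv_def chi_values)

lemma central: "awK * gen g \<doteq> gen g * awK"
  using rels by (auto simp: aw3_rels_def eqv_def)

lemma quadratic:
  "(awA - cst x) * (awA - cst (x^3 - 3 * x)) \<doteq> 0" "(awB - cst x) * (awB - cst (x^3 - 3 * x)) \<doteq> 0"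
  "(awK - cst (x^2 - 2)) * (awK - cst (x^4 - 4 * x^2 + 2)) \<doteq> 0"
proof -
  have "root_prod (chi q) (J2 (1/2) (1/2)) awA \<doteq> 0" "root_prod (chi q) (J2 (1/2) (1/2)) awB \<doteq> 0"
    "root_prod (chi q) (J3 (1/2) (1/2) (1/2)) awK \<doteq> 0"
    using rels by (auto simp: awbar_rels_def eqv_0_iff)
  then show "(awA - cst x) * (awA - cst (x^3 - 3 * x)) \<doteq> 0" "(awB - cst x) * (awB - cst (x^3 - 3 * x)) \<doteq> 0"
    "(awK - cst (x^2 - 2)) * (awK - cst (x^4 - 4 * x^2 + 2)) \<doteq> 0"
    by (simp_all add: J2_values J3_value root_prod_pair chi_values)
qed

text \<open>The common right-hand side of the three Askey--Wilson relations once every \<alpha>_i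
  equals \<chi>_{1/2}.\<close>

definition u :: "aw_gen free_alg" where "u = cst ((x^2 - 2) / x) * (cst (x^2 - 2) + awK)"

definition \<tau> :: complex where "\<tau> = 1 / (q^2 - inverse q ^ 2)"

lemma aw_relations:
  "awA + cst \<tau> * qcomm q awB awD \<doteq> u" "awB + cst \<tau> * qcomm q awD awA \<doteq> u"
  "awD + cst \<tau> * qcomm q awA awB \<doteq> u"
proof -
  have rhs: "cst (1 / (q + inverse q)) * (y * z + w * awK) \<doteq> u"
    if "y \<doteq> cst (x^2 - 2)" "z \<doteq> cst (x^2 - 2)" "w \<doteq> cst (x^2 - 2)" for y z w
  proof -
    have "cst (1 / (q + inverse q)) * (y * z + w * awK)
        \<doteq> cst (1 / (q + inverse q)) * (cst (x^2 - 2) * cst (x^2 - 2) + cst (x^2 - 2) * awK)"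
      by (intro eqv_left eqv_add eqv_mult that eqv_refl)
    also have "\<dots> = u"
      by (simp add: u_def x_def[symmetric] distrib_left mult.assoc[symmetric] flip: cst_simps(6))
    finally show ?thesis .
  qed
  have "awA + cst \<tau> * qcomm q awB awD \<doteq> cst (1 / (q + inverse q)) * (al1 * al2 + al3 * awK)"
    "awB + cst \<tau> * qcomm q awD awA \<doteq> cst (1 / (q + inverse q)) * (al2 * al3 + al1 * awK)"
    "awD + cst \<tau> * qcomm q awA awB \<doteq> cst (1 / (q + inverse q)) * (al1 * al3 + al2 * awK)"
    using rels unfolding \<tau>_def aw3_rels_def eqv_def by blast+
  then show "awA + cst \<tau> * qcomm q awB awD \<doteq> u" "awB + cst \<tau> * qcomm q awD awA \<doteq> u"
    "awD + cst \<tau> * qcomm q awA awB \<doteq> u"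
    using rhs alpha eqv_trans by blast+
qed

lemma \<tau>_mult: "\<tau> * (q - inverse q) = 1 / x"
proof -
  have "x * (q - inverse q) = q^2 - inverse q ^ 2"
    by (simp add: x_def algebra_simps power2_eq_square)
  then show ?thesis
    using q_poly(1,6) unfolding \<tau>_def by (simp add: field_simps)
qed

text \<open>Normalised so that X = \<chi>_1 corresponds to 0 and X = \<chi>_0 to \<open>x\<close>;
  the quadratic relation for X then reads e^2 = x e.\<close>

definition tl_gen :: "aw_gen free_alg \<Rightarrow> aw_gen free_alg" where
  "tl_gen X = cst (1 / (x^2 - 4)) * (cst (x^3 - 3 * x) - X)"

lemma eq_tl_gen: "X = cst (x^3 - 3 * x) - cst (x^2 - 4) * tl_gen X"
proof -
  have "cst (x^2 - 4) * tl_gen X = cst ((x^2 - 4) * (1 / (x^2 - 4))) * (cst (x^3 - 3 * x) - X)"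
    by (simp only: tl_gen_def cst_simps(6) mult.assoc)
  also have "(x^2 - 4) * (1 / (x^2 - 4)) = 1"
    using q_poly(2) by simp
  finally show ?thesis
    by (simp add: cst_simps)
qed

lemma tl_gen_square:
  assumes "(X - cst x) * (X - cst (x^3 - 3 * x)) \<doteq> 0"
  shows "tl_gen X * tl_gen X \<doteq> cst x * tl_gen X"
proof -
  define c h where "c = x^3 - 3 * x" and "h = x^2 - 4"
  let ?e = "tl_gen X"
  have X: "X = cst c - cst h * ?e"
    unfolding c_def h_def by (rule eq_tl_gen)
  have 1: "X - cst x = cst h * (cst x - ?e)"
  proof -
    have "X - cst x = cst (c - x) - cst h * ?e"
      by (subst X) (simp add: cst_simps(4))
    also have "c - x = h * x"
      by (simp add: c_def h_def algebra_simps eval_nat_numeral)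
    finally show ?thesis
      by (simp only: cst_simps(6) right_diff_distrib)
  qed
  have 2: "X - cst c = cst (- h) * ?e"
    by (subst X) (simp add: cst_simps(5))
  have "cst (h * - h) * ((cst x - ?e) * ?e) = cst h * (cst x - ?e) * (cst (- h) * ?e)"
    by (simp only: cst_simps(6) mult.assoc cst_left_commute[of "cst x - ?e"])
  also have "\<dots> = (X - cst x) * (X - cst c)"
    by (simp only: 1[symmetric] 2[symmetric])
  finally have "cst (h * - h) * ((cst x - ?e) * ?e) \<doteq> 0"
    using assms by (simp add: c_def)
  then have "(cst x - ?e) * ?e \<doteq> 0"
    by (rule eqv_0_cancel[rotated]) (use q_poly(2) in \<open>simp add: h_def\<close>)
  then show ?thesis
    by (intro eqv_sym[of "cst x * ?e"]) (simp add: eqv_def algebra_simps)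
qed

lemma tl_gen_eigenvector:
  assumes "tl_gen X * w \<doteq> cst c * w"
  shows "X * w \<doteq> cst (x^3 - 3 * x - (x^2 - 4) * c) * w"
proof -
  have "X * w = cst (x^3 - 3 * x) * w - cst (x^2 - 4) * (tl_gen X * w)"
    by (subst eq_tl_gen) (simp add: left_diff_distrib mult.assoc)
  also have "\<dots> \<doteq> cst (x^3 - 3 * x) * w - cst (x^2 - 4) * (cst c * w)"
    by (intro eqv_diff eqv_left eqv_refl assms)
  also have "\<dots> = cst (x^3 - 3 * x - (x^2 - 4) * c) * w"
    by (simp add: cst_simps(4,6) left_diff_distrib mult.assoc)
  finally show ?thesis .
qed

text \<open>On the image of \<^term>\<open>tl_gen X\<close> one has \<open>X = \<chi>\<^sub>0\<close>, and the relation on \<open>K - X\<close> does not admit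
  the difference \<open>\<chi>\<^sub>3\<^sub>/\<^sub>2 - \<chi>\<^sub>0\<close>.\<close>

lemma K_tl_gen:
  assumes X: "(X - cst x) * (X - cst (x^3 - 3 * x)) \<doteq> 0" "awK * X \<doteq> X * awK"
    and KX: "root_prod (\<lambda>m. m) (Mset q (1/2) (1/2) (1/2)) (awK - X) \<doteq> 0"
  shows "awK * tl_gen X \<doteq> cst (x^2 - 2) * tl_gen X"
proof -
  let ?e = "tl_gen X" and ?K2 = "awK - cst (x^2 - 2)"
  \<comment> \<open>By the quadratic relation for K, this is the part of the image of
    \<open>?e\<close> on which K acts by \<chi>_{3/2}; the claim is that it vanishes.\<close>
  define w where "w = ?K2 * ?e"
  have Kw: "awK * w \<doteq> cst (x^4 - 4 * x^2 + 2) * w"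
  proof -
    have comm: "?K2 * (awK - cst c) = (awK - cst c) * ?K2" for c
      by (simp add: left_diff_distrib right_diff_distrib cst_commute[of awK] cst_commute[of "cst c"])
    have "?K2 * (awK - cst (x^4 - 4 * x^2 + 2)) * ?e \<doteq> 0 * ?e"
      by (intro eqv_right quadratic)
    then have "(awK - cst (x^4 - 4 * x^2 + 2)) * w \<doteq> 0"
      by (simp only: comm w_def mult.assoc mult_zero_left)
    then show ?thesis
      by (simp add: eqv_def left_diff_distrib)
  qed
  have Xe: "X * ?e \<doteq> cst x * ?e"
  proof -
    have eq: "x^3 - 3 * x - (x^2 - 4) * x = x"
      by (simp add: algebra_simps eval_nat_numeral)
    show ?thesis
      using tl_gen_eigenvector[OF tl_gen_square[OF X(1)]] unfolding eq .
  qed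
  have Xw: "X * w \<doteq> cst x * w"
  proof -
    have "X * ?K2 \<doteq> ?K2 * X"
      using eqv_sym[OF X(2)]
      by (simp add: left_diff_distrib right_diff_distrib cst_commute[of X] eqv_diff)
    then have "X * ?K2 * ?e \<doteq> ?K2 * X * ?e"
      by (rule eqv_right)
    also have "\<dots> = ?K2 * (X * ?e)"
      by (rule mult.assoc)
    also have "\<dots> \<doteq> ?K2 * (cst x * ?e)"
      by (rule eqv_left[OF Xe])
    finally show ?thesis
      by (simp only: w_def mult.assoc cst_left_commute)
  qed
  have "w \<doteq> 0"
  proof (rule no_eigenvector[OF _ _ KX])
    show "(awK - X) * w \<doteq> cst (x^4 - 4 * x^2 + 2 - x) * w"
      using eqv_diff[OF Kw Xw] by (simp add: cst_simps(4) left_diff_distrib)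
    \<comment> \<open>Each coincidence of \<chi>_{3/2} - \<chi>_0 with an allowed difference factors
      into polynomials of \<open>q_poly\<close>. Equality with \<chi>_{1/2} - \<chi>_1 is the case
      that needs x^2 + x - 1, that is, q^5 different from 1.\<close>
    have ne: "a \<noteq> b" if "a - b = c" "c \<noteq> 0" for a b c :: complex
      using that by auto
    have "x^4 - 4 * x^2 + 2 - x \<noteq> x^2 - 2 - x"
      by (rule ne[where c = "(x^2 - 4) * (x^2 - 1)"], simp add: algebra_simps eval_nat_numeral, simp only: mult_eq_0_iff q_poly simp_thms)
    moreover have "x^4 - 4 * x^2 + 2 - x \<noteq> x^2 - 2 - (x^3 - 3 * x)"
      by (rule ne[where c = "(x^2 - 4) * (x^2 + x - 1)"], simp add: algebra_simps eval_nat_numeral, simp only: mult_eq_0_iff q_poly simp_thms)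
    moreover have "x^4 - 4 * x^2 + 2 - x \<noteq> x^4 - 4 * x^2 + 2 - (x^3 - 3 * x)"
      by (rule ne[where c = "x * (x^2 - 4)"], simp add: algebra_simps eval_nat_numeral, simp only: mult_eq_0_iff q_poly simp_thms)
    ultimately show "x^4 - 4 * x^2 + 2 - x \<notin> (\<lambda>m. m) ` Mset q (1/2) (1/2) (1/2)"
      by (simp only: Mset_value image_ident insert_iff empty_iff simp_thms)
  qed (simp add: Mset_value)
  then show ?thesis
    by (simp add: w_def eqv_def left_diff_distrib)
qed

text \<open>Since X is the scalar b on both sides of f, both products compress to b f Y f and only
  the factor q - q^{-1} survives, whichever order the q-commutator has.\<close>

lemma sandwich:
  assumes "f * X \<doteq> cst b * f" "X * f \<doteq> cst b * f"
  shows "f * qcomm q X Y * f \<doteq> cst ((q - inverse q) * b) * (f * Y * f)"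
    and "f * qcomm q Y X * f \<doteq> cst ((q - inverse q) * b) * (f * Y * f)"
proof -
  have XY: "f * X * Y * f \<doteq> cst b * (f * Y * f)"
    using eqv_right[OF eqv_right[OF assms(1)], of Y f] by (simp add: mult.assoc)
  have YX: "f * Y * X * f \<doteq> cst b * (f * Y * f)"
    using eqv_left[OF assms(2), of "f * Y"] by (simp add: mult.assoc cst_left_commute[of f] cst_left_commute[of Y])
  have 1: "f * qcomm q V W * f = cst q * (f * V * W * f) - cst (inverse q) * (f * W * V * f)" for V W
    by (simp add: qcomm_def left_diff_distrib right_diff_distrib mult.assoc cst_left_commute[of f])
  have 2: "cst q * (cst b * z) - cst (inverse q) * (cst b * z) = cst ((q - inverse q) * b) * z" for z :: "aw_gen free_alg"
    by (simp only: cst_simps(4,6) left_diff_distrib mult.assoc)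
  show "f * qcomm q X Y * f \<doteq> cst ((q - inverse q) * b) * (f * Y * f)"
    using eqv_diff[OF eqv_left[OF XY, of "cst q"] eqv_left[OF YX, of "cst (inverse q)"]]
    by (simp only: 1 2)
  show "f * qcomm q Y X * f \<doteq> cst ((q - inverse q) * b) * (f * Y * f)"
    using eqv_diff[OF eqv_left[OF YX, of "cst q"] eqv_left[OF XY, of "cst (inverse q)"]]
    by (simp only: 1 2)
qed

text \<open>The analogue of \<open>tl_gen\<close> for K: K = \<chi>_{3/2} corresponds to 0 and K =
  \<chi>_{1/2} to x^2 - 1. It is the candidate for x (e_1 + e_2) - e_1 e_2 - e_2 e_1.\<close>

definition Y :: "aw_gen free_alg" where "Y = cst (1 / (x^2 - 4)) * (cst (x^4 - 4 * x^2 + 2) - awK)"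

lemma eq_Y: "awK = cst (x^4 - 4 * x^2 + 2) - cst (x^2 - 4) * Y"
proof -
  have "cst (x^2 - 4) * Y = cst ((x^2 - 4) * (1 / (x^2 - 4))) * (cst (x^4 - 4 * x^2 + 2) - awK)"
    by (simp only: Y_def cst_simps(6) mult.assoc)
  also have "(x^2 - 4) * (1 / (x^2 - 4)) = 1"
    using q_poly(2) by simp
  finally show ?thesis
    by (simp add: cst_simps)
qed

lemma Y_eigenvector:
  assumes "awK * w \<doteq> cst (x^2 - 2) * w"
  shows "Y * w \<doteq> cst (x^2 - 1) * w"
proof -
  have "Y * w = cst (1 / (x^2 - 4)) * (cst (x^4 - 4 * x^2 + 2) * w - awK * w)"
    by (simp only: Y_def mult.assoc left_diff_distrib)
  also have "\<dots> \<doteq> cst (1 / (x^2 - 4)) * (cst (x^4 - 4 * x^2 + 2) * w - cst (x^2 - 2) * w)"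
    by (intro eqv_left eqv_diff eqv_refl assms)
  also have "\<dots> = cst (1 / (x^2 - 4) * (x^4 - 4 * x^2 + 2 - (x^2 - 2))) * w"
    by (simp only: cst_simps(4,6) mult.assoc left_diff_distrib)
  also have "1 / (x^2 - 4) * (x^4 - 4 * x^2 + 2 - (x^2 - 2)) = x^2 - 1"
    using q_poly(2) by (simp add: divide_simps) (simp add: algebra_simps eval_nat_numeral)
  finally show ?thesis .
qed

text \<open>With \<open>f = x - tl_gen V\<close>, the element \<open>V\<close> acts on \<open>f\<close> by the scalar \<open>\<chi>\<^sub>1\<close>. Multiplying two
  Askey--Wilson relations by \<open>f\<close> on both sides therefore leaves two linear equations for \<open>f W f\<close>
  and \<open>f D f\<close>.\<close>

lemma corner:
  assumes V: "(V - cst x) * (V - cst (x^3 - 3 * x)) \<doteq> 0" "awK * V \<doteq> V * awK"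
    and R: "W + cst \<tau> * R1 \<doteq> u" "awD + cst \<tau> * R2 \<doteq> u"
    and comm: "\<And>f b. f * V \<doteq> cst b * f \<Longrightarrow> V * f \<doteq> cst b * f \<Longrightarrow>
        f * R1 * f \<doteq> cst ((q - inverse q) * b) * (f * awD * f)"
      "\<And>f b. f * V \<doteq> cst b * f \<Longrightarrow> V * f \<doteq> cst b * f \<Longrightarrow>
        f * R2 * f \<doteq> cst ((q - inverse q) * b) * (f * W * f)"
  shows "(cst x - tl_gen V) * tl_gen W * (cst x - tl_gen V) \<doteq> Y * (cst x - tl_gen V)"
proof -
  define c h k where "c = x^3 - 3 * x" and "h = x^2 - 4" and "k = x^2 - 2"
  define e f where "e = tl_gen V" and "f = cst x - e"
  have h0: "h \<noteq> 0" and k0: "k \<noteq> 0"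
    using q_poly by (simp_all add: h_def k_def)
  have ee: "e * e \<doteq> cst x * e"
    unfolding e_def by (rule tl_gen_square[OF V(1)])
  have ef: "e * f \<doteq> 0" and fe: "f * e \<doteq> 0"
    using ee eqv_sym[OF ee] by (simp_all add: f_def eqv_def algebra_simps cst_commute[of e])
  have ff: "f * f \<doteq> cst x * f"
    using eqv_sym[OF ef] by (simp add: f_def eqv_def left_diff_distrib)
  have Vf: "V * f \<doteq> cst c * f"
    using tl_gen_eigenvector[of V f 0] ef by (simp add: c_def e_def cst_simps)
  have fV: "f * V \<doteq> cst c * f"
  proof -
    have "f * V = cst c * f - cst h * (f * e)"
      by (subst eq_tl_gen[of V])
        (simp only: c_def h_def e_def right_diff_distrib cst_commute[of f] cst_left_commute[of f])
    also have "\<dots> \<doteq> cst c * f - cst h * 0"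
      by (intro eqv_diff eqv_left fe eqv_refl)
    finally show ?thesis
      by simp
  qed
  have Kf: "awK * f \<doteq> f * awK"
  proof -
    have "awK * e \<doteq> e * awK"
    proof -
      have "awK * e = cst (1 / (x^2 - 4)) * (cst (x^3 - 3 * x) * awK - awK * V)"
        by (simp add: e_def tl_gen_def cst_left_commute[of awK] right_diff_distrib cst_commute[of awK])
      also have "\<dots> \<doteq> cst (1 / (x^2 - 4)) * (cst (x^3 - 3 * x) * awK - V * awK)"
        by (intro eqv_left eqv_diff V(2) eqv_refl)
      also have "\<dots> = e * awK"
        by (simp add: e_def tl_gen_def left_diff_distrib mult.assoc)
      finally show ?thesis .
    qed
    then show ?thesis
      by (simp add: f_def left_diff_distrib right_diff_distrib cst_commute[of awK] eqv_diff)
  qed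
  define a d w where "a = f * W * f" and "d = f * awD * f" and "w = f * u * f"
  have \<tau>c: "cst \<tau> * (cst ((q - inverse q) * c) * z) = cst (c / x) * z" for z :: "aw_gen free_alg"
  proof -
    have "cst \<tau> * (cst ((q - inverse q) * c) * z) = cst (\<tau> * (q - inverse q) * c) * z"
      by (simp only: cst_simps(6) mult.assoc)
    then show ?thesis
      by (simp add: \<tau>_mult)
  qed
  have lin: "f * Z * f + cst (c / x) * z \<doteq> w" if "Z + cst \<tau> * R \<doteq> u" "f * R * f \<doteq> cst ((q - inverse q) * c) * z" for Z R z
  proof -
    have "f * Z * f + cst \<tau> * (f * R * f) = f * (Z + cst \<tau> * R) * f"
      by (simp add: distrib_left distrib_right mult.assoc cst_left_commute[of f])
    also have "\<dots> \<doteq> w"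
      unfolding w_def by (intro eqv_left eqv_right that)
    finally have "f * Z * f + cst \<tau> * (f * R * f) \<doteq> w" .
    moreover have "cst \<tau> * (f * R * f) \<doteq> cst (c / x) * z"
      using eqv_left[OF that(2), of "cst \<tau>"] by (simp only: \<tau>c)
    ultimately show ?thesis
      using eqv_trans[OF eqv_add[OF eqv_refl eqv_sym]] by blast
  qed
  have 1: "a + cst (c / x) * d \<doteq> w"
    unfolding a_def d_def by (rule lin[OF R(1) comm(1)[OF fV Vf]])
  have 2: "d + cst (c / x) * a \<doteq> w"
    unfolding a_def d_def by (rule lin[OF R(2) comm(2)[OF fV Vf]])
  \<comment> \<open>Eliminating f D f leaves the coefficient 1 - (c/x)^2 for f W f and 1 - c/x for f
    u f. The common factor 1 - c/x = -h cancels, and 1 + c/x = k = \<chi>_{1/2} remains.\<close>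
  have cx: "c / x = k - 1" "1 - c / x = - h"
    using q_poly(1) by (simp_all add: c_def k_def h_def field_simps eval_nat_numeral)
  have "cst (- h) * (cst k * a) = (a + cst (c / x) * d) - cst (c / x) * (d + cst (c / x) * a)"
  proof -
    have "- h * k = 1 - (c / x) * (c / x)"
    proof -
      have "k = 1 + c / x"
        using cx(1) by simp
      then show ?thesis
        unfolding cx(2)[symmetric] by (simp only: left_diff_distrib distrib_left) simp
    qed
    then have "cst (- h) * (cst k * a) = cst (1 - (c / x) * (c / x)) * a"
      by (simp only: cst_simps(6)[symmetric] mult.assoc[symmetric])
    then show ?thesis
      by (simp only: cst_simps(2,4,6)) (simp add: algebra_simps)
  qed
  also have "\<dots> \<doteq> w - cst (c / x) * w"
    by (intro eqv_diff eqv_left 1 2)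
  also have "\<dots> = cst (- h) * w"
    by (simp only: cx(2)[symmetric] cst_simps(2,4) left_diff_distrib mult_1_left)
  finally have ka: "cst k * a \<doteq> w"
    by (rule eqv_cancel[rotated]) (simp add: h0)
  have "w \<doteq> cst k * ((cst k + awK) * f)"
  proof -
    have "f * (cst k + awK) \<doteq> (cst k + awK) * f"
      using eqv_sym[OF Kf] by (simp add: distrib_left distrib_right cst_commute[of f] eqv_add)
    then have "cst (k / x) * (f * (cst k + awK) * f) \<doteq> cst (k / x) * ((cst k + awK) * f * f)"
      by (intro eqv_left eqv_right)
    also have "cst (k / x) * (f * (cst k + awK) * f) = w"
      by (simp add: w_def u_def k_def mult.assoc cst_left_commute[of f])
    also have "cst (k / x) * ((cst k + awK) * f * f) = cst (k / x) * ((cst k + awK) * (f * f))"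
      by (simp only: mult.assoc)
    also have "\<dots> \<doteq> cst (k / x) * ((cst k + awK) * (cst x * f))"
      by (intro eqv_left ff)
    also have "\<dots> = cst (k / x * x) * ((cst k + awK) * f)"
      by (simp only: cst_simps(6) mult.assoc cst_left_commute[of "cst k + awK"])
    also have "k / x * x = k"
      using q_poly(1) by simp
    finally show ?thesis .
  qed
  with ka have "cst k * a \<doteq> cst k * ((cst k + awK) * f)"
    by (rule eqv_trans)
  then have a: "a \<doteq> (cst k + awK) * f"
    by (rule eqv_cancel[OF k0])
  have "cst h * (f * tl_gen W * f) = cst c * (f * f) - a"
    unfolding a_def
    by (subst (2) eq_tl_gen[of W])
      (simp add: c_def h_def left_diff_distrib right_diff_distrib mult.assoc cst_left_commute[of f])
  also have "\<dots> \<doteq> cst c * (cst x * f) - (cst k + awK) * f"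
    by (intro eqv_diff eqv_left ff a)
  also have "\<dots> = cst (c * x - k) * f - awK * f"
    by (simp add: cst_simps(4,6) left_diff_distrib distrib_right mult.assoc)
  \<comment> \<open>The identity x \<chi>_1 = \<chi>_{3/2} + \<chi>_{1/2}, which makes the corner
    equal to a multiple of \<open>Y\<close>.\<close>
  also have "c * x - k = x^4 - 4 * x^2 + 2"
    by (simp add: c_def k_def algebra_simps eval_nat_numeral)
  also have "cst (x^4 - 4 * x^2 + 2) * f - awK * f = cst h * (Y * f)"
    by (subst eq_Y) (simp only: h_def left_diff_distrib mult.assoc diff_diff_eq2 add_diff_cancel_left')
  finally show ?thesis
    unfolding f_def e_def by (rule eqv_cancel[OF h0])
qed

text \<open>The corner relation expands to x T = e - e e' e once \<open>Y\<close> is replaced by x^2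
  - 1 on e. The right-hand side is left divisible by e, so T is an eigenvector of e with eigenvalue
  x.\<close>

lemma defect:
  assumes ee: "e * e \<doteq> cst x * e"
    and corner: "(cst x - e) * e' * (cst x - e) \<doteq> Y * (cst x - e)" and Ye: "Y * e \<doteq> cst (x^2 - 1) * e"
    and T: "T = cst x * (e + e') - e' * e - e * e' - Y"
  shows "cst x * T \<doteq> e - e * e' * e" and "e * T \<doteq> cst x * T"
proof -
  \<comment> \<open>An exact identity in the free algebra: the difference is the error of the corner
    relation plus the error of the eigenvalue of \<open>Y\<close>.\<close>
  have "cst x * T - (e - e * e' * e) =
      ((cst x - e) * e' * (cst x - e) - Y * (cst x - e)) + (cst (x^2 - 1) * e - Y * e)"
    by (simp add: T power2_eq_square cst_simps algebra_simps cst_commute[of e] cst_commute[of e']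
        cst_commute[of Y] cst_left_commute[of e])
  then show xT: "cst x * T \<doteq> e - e * e' * e"
    using add[OF corner[unfolded eqv_def] eqv_sym[OF Ye, unfolded eqv_def]] by (simp add: eqv_def)
  have "cst x * (e * T) = e * (cst x * T)"
    by (rule cst_left_commute[symmetric])
  also have "\<dots> \<doteq> e * (e - e * e' * e)"
    by (rule eqv_left[OF xT])
  also have "\<dots> = e * e - e * e * (e' * e)"
    by (simp add: right_diff_distrib mult.assoc)
  also have "\<dots> \<doteq> cst x * e - cst x * e * (e' * e)"
    by (intro eqv_diff eqv_right ee)
  also have "\<dots> = cst x * (e - e * e' * e)"
    by (simp add: right_diff_distrib mult.assoc)
  also have "\<dots> \<doteq> cst x * (cst x * T)"
    by (rule eqv_left[OF eqv_sym[OF xT]])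
  finally show "e * T \<doteq> cst x * T"
    by (rule eqv_cancel[OF q_poly(1)])
qed

abbreviation "e1 \<equiv> tl_gen awA"
abbreviation "e2 \<equiv> tl_gen awB"

lemma tl_squares: "e1 * e1 \<doteq> cst x * e1" "e2 * e2 \<doteq> cst x * e2"
  by (intro tl_gen_square quadratic)+

lemma K_tl: "awK * e1 \<doteq> cst (x^2 - 2) * e1" "awK * e2 \<doteq> cst (x^2 - 2) * e2"
proof -
  have KX: "root_prod (\<lambda>m. m) (Mset q (1/2) (1/2) (1/2)) (awK - awA) \<doteq> 0"
    "root_prod (\<lambda>m. m) (Mset q (1/2) (1/2) (1/2)) (awK - awB) \<doteq> 0"
    using rels by (auto simp: awbar_rels_def eqv_0_iff)
  show "awK * e1 \<doteq> cst (x^2 - 2) * e1"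
    by (rule K_tl_gen[OF quadratic(1) central KX(1)])
  show "awK * e2 \<doteq> cst (x^2 - 2) * e2"
    by (rule K_tl_gen[OF quadratic(2) central KX(2)])
qed

text \<open>Symmetric in \<open>e1\<close> and \<open>e2\<close>, so both instances of
  \<open>defect\<close> concern the same element, which is therefore a common eigenvector of A and
  B.\<close>

definition T :: "aw_gen free_alg" where "T = cst x * (e1 + e2) - e1 * e2 - e2 * e1 - Y"

lemma corners:
  "(cst x - e2) * e1 * (cst x - e2) \<doteq> Y * (cst x - e2)" "(cst x - e1) * e2 * (cst x - e1) \<doteq> Y * (cst x - e1)"
  by (rule corner[OF quadratic(2) central aw_relations(1) aw_relations(3) sandwich(1) sandwich(2)]; assumption)
    (rule corner[OF quadratic(1) central aw_relations(2) aw_relations(3) sandwich(2) sandwich(1)]; assumption)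

lemma T_swap: "T = cst x * (e2 + e1) - e1 * e2 - e2 * e1 - Y" "T = cst x * (e1 + e2) - e2 * e1 - e1 * e2 - Y"
  by (simp_all add: T_def algebra_simps)

lemmas xT = defect(1)[OF tl_squares(2) corners(1) Y_eigenvector[OF K_tl(2)] T_swap(1)]
  defect(1)[OF tl_squares(1) corners(2) Y_eigenvector[OF K_tl(1)] T_swap(2)]

lemmas eT = defect(2)[OF tl_squares(2) corners(1) Y_eigenvector[OF K_tl(2)] T_swap(1)]
  defect(2)[OF tl_squares(1) corners(2) Y_eigenvector[OF K_tl(1)] T_swap(2)]

text \<open>On \<open>T\<close> the generators act by \<open>A = B = \<chi>\<^sub>0\<close> and \<open>K = \<chi>\<^sub>1\<^sub>/\<^sub>2\<close>. This one-dimensional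
  representation of \<open>AW(3)\<close> is excluded by the value which it assigns to \<open>D\<close>.\<close>

lemma T_zero: "T \<doteq> 0"
proof -
  have eq: "x^3 - 3 * x - (x^2 - 4) * x = x"
    by (simp add: algebra_simps eval_nat_numeral)
  have AT: "awA * T \<doteq> cst x * T" and BT: "awB * T \<doteq> cst x * T"
    using tl_gen_eigenvector[OF eT(2)] tl_gen_eigenvector[OF eT(1)] unfolding eq .
  have KT: "awK * T \<doteq> cst (x^2 - 2) * T"
  proof (rule eqv_cancel[OF q_poly(1)])
    have "cst x * (awK * T) = awK * (cst x * T)"
      by (rule cst_left_commute[symmetric])
    also have "\<dots> \<doteq> awK * (e1 * T)"
      by (rule eqv_left[OF eqv_sym[OF eT(2)]])
    also have "\<dots> = awK * e1 * T"
      by (simp only: mult.assoc)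
    also have "\<dots> \<doteq> cst (x^2 - 2) * e1 * T"
      by (rule eqv_right[OF K_tl(1)])
    also have "\<dots> = cst (x^2 - 2) * (e1 * T)"
      by (simp only: mult.assoc)
    also have "\<dots> \<doteq> cst (x^2 - 2) * (cst x * T)"
      by (rule eqv_left[OF eT(2)])
    also have "\<dots> = cst x * (cst (x^2 - 2) * T)"
      by (rule cst_left_commute)
    finally show "cst x * (awK * T) \<doteq> cst x * (cst (x^2 - 2) * T)" .
  qed
  have prod: "V * (W * T) \<doteq> cst (x * x) * T" if "V * T \<doteq> cst x * T" "W * T \<doteq> cst x * T" for V W
  proof -
    have "V * (W * T) \<doteq> V * (cst x * T)"
      by (rule eqv_left[OF that(2)])
    also have "\<dots> = cst x * (V * T)"
      by (rule cst_left_commute)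
    also have "\<dots> \<doteq> cst x * (cst x * T)"
      by (rule eqv_left[OF that(1)])
    finally show ?thesis
      by (simp only: cst_simps(6) mult.assoc)
  qed
  define k where "k = x^2 - 2"
  have uT: "u * T \<doteq> cst (2 * k * k / x) * T"
  proof -
    have "u * T = cst (k / x) * (cst k * T + awK * T)"
      by (simp add: u_def k_def distrib_right mult.assoc)
    also have "\<dots> \<doteq> cst (k / x) * (cst k * T + cst k * T)"
      unfolding k_def by (intro eqv_left eqv_add eqv_refl KT)
    also have "\<dots> = cst (k / x * (k + k)) * T"
      by (simp only: cst_simps(3,6) mult.assoc distrib_right)
    also have "k / x * (k + k) = 2 * k * k / x"
      by simp
    finally show ?thesis .
  qed
  have DT: "awD * T \<doteq> cst (2 * k * k / x - x) * T"
  proof -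
    have "qcomm q awA awB * T = cst q * (awA * (awB * T)) - cst (inverse q) * (awB * (awA * T))"
      by (simp add: qcomm_def left_diff_distrib mult.assoc)
    also have "\<dots> \<doteq> cst q * (cst (x * x) * T) - cst (inverse q) * (cst (x * x) * T)"
      by (intro eqv_diff eqv_left prod AT BT)
    also have "\<dots> = cst ((q - inverse q) * (x * x)) * T"
      by (simp only: cst_simps(4,6) left_diff_distrib mult.assoc)
    finally have "cst \<tau> * (qcomm q awA awB * T) \<doteq> cst \<tau> * (cst ((q - inverse q) * (x * x)) * T)"
      by (rule eqv_left)
    also have "\<dots> = cst (\<tau> * (q - inverse q) * (x * x)) * T"
      by (simp only: cst_simps(6) mult.assoc)
    also have "\<tau> * (q - inverse q) * (x * x) = x"
      using q_poly(1) by (simp add: \<tau>_mult)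
    finally have qc: "cst \<tau> * (qcomm q awA awB * T) \<doteq> cst x * T" .
    have "awD * T = (awD + cst \<tau> * qcomm q awA awB) * T - cst \<tau> * (qcomm q awA awB * T)"
      by (simp add: distrib_right mult.assoc)
    also have "\<dots> \<doteq> u * T - cst x * T"
      by (intro eqv_diff eqv_right aw_relations qc)
    also have "\<dots> \<doteq> cst (2 * k * k / x) * T - cst x * T"
      by (intro eqv_diff uT eqv_refl)
    finally show ?thesis
      by (simp only: cst_simps(4) left_diff_distrib)
  qed
  have rD: "root_prod (chi q) (J2 (1/2) (1/2)) awD \<doteq> 0"
    using rels by (auto simp: awbar_rels_def eqv_0_iff)
  \<comment> \<open>On \<open>T\<close>, u acts by 2 \<chi>_{1/2}^2 / x and the q-commutator term by
    x. The resulting value of D differs from \<chi>_0 by 2 (x^2 - 4)(x^2 - 1) / x and from \<chi>_1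
    by (x^2 - 4)(x^2 - 2) / x.\<close>
  have val: "2 * k * k / x - x \<notin> chi q ` J2 (1/2) (1/2)"
  proof -
    have x1: "x + 1 \<noteq> 0" "x - 1 \<noteq> 0" "x + 2 \<noteq> 0" "x - 2 \<noteq> 0"
    proof -
      have "(x + 1) * (x - 1) = x^2 - 1" "(x + 2) * (x - 2) = x^2 - 4"
        by (simp_all add: algebra_simps power2_eq_square)
      then show "x + 1 \<noteq> 0" "x - 1 \<noteq> 0" "x + 2 \<noteq> 0" "x - 2 \<noteq> 0"
        using q_poly(2,4) by (metis mult_zero_left mult_zero_right)+
    qed
    have "x * (2 * k * k / x - x - x) = 2 * ((x - 2) * (x + 1)) * ((x + 2) * (x - 1))"
      using q_poly(1) by (simp add: k_def field_simps eval_nat_numeral)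
    then have "2 * k * k / x - x - x \<noteq> 0"
      using x1 by (metis mult_eq_0_iff mult_zero_right zero_neq_numeral)
    moreover have "x * (2 * k * k / x - x - (x^3 - 3 * x)) = (x^2 - 4) * (x^2 - 2)"
      using q_poly(1) by (simp add: k_def field_simps eval_nat_numeral)
    then have "2 * k * k / x - x - (x^3 - 3 * x) \<noteq> 0"
      using q_poly(2,3) by (metis mult_eq_0_iff mult_zero_right)
    ultimately show ?thesis
      by (simp only: J2_values image_insert image_empty chi_values insert_iff empty_iff right_minus_eq simp_thms)
  qed
  show ?thesis
    by (rule no_eigenvector[OF _ val rD DT]) (simp add: J2_values)
qed

lemma tl_relations:
  "e1 * e2 * e1 \<doteq> e1" "e2 * e1 * e2 \<doteq> e2" "awK \<doteq> cst (x^4 - 4 * x^2 + 2) - cst (x^2 - 4) * (cst x * (e1 + e2) - e1 * e2 - e2 * e1)"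
proof -
  have "e - e * e' * e \<doteq> 0" if "cst x * T \<doteq> e - e * e' * e" for e e'
    using eqv_trans[OF eqv_sym[OF that] eqv_left[OF T_zero]] by simp
  from this[OF xT(1)] this[OF xT(2)] show "e1 * e2 * e1 \<doteq> e1" "e2 * e1 * e2 \<doteq> e2"
    using eqv_sym by (simp_all add: eqv_def)
  have "Y \<doteq> cst x * (e1 + e2) - e1 * e2 - e2 * e1"
    using eqv_sym[OF T_zero] by (simp add: T_def eqv_def)
  then have "cst (x^4 - 4 * x^2 + 2) - cst (x^2 - 4) * Y \<doteq>
      cst (x^4 - 4 * x^2 + 2) - cst (x^2 - 4) * (cst x * (e1 + e2) - e1 * e2 - e2 * e1)"
    by (intro eqv_diff eqv_left eqv_refl)
  then show "awK \<doteq> cst (x^4 - 4 * x^2 + 2) - cst (x^2 - 4) * (cst x * (e1 + e2) - e1 * e2 - e2 * e1)"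
    by (simp only: eq_Y[symmetric])
qed

end

subsection \<open>The Temperley--Lieb relations imply the defining relations of the quotient\<close>

lemma tl_comb_linear:
  "tl_comb S T a b c d e + tl_comb S T a' b' c' d' e' = tl_comb S T (a + a') (b + b') (c + c') (d + d') (e + e')"
  "tl_comb S T a b c d e - tl_comb S T a' b' c' d' e' = tl_comb S T (a - a') (b - b') (c - c') (d - d') (e - e')"
  "mat_scale k (tl_comb S T a b c d e) = tl_comb S T (k * a) (k * b) (k * c) (k * d) (k * e)"
  "mat 1 = tl_comb S T 1 0 0 0 0"
  by (simp_all add: tl_comb_def mat_scale_def vec_eq_iff algebra_simps)

locale tl_matrices =
  fixes S T :: "complex^'n^'n" and x :: complex
  assumes SS: "S ** S = mat_scale x S" and TT: "T ** T = mat_scale x T"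
    and STS: "S ** T ** S = S" and TST: "T ** S ** T = T"
begin

text \<open>The multiplication table in the basis of five words. With it, most relations reduce to
  five polynomial identities between coefficients.\<close>

lemma tl_comb_mult:
  "tl_comb S T a b c d e ** tl_comb S T a' b' c' d' e' =
     tl_comb S T (a * a')
       (a * b' + b * (a' + x * b' + e') + d * (b' + x * e'))
       (a * c' + c * (a' + x * c' + d') + e * (c' + x * d'))
       (a * d' + b * (c' + x * d') + d * (a' + x * c' + d'))
       (a * e' + c * (b' + x * e') + e * (a' + x * b' + e'))"
proof -
  have S: "S ** tl_comb S T a b c d e = tl_comb S T 0 (a + x * b + e) 0 (c + x * d) 0"
    and T: "T ** tl_comb S T a b c d e = tl_comb S T 0 0 (a + x * c + d) 0 (b + x * e)" for a b c d e
    by (simp_all add: tl_comb_def matrix_add_ldistrib mat_scale_simps matrix_mul_assoc SS TT STS TST mult.commute)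
  have left: "tl_comb S T a b c d e ** M = mat_scale a M + mat_scale b (S ** M) + mat_scale c (T ** M)
     + mat_scale d (S ** (T ** M)) + mat_scale e (T ** (S ** M))" for M
    by (simp add: tl_comb_def matrix_add_rdistrib mat_scale_simps matrix_mul_assoc)
  show ?thesis
    unfolding left S T tl_comb_linear(1,3) by (simp add: algebra_simps)
qed

end

context mon_ideal
begin

text \<open>Used with \<open>w\<close> a sum of eigenvectors annihilated by the polynomial: a
  resolution of a nonzero scalar into such vectors shows that the polynomial itself
  vanishes.\<close>

lemma root_prod_sum_eigenvectors:
  assumes "k \<noteq> 0" "w \<doteq> cst k" "root_prod f S y * w \<doteq> 0"
  shows "root_prod f S y \<doteq> 0"
proof (rule eqv_0_cancel[OF assms(1)])
  have "cst k * root_prod f S y = root_prod f S y * cst k"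
    by (rule cst_commute[symmetric])
  also have "\<dots> \<doteq> root_prod f S y * w"
    by (rule eqv_left[OF eqv_sym[OF assms(2)]])
  also have "\<dots> \<doteq> 0"
    by fact
  finally show "cst k * root_prod f S y \<doteq> 0" .
qed

lemma shift_eigenvector:
  assumes "r * w \<doteq> cst m * w"
  shows "(cst c - cst h * r) * w \<doteq> cst (c - h * m) * w"
proof -
  have "(cst c - cst h * r) * w = cst c * w - cst h * (r * w)"
    by (simp only: left_diff_distrib mult.assoc)
  also have "\<dots> \<doteq> cst c * w - cst h * (cst m * w)"
    by (intro eqv_diff eqv_left eqv_refl assms)
  finally show ?thesis
    by (simp only: cst_simps(4,6) left_diff_distrib mult.assoc)
qed

lemma projection_complement:
  assumes "r * r \<doteq> cst m * r"
  shows "r * (cst m - r) \<doteq> cst 0 * (cst m - r)"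
  using eqv_sym[OF assms] by (simp add: cst_simps right_diff_distrib cst_commute[of r] eqv_def)

text \<open>The resolution is m = r + (m - r), with eigenvalues c - h m and c.\<close>

lemma root_prod_two:
  assumes "finite S" "m \<noteq> 0" "r * r \<doteq> cst m * r" "c \<in> f ` S" "c - h * m \<in> f ` S"
  shows "root_prod f S (cst c - cst h * r) \<doteq> 0"
proof (rule root_prod_sum_eigenvectors[OF assms(2)])
  let ?X = "cst c - cst h * r"
  show "r + (cst m - r) \<doteq> cst m"
    by simp
  have "root_prod f S ?X * r \<doteq> 0"
    by (rule root_prod_eigenvector_0[OF assms(1,5) shift_eigenvector[OF assms(3)]])
  moreover have "root_prod f S ?X * (cst m - r) \<doteq> 0"
    using shift_eigenvector[OF projection_complement[OF assms(3)], of c h] assms(4)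
    by (intro root_prod_eigenvector_0[OF assms(1)]) auto
  ultimately have "root_prod f S ?X * r + root_prod f S ?X * (cst m - r) \<doteq> 0 + 0"
    by (rule eqv_add)
  then show "root_prod f S ?X * (r + (cst m - r)) \<doteq> 0"
    by (simp only: distrib_left add_0_left)
qed

text \<open>The pair (y, r) has the joint eigenvalues (n, m), (n, 0), (0, 0) on r, y (m - r), n - y.
  The fourth pair (0, m) is absent because y r = n r; it would produce the forbidden difference
  \<chi>_{3/2} - \<chi>_0.\<close>

lemma root_prod_three:
  assumes "finite S" "m \<noteq> 0" "n \<noteq> 0" and r: "r * r \<doteq> cst m * r" and y: "y * y \<doteq> cst n * y"
    and ry: "r * y \<doteq> cst n * r" and yr: "y * r \<doteq> cst n * r"
    and "b - h * n - (c - h * m) \<in> f ` S" "b - h * n - c \<in> f ` S" "b - c \<in> f ` S"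
  shows "root_prod f S ((cst b - cst h * y) - (cst c - cst h * r)) \<doteq> 0"
proof (rule root_prod_sum_eigenvectors[of "m * n"])
  let ?X = "(cst b - cst h * y) - (cst c - cst h * r)"
  let ?w1 = "r" and ?w2 = "y * (cst m - r)" and ?w3 = "cst n - y"
  have eig: "root_prod f S ?X * w \<doteq> 0"
    if "y * w \<doteq> cst i * w" "r * w \<doteq> cst j * w" "b - h * i - (c - h * j) \<in> f ` S" for w i j
    using eqv_diff[OF shift_eigenvector[OF that(1), of b h] shift_eigenvector[OF that(2), of c h]]
    by (intro root_prod_eigenvector_0[OF assms(1) that(3)])
      (simp only: cst_simps(4)[of "b - h * i"] left_diff_distrib[of "cst b - cst h * y"]
        left_diff_distrib[of "cst (b - h * i)"])
  have 1: "root_prod f S ?X * ?w1 \<doteq> 0"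
    using yr r assms(8) by (rule eig)
  have 2: "root_prod f S ?X * ?w2 \<doteq> 0"
  proof (rule eig[of _ n 0])
    show "y * ?w2 \<doteq> cst n * ?w2"
      using eqv_right[OF y, of "cst m - r"] by (simp only: mult.assoc)
    have "r * ?w2 \<doteq> cst n * r * (cst m - r)"
      using eqv_right[OF ry, of "cst m - r"] by (simp only: mult.assoc)
    also have "cst n * r * (cst m - r) = cst n * (r * (cst m - r))"
      by (simp only: mult.assoc)
    also have "\<dots> \<doteq> cst n * (cst 0 * (cst m - r))"
      by (rule eqv_left[OF projection_complement[OF r]])
    finally show "r * ?w2 \<doteq> cst 0 * ?w2"
      by (simp add: cst_simps)
  qed (use assms(9) in simp)
  have 3: "root_prod f S ?X * ?w3 \<doteq> 0"
  proof (rule eig[OF projection_complement[OF y], of 0])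
    have "r * ?w3 \<doteq> 0"
      using eqv_sym[OF ry] by (simp add: right_diff_distrib cst_commute[of r] eqv_def)
    then show "r * ?w3 \<doteq> cst 0 * ?w3"
      by (simp add: cst_simps)
  qed (use assms(10) in simp)
  \<comment> \<open>After expansion the terms m y cancel, and y r = n r removes the rest except m
    n.\<close>
  show "cst n * ?w1 + ?w2 + cst m * ?w3 \<doteq> cst (m * n)"
  proof -
    have "cst n * r + (y * cst m - y * r) + (cst m * cst n - cst m * y) \<doteq>
        cst n * r + (y * cst m - cst n * r) + (cst m * cst n - cst m * y)"
      by (intro eqv_add eqv_diff eqv_refl yr)
    then show ?thesis
      by (simp add: right_diff_distrib cst_simps cst_commute[of y])
  qed
  have "root_prod f S ?X * (cst n * ?w1 + ?w2 + cst m * ?w3) =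
      cst n * (root_prod f S ?X * ?w1) + root_prod f S ?X * ?w2 + cst m * (root_prod f S ?X * ?w3)"
    by (simp only: distrib_left cst_left_commute[of "root_prod f S ?X"])
  also have "\<dots> \<doteq> cst n * 0 + 0 + cst m * 0"
    by (intro eqv_add eqv_left 1 2 3)
  finally show "root_prod f S ?X * (cst n * ?w1 + ?w2 + cst m * ?w3) \<doteq> 0"
    by simp
qed (use assms in simp)

end

locale aw_images = generic_q q + tl_matrices S T "generic_q.x q" for q :: complex and S T :: "complex^'n^'n"
begin

text \<open>The values at \<open>gA\<close>, \<open>gB\<close>, \<open>gk\<close> copy the three
  Casimir images; the value at \<open>gD\<close> is the one forced by the third Askey--Wilson
  relation.\<close>

primrec gen_image :: "aw_gen \<Rightarrow> complex^'n^'n" where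
  "gen_image gA = tl_comb S T (x^3 - 3 * x) (- (x^2 - 4)) 0 0 0"
| "gen_image gB = tl_comb S T (x^3 - 3 * x) 0 (- (x^2 - 4)) 0 0"
| "gen_image gD = tl_comb S T (x^3 - 3 * x) (- (x^2 - 4)) (- (x^2 - 4)) ((x^2 - 4) * inverse q) ((x^2 - 4) * q)"
| "gen_image ga1 = tl_comb S T (x^2 - 2) 0 0 0 0"
| "gen_image ga2 = tl_comb S T (x^2 - 2) 0 0 0 0"
| "gen_image ga3 = tl_comb S T (x^2 - 2) 0 0 0 0"
| "gen_image gk = tl_comb S T (x^4 - 4 * x^2 + 2) (- (x^2 - 4) * x) (- (x^2 - 4) * x) (x^2 - 4) (x^2 - 4)"

definition \<Phi> :: "aw_gen free_alg \<Rightarrow> complex^'n^'n" where "\<Phi> = free_hom gen_image"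

lemma \<Phi>_hom: "\<Phi> \<in> mat_hom"
  unfolding \<Phi>_def by (rule free_hom_hom)

lemma \<Phi>_gen: "\<Phi> (gen g) = gen_image g"
  unfolding \<Phi>_def by (rule free_hom_gen)

lemmas \<Phi>_simps = mat_hom_simps[OF \<Phi>_hom] \<Phi>_gen gen_image.simps tl_comb_mult tl_comb_linear(1-3)
  tl_comb_linear(4)[of S T]

lemma tl_comb_zeroI:
  "a = 0 \<Longrightarrow> b = 0 \<Longrightarrow> c = 0 \<Longrightarrow> d = 0 \<Longrightarrow> e = 0 \<Longrightarrow> tl_comb S T a b c d e = 0"
  by (simp add: tl_comb_def mat_scale_simps)

lemma tl_comb_cong:
  "a = a' \<Longrightarrow> b = b' \<Longrightarrow> c = c' \<Longrightarrow> d = d' \<Longrightarrow> e = e' \<Longrightarrow> tl_comb S T a b c d e = tl_comb S T a' b' c' d' e'"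
  by simp

lemma q_cancel: "q * inverse q = 1" "inverse q * q = 1" "q * (inverse q * z) = z" "inverse q * (q * z) = z"
  using q_nz by simp_all

lemmas q_normal = x_def q_cancel algebra_simps eval_nat_numeral

lemma \<Phi>_central:
  assumes "z \<in> {ga1, ga2, ga3, gk}"
  shows "\<Phi> (gen z * gen g - gen g * gen z) = 0"
proof -
  have scalar: "tl_comb S T a 0 0 0 0 ** M = M ** tl_comb S T a 0 0 0 0" for a M
    by (simp add: tl_comb_def mat_scale_simps)
  have K: "gen_image gk ** gen_image g = gen_image g ** gen_image gk"
    by (induct g; simp only: gen_image.simps tl_comb_mult; intro tl_comb_cong; simp add: algebra_simps eval_nat_numeral)
  have "\<Phi> (gen z) ** \<Phi> (gen g) = \<Phi> (gen g) ** \<Phi> (gen z)"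
    using assms by (auto simp only: \<Phi>_gen K gen_image.simps(4-6) scalar)
  then show ?thesis
    by (simp only: mat_hom_simps[OF \<Phi>_hom] diff_self)
qed

text \<open>The image of \<chi>_{1/2} (\<chi>_{1/2} + K), which is x times the common right-hand
  side; the scalar coefficient uses \<chi>_{1/2} + \<chi>_{3/2} = x \<chi>_1.\<close>

definition U :: "complex^'n^'n" where
  "U = mat_scale (x^2 - 2) (tl_comb S T (x * (x^3 - 3 * x)) (- x * (x^2 - 4)) (- x * (x^2 - 4)) (x^2 - 4) (x^2 - 4))"

definition gen_image_D' :: "complex^'n^'n" where
  "gen_image_D' = tl_comb S T (x^3 - 3 * x) (- (x^2 - 4)) (- (x^2 - 4)) ((x^2 - 4) * q) ((x^2 - 4) * inverse q)"

lemmas zero_simps = mult_zero_left mult_zero_right add_0_left add_0_right diff_0_right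

text \<open>The Askey--Wilson relations with denominators cleared. Reversing the q-commutator of A
  and B exchanges q and q^{-1} in the value of D, which gives D'.\<close>

lemma qcomm_images:
  "\<Phi> (qcomm q awB awD) = mat_scale (q - inverse q) (U - mat_scale x (gen_image gA))"
  "\<Phi> (qcomm q awD awA) = mat_scale (q - inverse q) (U - mat_scale x (gen_image gB))"
  "\<Phi> (qcomm q awA awB) = mat_scale (q - inverse q) (U - mat_scale x (gen_image gD))"
  "\<Phi> (qcomm q awB awA) = mat_scale (q - inverse q) (U - mat_scale x gen_image_D')"
  by (simp only: qcomm_def U_def gen_image_D'_def \<Phi>_simps zero_simps, rule tl_comb_cong; simp add: q_normal)+

lemma U_images:
  "\<Phi> (al1 * al2) + \<Phi> (al3 * awK) = U" "\<Phi> (al2 * al3) + \<Phi> (al1 * awK) = U"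
  "\<Phi> (al1 * al3) + \<Phi> (al2 * awK) = U"
  by (simp only: U_def \<Phi>_simps zero_simps, rule tl_comb_cong; simp add: algebra_simps eval_nat_numeral)+

lemma \<tau>_x: "1 / (q^2 - inverse q ^ 2) * (q - inverse q) * x = 1" "1 / (q + inverse q) * x = 1"
proof -
  have "(q - inverse q) * x = q^2 - inverse q ^ 2"
    by (simp add: x_def algebra_simps power2_eq_square)
  then show "1 / (q^2 - inverse q ^ 2) * (q - inverse q) * x = 1"
    using q_poly(6) by (simp add: mult.assoc)
  show "1 / (q + inverse q) * x = 1"
    using q_poly(1) by (simp add: x_def)
qed

lemma U_scale:
  "M + mat_scale (1 / (q^2 - inverse q ^ 2)) (mat_scale (q - inverse q) (U - mat_scale x M))
     - mat_scale (1 / (q + inverse q)) U = 0"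
proof -
  let ?t = "1 / (q^2 - inverse q ^ 2) * (q - inverse q)"
  have "?t * x = 1" "1 / (q + inverse q) = ?t"
    using \<tau>_x q_poly(1) by (auto simp: field_simps)
  then show ?thesis
    by (simp only: mat_scale_diff mat_scale_simps(3,6) mult.assoc[symmetric]) simp
qed

lemma \<Phi>_aw3_rels: "y \<in> aw3_rels q \<Longrightarrow> \<Phi> y = 0"
  unfolding aw3_rels_def
  by (elim UnE; (elim CollectE exE conjE; simp only: \<Phi>_central)?)
    (auto simp only: insert_iff empty_iff mat_hom_simps(1,4,7)[OF \<Phi>_hom] qcomm_images U_images
      \<Phi>_gen U_scale)

lemma \<Phi>_awD': "\<Phi> (awD' q) = gen_image_D'"
proof -
  have "\<Phi> (awD' q) = mat_scale (1 / (q + inverse q)) U -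
      mat_scale (1 / (q^2 - inverse q ^ 2)) (mat_scale (q - inverse q) (U - mat_scale x gen_image_D'))"
    by (simp only: awD'_def mat_hom_simps(1,4,7)[OF \<Phi>_hom] qcomm_images U_images)
  then show ?thesis
    using U_scale[of gen_image_D'] by (metis add_diff_cancel_right' right_minus_eq)
qed

lemma \<Phi>_Omega:
  "\<Phi> (aw_Omega q - (cst (chi q (1/2) ^ 2 + chi q (1/2) ^ 2 + chi q (1/2) ^ 2) + awK^2
       + cst (chi q (1/2) * chi q (1/2) * chi q (1/2)) * awK - cst ((q + inverse q)^2))) = 0"
  unfolding aw_Omega_def chi_values x_def[symmetric] power2_eq_square[of awA] power2_eq_square[of awB]
    power2_eq_square[of awD] power2_eq_square[of awK]
  apply (simp only: mat_hom_simps(1,7)[OF \<Phi>_hom])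
  apply (simp only: \<Phi>_simps zero_simps)
  apply (rule tl_comb_zeroI; simp add: q_normal)
  done

text \<open>One argument for A, B, D and D': each is \<chi>_1 - (x^2 - 4) R with R^2 = x R and R
  without unit component. On the ideal of such elements the normalised K acts by x^2 - 1 from both
  sides, as \<open>root_prod_three\<close> requires.\<close>

lemma root_prods_vanish:
  assumes X: "\<Phi> X = mat_scale (x^3 - 3 * x) (mat 1) - mat_scale (x^2 - 4) R"
    and R: "R = tl_comb S T 0 b c d e" "R ** R = mat_scale x R"
  shows "\<Phi> (root_prod (chi q) (J2 (1/2) (1/2)) X) = 0"
    and "\<Phi> (root_prod (\<lambda>m. m) (Mset q (1/2) (1/2) (1/2)) (awK - X)) = 0"
    and "\<Phi> (root_prod (chi q) (J3 (1/2) (1/2) (1/2)) awK) = 0"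
proof -
  \<comment> \<open>Modulo the kernel, congruence means equality of images, so the eigenvector
    lemmas apply to matrices.\<close>
  interpret J: mon_ideal "{y. \<Phi> y = 0}"
    by (rule mon_ideal_kernel[OF \<Phi>_hom])
  have eqv: "J.eqv y z \<longleftrightarrow> \<Phi> y = \<Phi> z" for y z
    by (simp add: J.eqv_def mat_hom_simps[OF \<Phi>_hom])
  define h where "h = x^2 - 4"
  have h: "h \<noteq> 0"
    using q_poly(2) by (simp add: h_def)
  have split: "z = cst k - cst h * (cst (1 / h) * (cst k - z))" for k and z :: "aw_gen free_alg"
  proof -
    have "cst h * (cst (1 / h) * (cst k - z)) = cst (h * (1 / h)) * (cst k - z)"
      by (simp only: cst_simps(6) mult.assoc)
    then show ?thesis
      using h by (simp add: cst_simps)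
  qed
  define r where "r = cst (1 / h) * (cst (x^3 - 3 * x) - X)"
  define y where "y = cst (1 / h) * (cst (x^4 - 4 * x^2 + 2) - awK)"
  have X_eq: "X = cst (x^3 - 3 * x) - cst h * r" and K_eq: "awK = cst (x^4 - 4 * x^2 + 2) - cst h * y"
    unfolding r_def y_def by (rule split)+
  have \<Phi>_r: "\<Phi> r = R"
    using h by (simp add: r_def mat_hom_simps(4,7,8)[OF \<Phi>_hom] X mat_scale_simps h_def[symmetric])
  have \<Phi>_y: "\<Phi> y = tl_comb S T 0 x x (- 1) (- 1)"
    unfolding y_def mat_hom_simps(4,7,8)[OF \<Phi>_hom] \<Phi>_gen gen_image.simps tl_comb_linear(4)[of S T] tl_comb_linear(1-3)
    unfolding h_def[symmetric] by (rule tl_comb_cong) (use h in \<open>simp_all add: field_simps\<close>)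
  have n: "x^2 - 1 \<noteq> 0"
    by (rule q_poly)
  have rr: "J.eqv (r * r) (cst x * r)"
    by (simp only: eqv mat_hom_simps(2,8)[OF \<Phi>_hom] mat_scale_simps(7) matrix_mul_lid \<Phi>_r R(2))
  have ry: "J.eqv (r * y) (cst (x^2 - 1) * r)" and yr: "J.eqv (y * r) (cst (x^2 - 1) * r)"
    and yy: "J.eqv (y * y) (cst (x^2 - 1) * y)"
    unfolding eqv mat_hom_simps(2,8)[OF \<Phi>_hom] mat_scale_simps(7) matrix_mul_lid \<Phi>_r \<Phi>_y R(1) tl_comb_mult tl_comb_linear(3)
    by (rule tl_comb_cong; simp add: algebra_simps power2_eq_square)+
  have vals: "x^3 - 3 * x - h * x = x" "x^4 - 4 * x^2 + 2 - h * (x^2 - 1) = x^2 - 2"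
    by (simp_all add: h_def algebra_simps eval_nat_numeral)
  show "\<Phi> (root_prod (chi q) (J2 (1/2) (1/2)) X) = 0"
  proof -
    have "J.eqv (root_prod (chi q) (J2 (1/2) (1/2)) (cst (x^3 - 3 * x) - cst h * r)) 0"
      by (rule J.root_prod_two[OF _ q_poly(1) rr]; simp only: vals J2_values) (simp_all add: chi_values)
    then show ?thesis
      by (simp only: X_eq[symmetric] eqv mat_hom_simps(5)[OF \<Phi>_hom])
  qed
  show "\<Phi> (root_prod (chi q) (J3 (1/2) (1/2) (1/2)) awK) = 0"
  proof -
    have "J.eqv (root_prod (chi q) (J3 (1/2) (1/2) (1/2)) (cst (x^4 - 4 * x^2 + 2) - cst h * y)) 0"
      by (rule J.root_prod_two[OF _ n yy]; simp only: vals J3_value) (simp_all add: chi_values)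
    then show ?thesis
      by (simp only: K_eq[symmetric] eqv mat_hom_simps(5)[OF \<Phi>_hom])
  qed
  show "\<Phi> (root_prod (\<lambda>m. m) (Mset q (1/2) (1/2) (1/2)) (awK - X)) = 0"
  proof -
    have "J.eqv (root_prod (\<lambda>m. m) (Mset q (1/2) (1/2) (1/2))
        ((cst (x^4 - 4 * x^2 + 2) - cst h * y) - (cst (x^3 - 3 * x) - cst h * r))) 0"
      by (rule J.root_prod_three[OF _ q_poly(1) n rr yy ry yr]; simp only: vals Mset_value) simp_all
    then show ?thesis
      by (simp only: K_eq[symmetric] X_eq[symmetric] eqv mat_hom_simps(5)[OF \<Phi>_hom])
  qed
qed

lemma tl_projections:
  "\<Phi> awA = mat_scale (x^3 - 3 * x) (mat 1) - mat_scale (x^2 - 4) (tl_comb S T 0 1 0 0 0)"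
  "\<Phi> awB = mat_scale (x^3 - 3 * x) (mat 1) - mat_scale (x^2 - 4) (tl_comb S T 0 0 1 0 0)"
  "\<Phi> awD = mat_scale (x^3 - 3 * x) (mat 1) - mat_scale (x^2 - 4) (tl_comb S T 0 1 1 (- inverse q) (- q))"
  "\<Phi> (awD' q) = mat_scale (x^3 - 3 * x) (mat 1) - mat_scale (x^2 - 4) (tl_comb S T 0 1 1 (- q) (- inverse q))"
  unfolding \<Phi>_awD' gen_image_D'_def \<Phi>_gen gen_image.simps tl_comb_linear(4)[of S T] tl_comb_linear(1-3)
  by (rule tl_comb_cong; simp)+

text \<open>The elements for D and D' are conjugates of e_2: (1 - q e_1)(1 - q^{-1} e_1) = 1, and (1
  - q^{-1} e_1) e_2 (1 - q e_1) = e_1 + e_2 - q^{-1} e_1 e_2 - q e_2 e_1; D' is obtained by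
  inverting q.\<close>

lemma tl_projections_square:
  "tl_comb S T 0 1 0 0 0 ** tl_comb S T 0 1 0 0 0 = mat_scale x (tl_comb S T 0 1 0 0 0)"
  "tl_comb S T 0 0 1 0 0 ** tl_comb S T 0 0 1 0 0 = mat_scale x (tl_comb S T 0 0 1 0 0)"
  "tl_comb S T 0 1 1 (- inverse q) (- q) ** tl_comb S T 0 1 1 (- inverse q) (- q) = mat_scale x (tl_comb S T 0 1 1 (- inverse q) (- q))"
  "tl_comb S T 0 1 1 (- q) (- inverse q) ** tl_comb S T 0 1 1 (- q) (- inverse q) = mat_scale x (tl_comb S T 0 1 1 (- q) (- inverse q))"
  unfolding tl_comb_mult tl_comb_linear(3)
  by (rule tl_comb_cong; simp add: q_normal)+

lemma \<Phi>_awbar_rels: "y \<in> awbar_rels q (1/2) (1/2) (1/2) \<Longrightarrow> \<Phi> y = 0"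
proof -
  note van = root_prods_vanish[OF tl_projections(1) refl tl_projections_square(1)]
    root_prods_vanish[OF tl_projections(2) refl tl_projections_square(2)]
    root_prods_vanish[OF tl_projections(3) refl tl_projections_square(3)]
    root_prods_vanish[OF tl_projections(4) refl tl_projections_square(4)]
  have alpha: "\<Phi> (gen g - cst (chi q (1/2))) = 0" if "g \<in> {ga1, ga2, ga3}" for g
    using that by (auto simp: mat_hom_simps[OF \<Phi>_hom] \<Phi>_gen chi_values tl_comb_def mat_scale_simps)
  show "\<Phi> y = 0" if "y \<in> awbar_rels q (1/2) (1/2) (1/2)"
    using that alpha unfolding awbar_rels_def
    by (elim insertE emptyE; simp only: van \<Phi>_Omega insert_iff simp_thms)
qed

end

subsection \<open>The isomorphism\<close>

context aw_quotient
begin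

section \<open>Five words span the quotient\<close>

definition comb :: "complex \<Rightarrow> complex \<Rightarrow> complex \<Rightarrow> complex \<Rightarrow> complex \<Rightarrow> aw_gen free_alg" where
  "comb a b c d e = cst a + cst b * e1 + cst c * e2 + cst d * (e1 * e2) + cst e * (e2 * e1)"

definition span :: "aw_gen free_alg set" where
  "span = {y. \<exists>a b c d e. y \<doteq> comb a b c d e}"

lemma span_eqv: "y \<doteq> z \<Longrightarrow> z \<in> span \<Longrightarrow> y \<in> span"
  unfolding span_def using eqv_trans by blast

lemma span_basis: "1 \<in> span" "e1 \<in> span" "e2 \<in> span" "e1 * e2 \<in> span" "e2 * e1 \<in> span"
proof -
  have *: "comb a b c d e \<in> span" for a b c d e
    unfolding span_def using eqv_refl by blast
  show "1 \<in> span" "e1 \<in> span" "e2 \<in> span" "e1 * e2 \<in> span" "e2 * e1 \<in> span"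
    using *[of 1 0 0 0 0] *[of 0 1 0 0 0] *[of 0 0 1 0 0] *[of 0 0 0 1 0] *[of 0 0 0 0 1]
    by (simp_all add: comb_def cst_simps)
qed

lemma span_add: "y + z \<in> span" if y: "y \<in> span" and z: "z \<in> span"
proof -
  obtain a b c d e where y: "y \<doteq> comb a b c d e"
    using y by (auto simp: span_def)
  obtain a' b' c' d' e' where z: "z \<doteq> comb a' b' c' d' e'"
    using z by (auto simp: span_def)
  have "comb a b c d e + comb a' b' c' d' e' = comb (a + a') (b + b') (c + c') (d + d') (e + e')"
    by (simp add: comb_def cst_simps distrib_right)
  then show ?thesis
    using eqv_add[OF y z] unfolding span_def by (simp only: mem_Collect_eq) blast
qed

lemma span_cst: "cst k * y \<in> span" if y: "y \<in> span"
proof -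
  obtain a b c d e where y: "y \<doteq> comb a b c d e"
    using y by (auto simp: span_def)
  have "cst k * comb a b c d e = comb (k * a) (k * b) (k * c) (k * d) (k * e)"
    by (simp add: comb_def cst_simps distrib_left mult.assoc)
  then show ?thesis
    using eqv_left[OF y, of "cst k"] unfolding span_def by (simp only: mem_Collect_eq) blast
qed

text \<open>Elements with this property are closed under sums, products and scalars, so checking the
  generators suffices; applying a stable element to 1 puts it into \<open>span\<close>.\<close>

definition stable :: "aw_gen free_alg \<Rightarrow> bool" where
  "stable y \<longleftrightarrow> (\<forall>z\<in>span. y * z \<in> span)"

lemma stable_eqv: "y \<doteq> z \<Longrightarrow> stable z \<Longrightarrow> stable y"
  unfolding stable_def using span_eqv eqv_right by blast

lemma stable_cst: "stable (cst k)"
  by (simp add: stable_def span_cst)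

lemma stable_add: "stable y \<Longrightarrow> stable z \<Longrightarrow> stable (y + z)"
  by (simp add: stable_def distrib_right span_add)

lemma stable_mult: "stable y \<Longrightarrow> stable z \<Longrightarrow> stable (y * z)"
  by (simp add: stable_def mult.assoc)

lemma stable_diff: "stable y \<Longrightarrow> stable z \<Longrightarrow> stable (y - z)"
  using stable_add[OF _ stable_mult[OF stable_cst[of "- 1"]], of y z] by (simp add: cst_simps)

lemmas stable_intros = stable_cst stable_add stable_mult stable_diff

lemma stable_basis:
  assumes "\<And>z. z \<in> {1, e1, e2, e1 * e2, e2 * e1} \<Longrightarrow> y * z \<in> span"
  shows "stable y"
  unfolding stable_def
proof
  fix z assume "z \<in> span"
  then obtain a b c d e where z: "z \<doteq> comb a b c d e"
    by (auto simp: span_def)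
  have "y * comb a b c d e = cst a * (y * 1) + cst b * (y * e1) + cst c * (y * e2)
      + cst d * (y * (e1 * e2)) + cst e * (y * (e2 * e1))"
    by (simp only: comb_def distrib_left cst_left_commute[of y] mult_1_right cst_commute[of y])
  also have "\<dots> \<in> span"
    by (intro span_add span_cst assms) auto
  finally show "y * z \<in> span"
    using span_eqv[OF eqv_left[OF z]] by blast
qed

lemma stable_tl: "stable e1" "stable e2"
proof -
  have 1: "e1 * (e1 * z) \<in> span" if "e1 * z \<in> span" for z
    by (rule span_eqv[OF _ span_cst[OF that, of x]]) (use eqv_right[OF tl_squares(1), of z] in \<open>simp only: mult.assoc\<close>)
  have 2: "e2 * (e2 * z) \<in> span" if "e2 * z \<in> span" for z
    by (rule span_eqv[OF _ span_cst[OF that, of x]]) (use eqv_right[OF tl_squares(2), of z] in \<open>simp only: mult.assoc\<close>)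
  have 3: "e1 * (e2 * e1) \<in> span" "e2 * (e1 * e2) \<in> span"
    using span_eqv[OF tl_relations(1) span_basis(2)] span_eqv[OF tl_relations(2) span_basis(3)]
    by (simp_all only: mult.assoc)
  show "stable e1" "stable e2"
    using span_basis 1[of 1] 2[of 1] 1[OF span_basis(4)] 2[OF span_basis(5)] 3
    by (auto intro!: stable_basis)
qed

lemma stable_gen: "stable (gen g)"
proof -
  have A: "stable awA" and B: "stable awB"
    by (subst eq_tl_gen, intro stable_intros stable_tl)+
  have K: "stable awK"
    by (rule stable_eqv[OF tl_relations(3)]) (intro stable_intros stable_tl)
  \<comment> \<open>The third Askey--Wilson relation eliminates D in favour of A, B and K.\<close>
  have "awD \<doteq> u - cst \<tau> * qcomm q awA awB"
    using aw_relations(3) by (simp add: eqv_def algebra_simps)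
  then have D: "stable awD"
    by (rule stable_eqv) (use A B K in \<open>auto simp: u_def qcomm_def intro!: stable_intros\<close>)
  show ?thesis
    using A B K D alpha[THEN stable_eqv, OF stable_cst] by (cases g) auto
qed

lemma span_UNIV: "y \<in> span"
proof -
  have "stable (mon w)" for w :: "aw_gen list"
  proof (induction w)
    case Nil
    have "(mon [] :: aw_gen free_alg) = cst 1"
      by (simp add: cst_def zero_list_def)
    then show ?case
      by (simp only: stable_cst)
  next
    case (Cons g w)
    have "(mon (g # w) :: aw_gen free_alg) = gen g * mon w"
      by (simp add: mult_single plus_list_def)
    then show ?case
      using stable_mult[OF stable_gen Cons] by simp
  qed
  then have "stable (cst c * mon w)" for c and w :: "aw_gen list"
    by (intro stable_intros)
  then have "stable y"
    by (induction y rule: poly_mapping_single_induct) (simp_all add: cst_mult_single stable_add)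
  then show ?thesis
    using span_basis(1) unfolding stable_def by (metis mult_1_right)
qed

text \<open>Stated for an arbitrary homomorphism because it evaluates both \<open>\<Phi>\<close> and
  the competing morphism in the uniqueness claim.\<close>

lemma mat_hom_comb:
  fixes k :: "aw_gen free_alg \<Rightarrow> complex^'n^'n"
  assumes k: "k \<in> mat_hom"
    and A: "k awA = mat_scale (x^3 - 3 * x) (mat 1) - mat_scale (x^2 - 4) M"
    and B: "k awB = mat_scale (x^3 - 3 * x) (mat 1) - mat_scale (x^2 - 4) N"
  shows "k (comb a b c d e) = tl_comb M N a b c d e"
proof -
  have tl: "k (tl_gen X) = R" if "k X = mat_scale (x^3 - 3 * x) (mat 1) - mat_scale (x^2 - 4) R" for X R
    using q_poly(2) by (simp add: tl_gen_def mat_hom_simps(4,7,8)[OF k] that mat_scale_simps)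
  show ?thesis
    by (simp add: comb_def tl_comb_def mat_hom_simps[OF k] tl[OF A] tl[OF B] mat_scale_simps)
qed

end

context spin_half
begin

sublocale generic_q q
  by unfold_locales (use q0 generic in auto)

theorem awbar_isomorphism:
  "\<exists>\<phi> \<in> alg_iso (AWbar q (1/2) (1/2) (1/2)) (centralizer q \<pi> \<pi> \<pi>).
     sends_generators q (1/2) (1/2) (1/2) \<phi> (C12 q \<pi> \<pi> \<pi>) (C23 q \<pi> \<pi> \<pi>) (C123 q \<pi> \<pi> \<pi>) \<and>
     (\<forall>\<psi> \<in> alg_hom (AWbar q (1/2) (1/2) (1/2)) (centralizer q \<pi> \<pi> \<pi>).
        sends_generators q (1/2) (1/2) (1/2) \<psi> (C12 q \<pi> \<pi> \<pi>) (C23 q \<pi> \<pi> \<pi>) (C123 q \<pi> \<pi> \<pi>) \<longrightarrow>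
        (\<forall>y \<in> carrier (AWbar q (1/2) (1/2) (1/2)). \<psi> y = \<phi> y))"
proof -
  obtain S T where
    TL: "S ** S = mat_scale (q + inverse q) S" "T ** T = mat_scale (q + inverse q) T"
      "S ** T ** S = S" "T ** S ** T = T"
    and casimirs:
      "C12 q \<pi> \<pi> \<pi> = mat_scale (q^3 + inverse q ^ 3) (mat 1) - mat_scale ((q - inverse q)^2) S"
      "C23 q \<pi> \<pi> \<pi> = mat_scale (q^3 + inverse q ^ 3) (mat 1) - mat_scale ((q - inverse q)^2) T"
      "C123 q \<pi> \<pi> \<pi> = mat_scale (q^4 + inverse q ^ 4) (mat 1) - mat_scale ((q - inverse q)^2)
         (mat_scale (q + inverse q) (S + T) - S ** T - T ** S)"
    and carrier: "\<forall>m. m \<in> carrier (centralizer q \<pi> \<pi> \<pi>) \<longleftrightarrow> (\<exists>a b c d e. m = tl_comb S T a b c d e)"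
    and indep: "\<forall>a b c d e. tl_comb S T a b c d e = 0 \<longrightarrow> a = 0 \<and> b = 0 \<and> c = 0 \<and> d = 0 \<and> e = 0"
    by (rule temperley_lieb)
  note C12 = casimirs(1)[unfolded x_powers] and C23 = casimirs(2)[unfolded x_powers]
    and C123 = casimirs(3)[unfolded x_powers, folded x_def]
  interpret aw_images q S T
    by unfold_locales (use TL in \<open>simp_all add: x_def\<close>)
  let ?I = "awbar_ideal q (1/2) (1/2) (1/2)"
  interpret mon_ideal ?I
    unfolding awbar_ideal_def by (rule mon_ideal_genideal)
  interpret aw: aw_quotient q ?I
    by unfold_locales (unfold awbar_ideal_def, rule genideal_superset)
  have \<Phi>_ideal: "\<Phi> y = 0" if "y \<in> ?I" for y
    using \<Phi>_hom _ that[unfolded awbar_ideal_def]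
    by (rule mat_hom_genideal) (use \<Phi>_aw3_rels \<Phi>_awbar_rels in blast)
  have \<Phi>A: "\<Phi> awA = C12 q \<pi> \<pi> \<pi>" and \<Phi>B: "\<Phi> awB = C23 q \<pi> \<pi> \<pi>" and \<Phi>K: "\<Phi> awK = C123 q \<pi> \<pi> \<pi>"
    by (simp_all add: \<Phi>_gen C12 C23 C123 tl_comb_def mat_scale_simps mat_scale_diff)
      (simp_all add: mat_scale_def vec_eq_iff algebra_simps)
  have \<Phi>_comb: "\<Phi> (aw.comb a b c d e) = tl_comb S T a b c d e" for a b c d e
    by (rule aw.mat_hom_comb[OF \<Phi>_hom \<Phi>A[unfolded C12] \<Phi>B[unfolded C23]])
  have span: "\<exists>a b c d e. y - aw.comb a b c d e \<in> ?I" for y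
    using aw.span_UNIV[of y] by (auto simp: aw.span_def eqv_def)
  have AW: "AWbar q (1/2) (1/2) (1/2) = mon_quot ?I"
    by (simp add: AWbar_def)
  \<comment> \<open>Modulo the ideal, \<open>y\<close> is a combination of the five words;
    independence of their images makes all coefficients zero.\<close>
  have inj: "y \<in> ?I" if "\<Phi> y = 0" for y
  proof -
    obtain a b c d e where y: "y - aw.comb a b c d e \<in> ?I"
      using span by blast
    have "tl_comb S T a b c d e = 0"
      using \<Phi>_ideal[OF y] that by (simp add: mat_hom_simps[OF \<Phi>_hom] \<Phi>_comb)
    then have "a = 0 \<and> b = 0 \<and> c = 0 \<and> d = 0 \<and> e = 0"
      using indep by blast
    then have "aw.comb a b c d e = 0"
      by (simp add: aw.comb_def cst_simps)
    then show ?thesis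
      using y by simp
  qed
  have \<Phi>_carrier: "\<Phi> y \<in> carrier (centralizer q \<pi> \<pi> \<pi>)" for y
  proof -
    obtain a b c d e where y: "y - aw.comb a b c d e \<in> ?I"
      using span by blast
    then have "\<Phi> y = tl_comb S T a b c d e"
      using \<Phi>_ideal[OF y] by (simp add: mat_hom_simps[OF \<Phi>_hom] \<Phi>_comb)
    then show ?thesis
      using carrier by blast
  qed
  define \<phi> where "\<phi> X = the_elem (\<Phi> ` X)" for X
  have \<phi>: "\<phi> (cls ?I y) = \<Phi> y" for y
    unfolding \<phi>_def by (rule the_elem_hom_cls[OF \<Phi>_hom \<Phi>_ideal])
  have cent: "centralizer q \<pi> \<pi> \<pi> = mat_alg\<lparr>carrier := carrier (centralizer q \<pi> \<pi> \<pi>)\<rparr>"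
    by (simp add: centralizer_def)
  have ops: "X \<otimes>\<^bsub>centralizer q \<pi> \<pi> \<pi>\<^esub> Y = X ** Y" "X \<oplus>\<^bsub>centralizer q \<pi> \<pi> \<pi>\<^esub> Y = X + Y"
    "\<one>\<^bsub>centralizer q \<pi> \<pi> \<pi>\<^esub> = mat 1" "k \<odot>\<^bsub>centralizer q \<pi> \<pi> \<pi>\<^esub> X = mat_scale k X" for X Y k
    by (simp_all add: centralizer_def mat_alg_def)
  have "\<phi> \<in> ring_hom (mon_quot ?I) (centralizer q \<pi> \<pi> \<pi>)"
  proof (rule ring_hom_memI)
    fix X assume "X \<in> carrier (mon_quot ?I)"
    then show "\<phi> X \<in> carrier (centralizer q \<pi> \<pi> \<pi>)"
      using \<Phi>_carrier by (auto simp: carrier_quot \<phi>)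
  next
    fix X Z assume "X \<in> carrier (mon_quot ?I)" "Z \<in> carrier (mon_quot ?I)"
    then obtain y z where yz: "X = cls ?I y" "Z = cls ?I z"
      by (auto simp: carrier_quot)
    show "\<phi> (X \<otimes>\<^bsub>mon_quot ?I\<^esub> Z) = \<phi> X \<otimes>\<^bsub>centralizer q \<pi> \<pi> \<pi>\<^esub> \<phi> Z"
      "\<phi> (X \<oplus>\<^bsub>mon_quot ?I\<^esub> Z) = \<phi> X \<oplus>\<^bsub>centralizer q \<pi> \<pi> \<pi>\<^esub> \<phi> Z"
      by (simp_all only: yz quot_ops ops \<phi> mat_hom_simps(1,2)[OF \<Phi>_hom])
  next
    show "\<phi> \<one>\<^bsub>mon_quot ?I\<^esub> = \<one>\<^bsub>centralizer q \<pi> \<pi> \<pi>\<^esub>"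
      by (simp only: quot_ops ops \<phi> mat_hom_simps(3)[OF \<Phi>_hom])
  qed
  moreover have "\<phi> (c \<odot>\<^bsub>mon_quot ?I\<^esub> X) = c \<odot>\<^bsub>centralizer q \<pi> \<pi> \<pi>\<^esub> \<phi> X"
    if X: "X \<in> carrier (mon_quot ?I)" for c X
  proof -
    obtain y where y: "X = cls ?I y"
      using X by (auto simp: carrier_quot)
    show ?thesis
      by (simp only: y quot_ops ops \<phi> mat_hom_simps(4)[OF \<Phi>_hom])
  qed
  ultimately have hom: "\<phi> \<in> alg_hom (mon_quot ?I) (centralizer q \<pi> \<pi> \<pi>)"
    by (simp add: alg_hom_def)
  have "bij_betw \<phi> (carrier (mon_quot ?I)) (carrier (centralizer q \<pi> \<pi> \<pi>))"
    unfolding bij_betw_def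
  proof
    show "inj_on \<phi> (carrier (mon_quot ?I))"
    proof (rule inj_onI)
      fix X Z assume XZ: "X \<in> carrier (mon_quot ?I)" "Z \<in> carrier (mon_quot ?I)" "\<phi> X = \<phi> Z"
      then obtain y z where yz: "X = cls ?I y" "Z = cls ?I z"
        by (auto simp: carrier_quot)
      then have "\<Phi> (y - z) = 0"
        using XZ(3) by (simp add: \<phi> mat_hom_simps[OF \<Phi>_hom])
      then show "X = Z"
        unfolding yz cls_eq_iff by (rule inj)
    qed
    show "\<phi> ` carrier (mon_quot ?I) = carrier (centralizer q \<pi> \<pi> \<pi>)"
    proof
      show "\<phi> ` carrier (mon_quot ?I) \<subseteq> carrier (centralizer q \<pi> \<pi> \<pi>)"
        using \<Phi>_carrier by (auto simp: carrier_quot \<phi>)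
      show "carrier (centralizer q \<pi> \<pi> \<pi>) \<subseteq> \<phi> ` carrier (mon_quot ?I)"
      proof
        fix m assume "m \<in> carrier (centralizer q \<pi> \<pi> \<pi>)"
        then obtain a b c d e where "m = tl_comb S T a b c d e"
          using carrier by blast
        then have "m = \<phi> (cls ?I (aw.comb a b c d e))"
          by (simp only: \<phi> \<Phi>_comb)
        then show "m \<in> \<phi> ` carrier (mon_quot ?I)"
          by (auto simp: carrier_quot)
      qed
    qed
  qed
  with hom have iso: "\<phi> \<in> alg_iso (mon_quot ?I) (centralizer q \<pi> \<pi> \<pi>)"
    by (simp add: alg_iso_def)
  have sends: "sends_generators q (1/2) (1/2) (1/2) \<phi> (C12 q \<pi> \<pi> \<pi>) (C23 q \<pi> \<pi> \<pi>) (C123 q \<pi> \<pi> \<pi>)"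
    by (simp add: sends_generators_def \<phi> \<Phi>A \<Phi>B \<Phi>K)
  have unique: "\<psi> X = \<phi> X"
    if \<psi>: "\<psi> \<in> alg_hom (mon_quot ?I) (centralizer q \<pi> \<pi> \<pi>)"
      and gens: "sends_generators q (1/2) (1/2) (1/2) \<psi> (C12 q \<pi> \<pi> \<pi>) (C23 q \<pi> \<pi> \<pi>) (C123 q \<pi> \<pi> \<pi>)"
      and X: "X \<in> carrier (mon_quot ?I)" for \<psi> X
  proof -
    \<comment> \<open>The centralizer differs from the full matrix algebra only in its carrier, so
      the morphism can be composed with the inclusion and treated as a matrix
      representation.\<close>
    have "\<psi> \<in> alg_hom (mon_quot ?I) mat_alg"
      using \<psi> by (subst (asm) cent) (auto simp: alg_hom_def ring_hom_def mat_alg_def)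
    note k = quot_hom[OF this]
    have k_comb: "\<psi> (cls ?I (aw.comb a b c d e)) = tl_comb S T a b c d e" for a b c d e
      using gens C12 C23 unfolding sends_generators_def
      by (intro aw.mat_hom_comb[OF k(1)]) simp_all
    obtain y where y: "X = cls ?I y"
      using X by (auto simp: carrier_quot)
    obtain a b c d e where "y - aw.comb a b c d e \<in> ?I"
      using span by blast
    then have "X = cls ?I (aw.comb a b c d e)"
      by (simp only: y cls_eq_iff)
    then show ?thesis
      by (simp only: k_comb \<phi> \<Phi>_comb)
  qed
  show ?thesis
    unfolding AW using iso sends unique by blast
qed

end

theorem theorem6p1:
  fixes q s :: complex and \<pi> :: "2 uq_rep"
  assumes "q \<noteq> 0" and "\<forall>n::nat. n > 0 \<longrightarrow> q ^ n \<noteq> 1" and "s ^ 2 = q"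
    and "spin_rep q s (1/2) \<pi>"
  shows "\<exists>\<phi> \<in> alg_iso (AWbar q (1/2) (1/2) (1/2)) (centralizer q \<pi> \<pi> \<pi>).
           sends_generators q (1/2) (1/2) (1/2) \<phi> (C12 q \<pi> \<pi> \<pi>) (C23 q \<pi> \<pi> \<pi>) (C123 q \<pi> \<pi> \<pi>) \<and>
           (\<forall>\<psi> \<in> alg_hom (AWbar q (1/2) (1/2) (1/2)) (centralizer q \<pi> \<pi> \<pi>).
              sends_generators q (1/2) (1/2) (1/2) \<psi> (C12 q \<pi> \<pi> \<pi>) (C23 q \<pi> \<pi> \<pi>) (C123 q \<pi> \<pi> \<pi>) \<longrightarrow>
              (\<forall>x \<in> carrier (AWbar q (1/2) (1/2) (1/2)). \<psi> x = \<phi> x))"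
  using spin_half.awbar_isomorphism[OF spin_half.intro[OF assms]] .

end
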